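(* Let $(X_i,Y_i,Z_i)_{i\ge1}$ be i.i.d. with law $P$ on $\mathbb R\times\mathbb R\times\mathbb R^d$, $d\ge1$, let $\mathcal H$ be a separable reproducing kernel Hilbert space of functions $\mathbb R^d\to\mathbb R$ with kernel $K$, and let $\epsilon_X(Z),\epsilon_Y(Z)$, $f,g$, the regression estimators $\widehat f,\widehat g$ and the residuals $\widehat\epsilon_{X_i}(Z_i),\widehat\epsilon_{Y_i}(Z_i)$ be as in the context. Assume: (i) $A_f=\frac1n\sum_{i=1}^n(f(Z_i)-\widehat f(Z_i))^2=o_p(n^{-1/2})$ and $A_g=\frac1n\sum_{i=1}^n(g(Z_i)-\widehat g(Z_i))^2=o_p(n^{-1/2})$; (ii) $u_f(z,y)=\mathbb E(\epsilon_X(Z)^2\mid Z=z,Y=y)$ and $v_g(z,x)=\mathbb E(\epsilon_Y(Z)^2\mid Z=z,X=x)$ are uniformly bounded; (iii) $0<\mathbb E(\epsilon_X(Z)^2\epsilon_Y(Z)^2)$; (iv) there is a constant $C>0$ with $|K(z,z')|\le C$ for all $z,z'\in\mathbb R^d$. Let $$\Psi_n=\sup_{\omega\in\mathcal H:\|\omega\|_{\mathcal H}=1}S_n(\omega)^2,\qquad S_n(\omega)=\frac1{\sqrt n}\sum_{i=1}^n\omega(Z_i)\,\widehat\epsilon_{X_i}(Z_i)\,\widehat\epsilon_{Y_i}(Z_i).$$ Then, under the null hypothesis that $X$ and $Y$ are conditionally independent given $Z$, as $n\to\infty$, $$\Psi_n\overset{\mathcal D}{\to}\sum_{i=1}^\infty\lambda_iQ_i^2,$$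 where $Q_1,Q_2,\dots$ are i.i.d. standard normal random variables and $\lambda_1,\lambda_2,\dots$ are the eigenvalues (with multiplicity) of the operator $T_\sigma:\mathcal H\to\mathcal H$, $(T_\sigma\omega)(z)=\sigma(\omega,K(z,\cdot))$, with $$\sigma(\omega,\omega')=\int_{\mathbb R^d}\omega(z)\omega'(z)\,\mathbb E(\epsilon_X(Z)^2\mid Z=z)\,\mathbb E(\epsilon_Y(Z)^2\mid Z=z)\,dF_Z(z).$$
   Context: $(X,Y,Z)\sim P$ with $X,Y$ integrable; $f(z)=\mathbb E(X\mid Z=z)$, $g(z)=\mathbb E(Y\mid Z=z)$, $\epsilon_X(Z)=X-f(Z)$, $\epsilon_Y(Z)=Y-g(Z)$; $F_Z$ is the law of $Z$. For each $n$, $\widehat f$ is an estimator of $f$ computed only from $(X_i,Z_i)_{i=1}^n$, and $\widehat g$ is an estimator of $g$ computed only from $(Y_i,Z_i)_{i=1}^n$. Residuals: $\widehat\epsilon_{X_i}(Z_i)=X_i-\widehat f(Z_i)$, $\widehat\epsilon_{Y_i}(Z_i)=Y_i-\widehat g(Z_i)$. All functions in $\mathcal H$ are Borel measurable. $\overset{\mathcal D}{\to}$ is convergence in distribution and $o_p$ is the usual stochastic order notation as $n\to\infty$. *)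

theory Defs
  imports "HOL-Probability.Probability"
begin

text \<open>
  A reproducing kernel Hilbert space of functions on \<open>'a\<close> is a Hilbert space \<open>'h\<close> together with
  the map \<open>fval\<close> sending an element of \<open>'h\<close> to the function it is. The element \<open>k\<close> below is
  \<open>K(z,\<cdot>)\<close>. Injectivity of \<open>fval\<close> says that elements of the space are functions; linearity in
  \<open>bounded_linear\<close> says that the vector space operations are the pointwise ones.
\<close>

locale rkhs =
  fixes fval :: "'h::{real_inner, complete_space} \<Rightarrow> 'a \<Rightarrow> real"
    and K :: "'a \<Rightarrow> 'a \<Rightarrow> real"
  assumes inj_fval: "inj fval"
    and bounded_linear_fval: "\<And>z. bounded_linear (\<lambda>w. fval w z)"
    and reproducing: "\<And>z. \<exists>k. fval k = K z \<and> (\<forall>w. fval w z = w \<bullet> k)"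

text \<open>
  \<open>h\<close> is a version of \<open>w \<mapsto> E(V | W = w)\<close>. Integrability of \<open>V\<close> is part of the notion, because
  \<open>real_cond_exp\<close> takes junk values where the conditional expectation is infinite.
\<close>

definition cond_exp_version ::
  "'m measure \<Rightarrow> ('m \<Rightarrow> real) \<Rightarrow> ('m \<Rightarrow> 'b::topological_space) \<Rightarrow> ('b \<Rightarrow> real) \<Rightarrow> bool" where
  "cond_exp_version M V W h \<longleftrightarrow>
     integrable M V \<and> h \<in> borel_measurable borel \<and>
     (AE x in M. real_cond_exp M (vimage_algebra (space M) W borel) V x = h (W x))"

definition cond_indep_given ::
  "'m measure \<Rightarrow> ('m \<Rightarrow> 'a::topological_space) \<Rightarrow> ('m \<Rightarrow> 'b::topological_space) \<Rightarrow>
   ('m \<Rightarrow> 'c::topological_space) \<Rightarrow> bool" where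
  "cond_indep_given M X Y Z \<longleftrightarrow>
     (let F = vimage_algebra (space M) Z borel in
      \<forall>A\<in>sets borel. \<forall>B\<in>sets borel. AE x in M.
        real_cond_exp M F (\<lambda>x. indicator A (X x) * indicator B (Y x)) x =
        real_cond_exp M F (\<lambda>x. indicator A (X x)) x * real_cond_exp M F (\<lambda>x. indicator B (Y x)) x)"

definition small_o_p :: "'m measure \<Rightarrow> (nat \<Rightarrow> 'm \<Rightarrow> real) \<Rightarrow> (nat \<Rightarrow> real) \<Rightarrow> bool" where
  "small_o_p M A r \<longleftrightarrow>
     (\<forall>e>0. (\<lambda>n. measure M {x \<in> space M. \<bar>A n x\<bar> > e * r n}) \<longlonglongrightarrow> 0)"

definition converges_in_distribution ::
  "'m measure \<Rightarrow> (nat \<Rightarrow> 'm \<Rightarrow> real) \<Rightarrow> 'q measure \<Rightarrow> ('q \<Rightarrow> real) \<Rightarrow> bool" where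
  "converges_in_distribution M A N L \<longleftrightarrow>
     (\<forall>n. A n \<in> borel_measurable M) \<and> L \<in> borel_measurable N \<and>
     weak_conv_m (\<lambda>n. distr M borel (A n)) (distr N borel L)"

abbreviation xc :: "real \<times> real \<times> 'c \<Rightarrow> real" where "xc p \<equiv> fst p"
abbreviation yc :: "real \<times> real \<times> 'c \<Rightarrow> real" where "yc p \<equiv> fst (snd p)"
abbreviation zc :: "real \<times> real \<times> 'c \<Rightarrow> 'c" where "zc p \<equiv> snd (snd p)"

definition eps ::
  "(real \<times> real \<times> 'c \<Rightarrow> real) \<Rightarrow> ('c \<Rightarrow> real) \<Rightarrow> real \<times> real \<times> 'c \<Rightarrow> real" where
  "eps r h p = r p - h (zc p)"

text \<open>
  An estimator is a family \<open>est\<close>, where \<open>est n D\<close> is the function fitted to the data set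
  \<open>D\<close> of \<open>n\<close> (response, covariate) pairs, indexed by \<open>{..<n}\<close>. The only measurability required is
  that the fitted values at the covariates in the data are measurable functions of the data.
\<close>

type_synonym 'c estimator = "nat \<Rightarrow> (nat \<Rightarrow> real \<times> 'c) \<Rightarrow> 'c \<Rightarrow> real"

definition regression_estimator :: "'c::topological_space estimator \<Rightarrow> bool" where
  "regression_estimator est \<longleftrightarrow>
     (\<forall>n. \<forall>i<n. (\<lambda>D. est n D (snd (D i))) \<in> borel_measurable (\<Pi>\<^sub>M i\<in>{..<n}. borel))"

text \<open>
  For a response coordinate \<open>r\<close> (\<open>xc\<close> or \<open>yc\<close>) and a sample \<open>W\<close>: the fitted function, the
  mean squared error of the fitted values, and the residuals. Restricting the data to \<open>{..<n}\<close>
  ensures that only the first \<open>n\<close> pairs are used.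
\<close>

definition fitted ::
  "(real \<times> real \<times> 'c \<Rightarrow> real) \<Rightarrow> 'c estimator \<Rightarrow> (nat \<Rightarrow> 'm \<Rightarrow> real \<times> real \<times> 'c) \<Rightarrow>
   nat \<Rightarrow> 'm \<Rightarrow> 'c \<Rightarrow> real" where
  "fitted r est W n x = est n (\<lambda>i\<in>{..<n}. (r (W i x), zc (W i x)))"

definition mean_sq_error ::
  "(real \<times> real \<times> 'c \<Rightarrow> real) \<Rightarrow> 'c estimator \<Rightarrow> ('c \<Rightarrow> real) \<Rightarrow>
   (nat \<Rightarrow> 'm \<Rightarrow> real \<times> real \<times> 'c) \<Rightarrow> nat \<Rightarrow> 'm \<Rightarrow> real" where
  "mean_sq_error r est h W n x =
     (1 / real n) * (\<Sum>i<n. (h (zc (W i x)) - fitted r est W n x (zc (W i x)))\<^sup>2)"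

definition residual ::
  "(real \<times> real \<times> 'c \<Rightarrow> real) \<Rightarrow> 'c estimator \<Rightarrow> (nat \<Rightarrow> 'm \<Rightarrow> real \<times> real \<times> 'c) \<Rightarrow>
   nat \<Rightarrow> nat \<Rightarrow> 'm \<Rightarrow> real" where
  "residual r est W n i x = r (W i x) - fitted r est W n x (zc (W i x))"

definition S_stat ::
  "('h \<Rightarrow> 'c \<Rightarrow> real) \<Rightarrow> 'c estimator \<Rightarrow> 'c estimator \<Rightarrow>
   (nat \<Rightarrow> 'm \<Rightarrow> real \<times> real \<times> 'c) \<Rightarrow> nat \<Rightarrow> 'm \<Rightarrow> 'h \<Rightarrow> real" where
  "S_stat fval fhat ghat W n x w =
     (1 / sqrt (real n)) *
     (\<Sum>i<n. fval w (zc (W i x)) * residual xc fhat W n i x * residual yc ghat W n i x)"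

text \<open>
  The supremum is taken in \<open>[0,\<infinity>]\<close>, so that it is \<open>0\<close> (rather than unspecified) for the zero
  space, which has no unit vectors. It is always finite, because point evaluations are bounded.
\<close>

definition Psi_stat ::
  "('h::real_normed_vector \<Rightarrow> 'c \<Rightarrow> real) \<Rightarrow> 'c estimator \<Rightarrow> 'c estimator \<Rightarrow>
   (nat \<Rightarrow> 'm \<Rightarrow> real \<times> real \<times> 'c) \<Rightarrow> nat \<Rightarrow> 'm \<Rightarrow> real" where
  "Psi_stat fval fhat ghat W n x =
     enn2real (SUP w\<in>{w. norm w = 1}. ennreal ((S_stat fval fhat ghat W n x w)\<^sup>2))"

definition sigma_form ::
  "'c measure \<Rightarrow> ('c \<Rightarrow> real) \<Rightarrow> ('c \<Rightarrow> real) \<Rightarrow> ('c \<Rightarrow> real) \<Rightarrow> ('c \<Rightarrow> real) \<Rightarrow> real" where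
  "sigma_form F sX sY a b = (\<integral>z. a z * b z * sX z * sY z \<partial>F)"

definition T_sigma ::
  "('h \<Rightarrow> 'c \<Rightarrow> real) \<Rightarrow> ('c \<Rightarrow> 'c \<Rightarrow> real) \<Rightarrow> 'c measure \<Rightarrow> ('c \<Rightarrow> real) \<Rightarrow> ('c \<Rightarrow> real) \<Rightarrow>
   'h \<Rightarrow> 'h" where
  "T_sigma fval K F sX sY w = inv fval (\<lambda>z. sigma_form F sX sY (fval w) (K z))"

text \<open>
  \<open>lam\<close> lists the eigenvalues of \<open>T\<close>: each \<open>\<mu> \<noteq> 0\<close> occurs exactly as often as the dimension of
  \<open>{v. T v = \<mu> v}\<close> (so not at all if it is not an eigenvalue). The number of zeros in the list is
  left free, so that operators of finite rank are covered.
\<close>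

definition eigenvalue_sequence :: "('h::real_vector \<Rightarrow> 'h) \<Rightarrow> (nat \<Rightarrow> real) \<Rightarrow> bool" where
  "eigenvalue_sequence T lam \<longleftrightarrow>
     (\<forall>\<mu>. \<mu> \<noteq> 0 \<longrightarrow>
        (\<exists>B b. independent B \<and> span B = {v. T v = \<mu> *\<^sub>R v} \<and> bij_betw b {i. lam i = \<mu>} B))"

end

theory Submission
  imports Defs "HOL-Library.Diagonal_Subsequence"
begin

text \<open>
  Let \<open>k(z)\<close> be the element \<open>K(z,\<cdot>)\<close> and \<open>\<kappa> = \<epsilon>\<^sub>X \<epsilon>\<^sub>Y k(Z)\<close>. Then \<open>\<Psi>\<^sub>n\<close> is the squared norm of
  a vector which differs from \<open>V\<^sub>n = n\<^bsup>-1/2\<^esup> \<Sum> \<kappa>\<^sub>i\<close> by three terms: two are sums of noise of one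
  regression weighted by the errors of the other, which are small by orthogonality of the noise given
  the data of the other regression, and the third is bounded by \<open>\<surd>n (A\<^sub>f + A\<^sub>g)\<close>. Under the null hypothesis
  \<open>\<kappa>\<close> is centred with covariance operator \<open>T\<^sub>\<sigma>\<close>. Expanding \<open>V\<^sub>n\<close> in eigenvectors of this trace class
  operator leaves a finite sum of squares and a remainder whose mean is a tail of the trace, so it suffices
  to find the limit of the Laplace transform of the finite sum. The latter is a Gaussian mixture
  of characteristic functions of linear forms in \<open>V\<^sub>n\<close>, whence the one-dimensional central limit theorem
  applies. On nonnegative random variables, convergence of Laplace transforms gives convergence
  in distribution.
\<close>


section \<open>Hilbert spaces\<close>

text \<open>Each estimator is evaluated on the sample it was fitted to, so the error at observation
  i depends on all the pairs (X_j, Z_j). What saves the terms linear in the errors is that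
  \<open>fhat\<close> never sees Y: with all pairs (X_j, Z_j) frozen the errors are constants, and
  the null hypothesis makes the noise of Y centred given (Z, X), not merely given Z. The same
  sharpening centres \<kappa>. These terms therefore vanish as soon as the mean squared errors do;
  the rate n^(-1/2) is used up by the product of the two errors, where no cancellation is available.
  Laplace transforms fit a squared norm: after Gaussian mixing only single linear forms of V_n
  occur, so neither joint convergence of coordinates nor tightness in the Hilbert space has to be
  discussed. The eigenvectors used span only a complement of the kernel of T. This does no harm,
  because \<kappa> is almost surely orthogonal to that kernel, and so the trace identity still holds
  with equality.\<close>

lemma riesz_representation:
  fixes \<phi> :: "'h::{real_inner, complete_space} \<Rightarrow> real"
  assumes "bounded_linear \<phi>"
  shows "\<exists>v. \<forall>w. \<phi> w = v \<bullet> w"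
proof -
  interpret bounded_linear \<phi> by fact
  obtain B where B: "B > 0" "\<And>x. \<bar>\<phi> x\<bar> \<le> norm x * B"
    using pos_bounded by auto
  \<comment> \<open>If u represents \<open>\<phi>\<close>, then J v = |v - u|^2 - |u|^2; the
    representing vector is therefore sought as a minimiser of J.\<close>
  define J where "J v = v \<bullet> v - 2 * \<phi> v" for v
  have lower: "J v \<ge> - B\<^sup>2" for v
  proof -
    have "2 * \<phi> v \<le> 2 * (norm v * B)"
      using B(2)[of v] by linarith
    also have "\<dots> \<le> (norm v)\<^sup>2 + B\<^sup>2"
      using zero_le_power2[of "norm v - B"] by (simp add: power2_diff)
    finally show ?thesis unfolding J_def by (simp add: power2_norm_eq_inner)
  qed
  have bdd: "bdd_below (range J)"
    using lower by (intro bdd_belowI) auto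
  define m where "m = Inf (range J)"
  have m_le: "m \<le> J v" for v
    unfolding m_def using bdd by (intro cInf_lower) auto
  have "\<exists>v. J v < m + inverse (real (Suc n))" for n
    using cInf_lessD[of "range J" "m + inverse (real (Suc n))"] unfolding m_def by auto
  then obtain v where v: "\<And>n. J (v n) < m + inverse (real (Suc n))" by metis
  \<comment> \<open>Parallelogram law: J at the midpoint is at least m, which forces a minimising
    sequence to be Cauchy.\<close>
  have gap: "(norm (x - y))\<^sup>2 \<le> 2 * (J x - m) + 2 * (J y - m)" for x y
  proof -
    define z where "z = (1/2) *\<^sub>R (x + y)"
    have "(norm (x - y))\<^sup>2 = 2 * J x + 2 * J y - 4 * J z"
      unfolding J_def power2_norm_eq_inner z_def
      by (simp add: scaleR add inner_simps inner_commute field_simps)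
    moreover have "m \<le> J z" by (rule m_le)
    ultimately show ?thesis by argo
  qed
  have "Cauchy v"
  proof (rule metric_CauchyI)
    fix e :: real assume "e > 0"
    obtain N where N: "inverse (real (Suc N)) < e\<^sup>2 / 4"
      using reals_Archimedean[of "e\<^sup>2 / 4"] \<open>e > 0\<close> by auto
    have "dist (v i) (v j) < e" if "i \<ge> N" "j \<ge> N" for i j
    proof -
      have "inverse (real (Suc k)) \<le> inverse (real (Suc N))" if "k \<ge> N" for k
        using that by (simp add: field_simps)
      with that have "inverse (real (Suc i)) \<le> inverse (real (Suc N))"
        "inverse (real (Suc j)) \<le> inverse (real (Suc N))" by blast+
      then have "(norm (v i - v j))\<^sup>2 < e\<^sup>2"
        using gap[of "v i" "v j"] v[of i] v[of j] N by argo
      then show ?thesis using \<open>e > 0\<close> by (simp add: dist_norm power2_less_imp_less)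
    qed
    then show "\<exists>N. \<forall>m\<ge>N. \<forall>n\<ge>N. dist (v m) (v n) < e" by blast
  qed
  then obtain u where u: "v \<longlonglongrightarrow> u"
    using Cauchy_convergent by (auto simp: convergent_def)
  have "(\<lambda>n. J (v n)) \<longlonglongrightarrow> J u"
    unfolding J_def by (intro tendsto_intros u tendsto)
  moreover have "(\<lambda>n. m + inverse (real (Suc n))) \<longlonglongrightarrow> m"
    using LIMSEQ_inverse_real_of_nat_add .
  ultimately have Ju: "J u \<le> m"
    using v by (intro LIMSEQ_le) (auto intro: less_imp_le)
  have "\<phi> w = u \<bullet> w" for w
  proof (rule ccontr)
    assume neq: "\<phi> w \<noteq> u \<bullet> w"
    define d where "d = \<phi> w - u \<bullet> w"
    have "w \<noteq> 0" using neq zero by auto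
    \<comment> \<open>The minimiser of the quadratic t -> J (u + t w); the value drops by exactly
      d^2 / (w \<bullet> w).\<close>
    define t where "t = d / (w \<bullet> w)"
    have "J (u + t *\<^sub>R w) = J u - 2 * t * d + t\<^sup>2 * (w \<bullet> w)"
      unfolding J_def d_def
      by (simp add: scaleR add inner_simps inner_commute power2_eq_square algebra_simps)
    also have "\<dots> = J u - d\<^sup>2 / (w \<bullet> w)"
      using \<open>w \<noteq> 0\<close> unfolding t_def by (simp add: power2_eq_square field_simps)
    also have "\<dots> < J u"
      using neq \<open>w \<noteq> 0\<close> unfolding d_def by (simp add: zero_less_divide_iff)
    finally show False using Ju m_le[of "u + t *\<^sub>R w"] by linarith
  qed
  then show ?thesis by blast
qed

text \<open>Diagonal extraction makes the inner products with a countable dense set converge, the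
  norm bound extends this to every w, and Riesz represents the limit functional. The unit ball need
  not be norm compact, so this is the compactness with which a maximiser of a quadratic form is
  found.\<close>

lemma weak_sequential_compactness:
  fixes v :: "nat \<Rightarrow> 'h::{real_inner, complete_space, second_countable_topology}"
  assumes v: "\<And>n. norm (v n) \<le> 1"
  shows "\<exists>r u. strict_mono r \<and> norm u \<le> 1 \<and> (\<forall>w. (\<lambda>n. v (r n) \<bullet> w) \<longlonglongrightarrow> u \<bullet> w)"
proof -
  obtain D :: "'h set" where D: "countable D"
    and dense: "\<And>X. open X \<Longrightarrow> X \<noteq> {} \<Longrightarrow> \<exists>d\<in>D. d \<in> X"
    using countable_dense_setE by blast
  have "D \<noteq> {}" using dense[of UNIV] by auto
  define d where "d = from_nat_into D"
  have range_d: "range d = D"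
    unfolding d_def using D \<open>D \<noteq> {}\<close> by (simp add: range_from_nat_into)
  interpret subseqs "\<lambda>k s. convergent (\<lambda>n. v (s n) \<bullet> d k)"
  proof
    fix k and s :: "nat \<Rightarrow> nat"
    have "bounded (range (\<lambda>n. v (s n) \<bullet> d k))"
    proof (rule boundedI)
      fix x assume "x \<in> range (\<lambda>n. v (s n) \<bullet> d k)"
      then obtain n where "x = v (s n) \<bullet> d k" by auto
      then have "norm x \<le> norm (v (s n)) * norm (d k)"
        using Cauchy_Schwarz_ineq2 by simp
      also have "\<dots> \<le> 1 * norm (d k)" using v by (intro mult_right_mono) auto
      finally show "norm x \<le> norm (d k)" by simp
    qed
    from bounded_imp_convergent_subsequence[OF this]
    obtain l r where "strict_mono r" "((\<lambda>n. v (s n) \<bullet> d k) \<circ> r) \<longlonglongrightarrow> l" by auto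
    then show "\<exists>r'. strict_mono r' \<and> convergent (\<lambda>n. v ((s \<circ> r') n) \<bullet> d k)"
      by (auto simp: convergent_def o_def)
  qed
  define r where "r = diagseq"
  have r: "strict_mono r" unfolding r_def by (rule subseq_diagseq)
  have conv_d: "convergent (\<lambda>n. v (r n) \<bullet> d k)" for k
  proof -
    \<comment> \<open>The diagonal sequence is a subsequence of the one extracted for
      \<open>d k\<close> only after its first terms are dropped; the shift by \<open>Suc k\<close>
      drops them, and convergence ignores it.\<close>
    have "convergent (\<lambda>n. v ((diagseq \<circ> ((+) (Suc k))) n) \<bullet> d k)"
    proof (rule diagseq_holds)
      fix r s :: "nat \<Rightarrow> nat" and n :: nat
      assume "strict_mono r" "convergent (\<lambda>na. v (s na) \<bullet> d n)"
      then show "convergent (\<lambda>na. v ((s \<circ> r) na) \<bullet> d n)"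
        using convergent_subseq_convergent[of "\<lambda>na. v (s na) \<bullet> d n" r] by (simp add: o_def)
    qed
    then have "convergent (\<lambda>n. v (r (n + Suc k)) \<bullet> d k)"
      by (simp add: r_def o_def add.commute)
    then show ?thesis
      using convergent_ignore_initial_segment[of "\<lambda>n. v (r n) \<bullet> d k" "Suc k"] by simp
  qed
  have conv: "convergent (\<lambda>n. v (r n) \<bullet> w)" for w
  proof -
    have "Cauchy (\<lambda>n. v (r n) \<bullet> w)"
    proof (rule metric_CauchyI)
      fix e :: real assume "e > 0"
      then obtain x where x: "x \<in> D" "x \<in> ball w (e/4)"
        using dense[of "ball w (e/4)"] by auto
      then obtain k where k: "x = d k" using range_d by auto
      have close: "\<bar>v n \<bullet> w - v n \<bullet> x\<bar> < e/4" for n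
      proof -
        have "\<bar>v n \<bullet> w - v n \<bullet> x\<bar> = \<bar>v n \<bullet> (w - x)\<bar>" by (simp add: inner_diff_right)
        also have "\<dots> \<le> norm (v n) * norm (w - x)" by (rule Cauchy_Schwarz_ineq2)
        also have "\<dots> \<le> 1 * norm (w - x)" using v by (intro mult_right_mono) auto
        also have "\<dots> < e/4" using x(2) by (simp add: dist_norm)
        finally show ?thesis .
      qed
      have "Cauchy (\<lambda>n. v (r n) \<bullet> x)"
        using conv_d k convergent_Cauchy by blast
      from metric_CauchyD[OF this, of "e/4"] \<open>e > 0\<close>
      obtain N where N: "\<And>m n. m \<ge> N \<Longrightarrow> n \<ge> N \<Longrightarrow> dist (v (r m) \<bullet> x) (v (r n) \<bullet> x) < e/4"
        by auto
      have "dist (v (r m) \<bullet> w) (v (r n) \<bullet> w) < e" if "m \<ge> N" "n \<ge> N" for m n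
        using N[OF that] close[of "r m"] close[of "r n"] \<open>e > 0\<close> unfolding dist_real_def by linarith
      then show "\<exists>N. \<forall>m\<ge>N. \<forall>n\<ge>N. dist (v (r m) \<bullet> w) (v (r n) \<bullet> w) < e" by blast
    qed
    then show ?thesis by (rule Cauchy_convergent)
  qed
  define \<phi> where "\<phi> w = lim (\<lambda>n. v (r n) \<bullet> w)" for w
  have \<phi>: "(\<lambda>n. v (r n) \<bullet> w) \<longlonglongrightarrow> \<phi> w" for w
    using conv[of w] unfolding \<phi>_def convergent_LIMSEQ_iff .
  have \<phi>_le: "\<bar>\<phi> w\<bar> \<le> norm w" for w
  proof -
    have "(\<lambda>n. \<bar>v (r n) \<bullet> w\<bar>) \<longlonglongrightarrow> \<bar>\<phi> w\<bar>" by (intro tendsto_intros \<phi>)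
    moreover have "\<bar>v (r n) \<bullet> w\<bar> \<le> norm w" for n
      using Cauchy_Schwarz_ineq2[of "v (r n)" w] mult_right_mono[OF v[of "r n"], of "norm w"]
      by simp
    ultimately show ?thesis by (intro LIMSEQ_le_const2) auto
  qed
  have "bounded_linear \<phi>"
  proof (rule bounded_linear_intro[where K = 1])
    show "\<phi> (x + y) = \<phi> x + \<phi> y" for x y
      by (rule LIMSEQ_unique[OF \<phi>]) (simp add: inner_add_right, intro tendsto_intros \<phi>)
    show "\<phi> (c *\<^sub>R x) = c *\<^sub>R \<phi> x" for c x
      by (rule LIMSEQ_unique[OF \<phi>]) (simp, intro tendsto_intros \<phi>)
  qed (use \<phi>_le in simp)
  then obtain u where u: "\<And>w. \<phi> w = u \<bullet> w" using riesz_representation by blast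
  have "norm u \<le> 1"
  proof (cases "u = 0")
    case False
    have "norm u * norm u \<le> 1 * norm u"
      using \<phi>_le[of u] u[of u] by (simp add: dot_square_norm power2_eq_square)
    with False show ?thesis by (simp add: mult_le_cancel_right)
  qed simp
  then show ?thesis using r \<phi> u by auto
qed

section \<open>Orthonormal systems\<close>

text \<open>Zero vectors are allowed in \<open>e\<close>, so that finite systems are sequences, too.\<close>

definition orthonormal_or_zero :: "('i \<Rightarrow> 'h::real_inner) \<Rightarrow> bool" where
  "orthonormal_or_zero e \<longleftrightarrow> (\<forall>i. e i \<noteq> 0 \<longrightarrow> norm (e i) = 1) \<and> (\<forall>i j. i \<noteq> j \<longrightarrow> e i \<bullet> e j = 0)"

lemma orthonormal_or_zero_norm_diff:
  assumes e: "orthonormal_or_zero e" and "finite A"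
  shows "(norm (x - (\<Sum>i\<in>A. (x \<bullet> e i) *\<^sub>R e i)))\<^sup>2 = (norm x)\<^sup>2 - (\<Sum>i\<in>A. (x \<bullet> e i)\<^sup>2)"
proof -
  define y where "y = (\<Sum>i\<in>A. (x \<bullet> e i) *\<^sub>R e i)"
  have self: "e i \<bullet> e i = 1 \<or> e i = 0" for i
    using e unfolding orthonormal_or_zero_def by (auto simp: dot_square_norm)
  have y_e: "y \<bullet> e j = x \<bullet> e j" if "j \<in> A" for j
  proof -
    have "y \<bullet> e j = (\<Sum>i\<in>A. (x \<bullet> e i) * (e i \<bullet> e j))"
      unfolding y_def by (simp add: inner_sum_left)
    also have "\<dots> = (\<Sum>i\<in>A. if i = j then (x \<bullet> e j) * (e j \<bullet> e j) else 0)"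
      using e unfolding orthonormal_or_zero_def by (intro sum.cong) auto
    also have "\<dots> = x \<bullet> e j"
      using that \<open>finite A\<close> self[of j] by auto
    finally show ?thesis .
  qed
  have xy: "x \<bullet> y = (\<Sum>i\<in>A. (x \<bullet> e i)\<^sup>2)"
    unfolding y_def by (simp add: inner_sum_right power2_eq_square)
  have yy: "y \<bullet> y = (\<Sum>i\<in>A. (x \<bullet> e i)\<^sup>2)"
  proof -
    have "y \<bullet> y = (\<Sum>i\<in>A. (x \<bullet> e i) * (y \<bullet> e i))"
      by (subst (2) y_def) (simp add: inner_sum_right)
    also have "\<dots> = (\<Sum>i\<in>A. (x \<bullet> e i)\<^sup>2)"
      using y_e by (simp add: power2_eq_square)
    finally show ?thesis .
  qed
  show ?thesis
    unfolding y_def[symmetric] power2_norm_eq_inner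
    using xy yy by (simp add: inner_diff_left inner_diff_right inner_commute)
qed

lemma bessel_inequality:
  assumes "orthonormal_or_zero e" and "finite A"
  shows "(\<Sum>i\<in>A. (x \<bullet> e i)\<^sup>2) \<le> (norm x)\<^sup>2"
  using orthonormal_or_zero_norm_diff[OF assms, of x] by (metis diff_ge_0_iff_ge zero_le_power2)

text \<open>By Bessel's inequality the partial sums are Cauchy. The limit is the projection of x to
  the closed span of the system, which need not be the whole space.\<close>

lemma orthonormal_projection:
  fixes e :: "nat \<Rightarrow> 'h::{real_inner, complete_space}"
  assumes e: "orthonormal_or_zero e"
  shows "\<exists>y. (\<lambda>n. \<Sum>i<n. (x \<bullet> e i) *\<^sub>R e i) \<longlonglongrightarrow> y \<and> (\<forall>i. y \<bullet> e i = x \<bullet> e i)"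
proof -
  define s where "s n = (\<Sum>i<n. (x \<bullet> e i) *\<^sub>R e i)" for n
  have self: "e i \<bullet> e i = 1 \<or> e i = 0" for i
    using e unfolding orthonormal_or_zero_def by (auto simp: dot_square_norm)
  have s_e: "s n \<bullet> e j = (if j < n then x \<bullet> e j else 0)" for n j
  proof -
    have "s n \<bullet> e j = (\<Sum>i<n. (x \<bullet> e i) * (e i \<bullet> e j))"
      unfolding s_def by (simp add: inner_sum_left)
    also have "\<dots> = (\<Sum>i<n. if i = j then (x \<bullet> e j) * (e j \<bullet> e j) else 0)"
      using e unfolding orthonormal_or_zero_def by (intro sum.cong) auto
    also have "\<dots> = (if j < n then x \<bullet> e j else 0)" using self[of j] by auto
    finally show ?thesis .
  qed
  have "(\<lambda>i. (x \<bullet> e i)\<^sup>2) sums (\<Sum>i. (x \<bullet> e i)\<^sup>2)"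
    using bessel_inequality[OF e, of _ x]
    by (intro summable_sums summableI_nonneg_bounded[where x = "(norm x)\<^sup>2"]) auto
  then have "Cauchy (\<lambda>n. \<Sum>i<n. (x \<bullet> e i)\<^sup>2)"
    unfolding sums_def by (rule LIMSEQ_imp_Cauchy)
  have s_diff: "(norm (s n - s m))\<^sup>2 = (\<Sum>i<n. (x \<bullet> e i)\<^sup>2) - (\<Sum>i<m. (x \<bullet> e i)\<^sup>2)" if "m \<le> n" for m n
  proof -
    have inn: "s k \<bullet> s l = (\<Sum>i<min k l. (x \<bullet> e i)\<^sup>2)" for k l
    proof -
      have "s k \<bullet> s l = (\<Sum>i<l. (x \<bullet> e i) * (s k \<bullet> e i))"
        by (subst (2) s_def) (simp add: inner_sum_right)
      also have "\<dots> = (\<Sum>i<l. if i < k then (x \<bullet> e i)\<^sup>2 else 0)"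
        by (intro sum.cong) (auto simp: s_e power2_eq_square)
      also have "\<dots> = (\<Sum>i\<in>{i\<in>{..<l}. i < k}. (x \<bullet> e i)\<^sup>2)"
        by (rule sum.inter_filter[symmetric]) simp
      also have "{i\<in>{..<l}. i < k} = {..<min k l}" by auto
      finally show ?thesis .
    qed
    show ?thesis unfolding power2_norm_eq_inner
      using that by (simp add: inner_diff_left inner_diff_right inn min_def)
  qed
  have "Cauchy s"
  proof (rule metric_CauchyI)
    fix r :: real assume "r > 0"
    from metric_CauchyD[OF \<open>Cauchy (\<lambda>n. \<Sum>i<n. (x \<bullet> e i)\<^sup>2)\<close>, of "r\<^sup>2"] \<open>r > 0\<close>
    obtain N where N: "\<And>m n. m \<ge> N \<Longrightarrow> n \<ge> N \<Longrightarrow>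
        dist (\<Sum>i<m. (x \<bullet> e i)\<^sup>2) (\<Sum>i<n. (x \<bullet> e i)\<^sup>2) < r\<^sup>2" by auto
    have le: "dist (s n) (s m) < r" if "m \<ge> N" "n \<ge> N" "m \<le> n" for m n
    proof -
      have "(norm (s n - s m))\<^sup>2 < r\<^sup>2"
        using N[OF that(2,1)] s_diff[OF that(3)] by (simp add: dist_real_def)
      then show ?thesis using \<open>r > 0\<close> by (simp add: dist_norm power2_less_imp_less)
    qed
    have "dist (s m) (s n) < r" if "m \<ge> N" "n \<ge> N" for m n
      using le[of m n] le[of n m] that by (cases "m \<le> n") (auto simp: dist_commute)
    then show "\<exists>N. \<forall>m\<ge>N. \<forall>n\<ge>N. dist (s m) (s n) < r" by blast
  qed
  then obtain y where y: "s \<longlonglongrightarrow> y" using Cauchy_convergent by (auto simp: convergent_def)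
  have "y \<bullet> e i = x \<bullet> e i" for i
  proof (rule LIMSEQ_unique)
    show "(\<lambda>n. s n \<bullet> e i) \<longlonglongrightarrow> y \<bullet> e i" by (intro tendsto_intros y)
    have "eventually (\<lambda>n. s n \<bullet> e i = x \<bullet> e i) sequentially"
      using eventually_gt_at_top[of i] by eventually_elim (simp add: s_e)
    then show "(\<lambda>n. s n \<bullet> e i) \<longlonglongrightarrow> x \<bullet> e i" by (rule tendsto_eventually)
  qed
  then show ?thesis using y unfolding s_def by blast
qed

text \<open>The cardinality bound provides a largest orthonormal subset of \<open>S\<close>; a
  vector of \<open>S\<close> outside its span would, minus its projection and normalised, enlarge
  it. For eigenspaces the bound comes from the trace.\<close>

lemma finite_span_orthonormal_basis:
  fixes S :: "'h::real_inner set"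
  assumes S: "subspace S"
    and bdd: "\<And>B. B \<subseteq> S \<Longrightarrow> finite B \<Longrightarrow> pairwise orthogonal B \<Longrightarrow> (\<forall>b\<in>B. norm b = 1) \<Longrightarrow> card B \<le> m"
  shows "\<exists>B. finite B \<and> independent B \<and> span B = S \<and> pairwise orthogonal B \<and> (\<forall>b\<in>B. norm b = 1)"
proof -
  define \<B> where "\<B> = {B. B \<subseteq> S \<and> finite B \<and> pairwise orthogonal B \<and> (\<forall>b\<in>B. norm b = 1)}"
  have "{} \<in> \<B>" unfolding \<B>_def by simp
  moreover have "\<forall>B. B \<in> \<B> \<longrightarrow> card B < Suc m"
    using bdd unfolding \<B>_def by (auto simp: less_Suc_eq_le)
  ultimately obtain B where B: "B \<in> \<B>" and max: "\<And>B'. B' \<in> \<B> \<Longrightarrow> card B' \<le> card B"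
    using ex_has_greatest_nat[of "\<lambda>B. B \<in> \<B>" "{}" card "Suc m"] by auto
  from B have B': "B \<subseteq> S" "finite B" "pairwise orthogonal B" "\<forall>b\<in>B. norm b = 1"
    unfolding \<B>_def by auto
  have "S \<subseteq> span B"
  proof
    fix x assume "x \<in> S"
    define u where "u = x - (\<Sum>b\<in>B. (x \<bullet> b) *\<^sub>R b)"
    have "u \<in> S"
      unfolding u_def using \<open>x \<in> S\<close> S B'(1) by (intro subspace_diff subspace_sum subspace_scale) auto
    have orth: "u \<bullet> c = 0" if "c \<in> B" for c
    proof -
      have "(\<Sum>b\<in>B. (x \<bullet> b) * (b \<bullet> c)) = (\<Sum>b\<in>B. if b = c then x \<bullet> c else 0)"
        using B'(3,4) that by (intro sum.cong) (auto simp: pairwise_def orthogonal_def dot_square_norm)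
      also have "\<dots> = x \<bullet> c" using that B'(2) by simp
      finally show ?thesis unfolding u_def by (simp add: inner_diff_left inner_sum_left)
    qed
    have "u = 0"
    proof (rule ccontr)
      assume "u \<noteq> 0"
      define b where "b = (1 / norm u) *\<^sub>R u"
      have nb: "norm b = 1" using \<open>u \<noteq> 0\<close> unfolding b_def by simp
      have ob: "b \<bullet> c = 0" if "c \<in> B" for c unfolding b_def using orth[OF that] by simp
      have "b \<notin> B" using ob[of b] nb by (auto simp: dot_square_norm)
      have "b \<in> S" unfolding b_def using \<open>u \<in> S\<close> S by (intro subspace_scale)
      then have "insert b B \<in> \<B>"
        using B' nb ob unfolding \<B>_def
        by (auto simp: pairwise_insert orthogonal_def inner_commute)
      from max[OF this] show False using \<open>b \<notin> B\<close> B'(2) by simp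
    qed
    then have "x = (\<Sum>b\<in>B. (x \<bullet> b) *\<^sub>R b)" unfolding u_def by simp
    also have "\<dots> \<in> span B" by (intro span_sum span_scale span_base)
    finally show "x \<in> span B" .
  qed
  moreover have "span B \<subseteq> S" using B'(1) S by (rule span_minimal)
  moreover have "independent B"
    using B' by (intro pairwise_orthogonal_independent) auto
  ultimately show ?thesis using B' by blast
qed

text \<open>By separability the norm is determined by countably many inner products, so distances to
  fixed points are measurable, and open sets are countable unions of balls. The map z -> K(z,.) into
  the Hilbert space is accessible only through inner products, since these are the functions
  \<open>fval w\<close>.\<close>

lemma borel_measurable_weakI:
  fixes k :: "'p \<Rightarrow> 'h::{real_inner, second_countable_topology}"
  assumes weak: "\<And>w. (\<lambda>p. k p \<bullet> w) \<in> borel_measurable P"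
  shows "k \<in> borel_measurable P"
proof -
  obtain D :: "'h set" where D: "countable D"
    and dense: "\<And>X. open X \<Longrightarrow> X \<noteq> {} \<Longrightarrow> \<exists>d\<in>D. d \<in> X"
    using countable_dense_setE by blast
  have sup: "norm x \<le> r \<longleftrightarrow> (\<forall>d\<in>D. x \<bullet> d \<le> r * norm d)" if "r \<ge> 0" for x :: 'h and r
  proof
    assume "norm x \<le> r"
    show "\<forall>d\<in>D. x \<bullet> d \<le> r * norm d"
    proof
      fix d
      have "x \<bullet> d \<le> norm x * norm d" by (rule norm_cauchy_schwarz)
      also have "\<dots> \<le> r * norm d" using \<open>norm x \<le> r\<close> by (intro mult_right_mono) auto
      finally show "x \<bullet> d \<le> r * norm d" .
    qed
  next
    assume *: "\<forall>d\<in>D. x \<bullet> d \<le> r * norm d"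
    show "norm x \<le> r"
    proof (rule ccontr)
      assume "\<not> norm x \<le> r"
      \<comment> \<open>The strict inequality holds at d = x and defines an open set, so it also
        holds at some point of the dense set.\<close>
      define X where "X = {d. r * norm d < x \<bullet> d}"
      have "open X" unfolding X_def by (intro open_Collect_less continuous_intros)
      moreover have "x \<in> X"
        using \<open>\<not> norm x \<le> r\<close> \<open>r \<ge> 0\<close> unfolding X_def
        by (auto simp: dot_square_norm power2_eq_square intro!: mult_strict_right_mono)
      ultimately obtain d where "d \<in> D" "d \<in> X" using dense[of X] by auto
      then show False using * unfolding X_def by auto
    qed
  qed
  have norm_meas: "(\<lambda>p. norm (k p - c)) \<in> borel_measurable P" for c
  proof (rule borel_measurableI_le)
    fix r
    show "{x \<in> space P. norm (k x - c) \<le> r} \<in> sets P"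
    proof (cases "r \<ge> 0")
      case True
      have [measurable]: "(\<lambda>p. (k p - c) \<bullet> d) \<in> borel_measurable P" for d
        using weak[of d] by (simp add: inner_diff_left)
      have "{x \<in> space P. norm (k x - c) \<le> r} = {x \<in> space P. \<forall>d\<in>D. (k x - c) \<bullet> d \<le> r * norm d}"
        using sup[OF True] by auto
      also have "\<dots> \<in> sets P" using D by measurable
      finally show ?thesis .
    next
      case False
      then have "{x \<in> space P. norm (k x - c) \<le> r} = {}"
        using norm_ge_zero order_trans by blast
      then show ?thesis by (metis sets.empty_sets)
    qed
  qed
  show ?thesis
  proof (rule borel_measurableI)
    fix S :: "'h set" assume "open S"
    define R where "R = {(c, q). c \<in> D \<and> q \<in> \<rat> \<and> q > 0 \<and> ball c q \<subseteq> S}"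
    have "countable R"
      by (rule countable_subset[of _ "D \<times> \<rat>"]) (auto simp: R_def D countable_rat)
    have "S = (\<Union>z\<in>R. ball (fst z) (snd z))"
    proof
      show "(\<Union>z\<in>R. ball (fst z) (snd z)) \<subseteq> S" unfolding R_def by auto
      show "S \<subseteq> (\<Union>z\<in>R. ball (fst z) (snd z))"
      proof
        fix x assume "x \<in> S"
        then obtain r where r: "r > 0" "ball x r \<subseteq> S" using \<open>open S\<close> open_contains_ball by blast
        obtain q where q: "q \<in> \<rat>" "0 < q" "q < r / 2" using Rats_dense_in_real[of 0 "r/2"] r(1) by auto
        obtain c where c: "c \<in> D" "c \<in> ball x q" using dense[of "ball x q"] q by auto
        have "ball c q \<subseteq> ball x r"
        proof
          fix y assume "y \<in> ball c q"
          then show "y \<in> ball x r"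
            using c(2) q(3) dist_triangle[of x y c] by (auto simp: dist_commute)
        qed
        then have "(c, q) \<in> R" using c q r unfolding R_def by auto
        moreover have "x \<in> ball c q" using c(2) by (simp add: dist_commute)
        ultimately show "x \<in> (\<Union>z\<in>R. ball (fst z) (snd z))" by (intro UN_I[of "(c, q)"]) simp_all
      qed
    qed
    then have "k -` S \<inter> space P = (\<Union>z\<in>R. {p \<in> space P. norm (k p - fst z) < snd z})"
      by (subst \<open>S = _\<close>) (fastforce simp: dist_norm norm_minus_commute)
    also have "\<dots> \<in> sets P"
      using \<open>countable R\<close> norm_meas by (intro sets.countable_UN') auto
    finally show "k -` S \<inter> space P \<in> sets P" .
  qed
qed

section \<open>Covariance operators and their spectrum\<close>

lemma integrable_inner_mult:
  fixes \<kappa> :: "'p \<Rightarrow> 'h::{real_inner, second_countable_topology}"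
  assumes [measurable]: "\<kappa> \<in> borel_measurable P" and sq: "integrable P (\<lambda>p. (norm (\<kappa> p))\<^sup>2)"
  shows "integrable P (\<lambda>p. (v \<bullet> \<kappa> p) * (w \<bullet> \<kappa> p))"
proof (rule Bochner_Integration.integrable_bound)
  show "integrable P (\<lambda>p. norm v * norm w * (norm (\<kappa> p))\<^sup>2)"
    using sq by simp
  have "\<bar>(v \<bullet> \<kappa> p) * (w \<bullet> \<kappa> p)\<bar> \<le> (norm v * norm (\<kappa> p)) * (norm w * norm (\<kappa> p))" for p
    unfolding abs_mult by (intro mult_mono Cauchy_Schwarz_ineq2) auto
  then show "AE p in P. norm ((v \<bullet> \<kappa> p) * (w \<bullet> \<kappa> p)) \<le> norm (norm v * norm w * (norm (\<kappa> p))\<^sup>2)"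
    by (simp add: power2_eq_square algebra_simps)
qed measurable

text \<open>The operator v -> E((v \<bullet> \<kappa>) \<kappa>) in weak form. The identity
  \<open>T_inner\<close> already forces T to be symmetric, hence linear, and nonnegative.\<close>

locale covariance_operator =
  fixes P :: "'p measure"
    and \<kappa> :: "'p \<Rightarrow> 'h::{real_inner, complete_space, second_countable_topology}"
    and T :: "'h \<Rightarrow> 'h"
  assumes \<kappa>_measurable [measurable]: "\<kappa> \<in> borel_measurable P"
    and square_integrable: "integrable P (\<lambda>p. (norm (\<kappa> p))\<^sup>2)"
    and T_inner: "\<And>v w. T v \<bullet> w = (\<integral>p. (v \<bullet> \<kappa> p) * (w \<bullet> \<kappa> p) \<partial>P)"
begin

lemma integrable_inner: "integrable P (\<lambda>p. (v \<bullet> \<kappa> p) * (w \<bullet> \<kappa> p))"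
  by (rule integrable_inner_mult[OF \<kappa>_measurable square_integrable])

lemma integrable_inner_square: "integrable P (\<lambda>p. (\<kappa> p \<bullet> v)\<^sup>2)"
  using integrable_inner[of v v] by (simp add: power2_eq_square inner_commute)

lemma T_inner_self: "T v \<bullet> v = (\<integral>p. (\<kappa> p \<bullet> v)\<^sup>2 \<partial>P)"
  unfolding T_inner by (simp add: power2_eq_square inner_commute)

lemma T_symmetric: "T v \<bullet> w = v \<bullet> T w"
  unfolding inner_commute[of v "T w"] T_inner by (simp add: mult.commute)

lemma linear_T: "linear T"
proof (rule linearI)
  show "T (x + y) = T x + T y" for x y
  proof -
    have "T (x + y) \<bullet> z = (T x + T y) \<bullet> z" for z
      by (simp add: T_symmetric inner_add_left)
    then show ?thesis by (metis vector_eq_rdot)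
  qed
  show "T (c *\<^sub>R x) = c *\<^sub>R T x" for c x
  proof -
    have "T (c *\<^sub>R x) \<bullet> z = (c *\<^sub>R T x) \<bullet> z" for z
      by (simp add: T_symmetric)
    then show ?thesis by (metis vector_eq_rdot)
  qed
qed

lemma T_nonneg: "0 \<le> T v \<bullet> v"
  unfolding T_inner_self by simp

lemma AE_orthogonal: "T v \<bullet> v = 0 \<Longrightarrow> AE p in P. \<kappa> p \<bullet> v = 0"
  using integral_nonneg_eq_0_iff_AE[OF integrable_inner_square[of v]]
  unfolding T_inner_self by simp

text \<open>Where the quadratic form vanishes, \<kappa> is almost surely orthogonal to v, so the
  integrand defining \<open>T v \<bullet> w\<close> vanishes for every w, in particular for w = T
  v.\<close>

lemma T_eq_0: assumes "T v \<bullet> v = 0" shows "T v = 0"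
proof -
  have "T v \<bullet> T v = (\<integral>p. 0 \<partial>P)"
    unfolding T_inner[of v "T v"]
    using AE_orthogonal[OF assms]
    by (intro integral_cong_AE) (auto simp: inner_commute)
  then show ?thesis by simp
qed

text \<open>Bessel's inequality under the integral. This trace bound is the source of finite
  multiplicities for nonzero eigenvalues and of the countability of the eigenvectors.\<close>

lemma sum_T_inner_le_trace:
  assumes "orthonormal_or_zero e" "finite A"
  shows "(\<Sum>i\<in>A. T (e i) \<bullet> e i) \<le> (\<integral>p. (norm (\<kappa> p))\<^sup>2 \<partial>P)"
proof -
  have "(\<Sum>i\<in>A. T (e i) \<bullet> e i) = (\<integral>p. (\<Sum>i\<in>A. (\<kappa> p \<bullet> e i)\<^sup>2) \<partial>P)"
    unfolding T_inner_self by (subst Bochner_Integration.integral_sum) (auto intro: integrable_inner_square)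
  also have "\<dots> \<le> (\<integral>p. (norm (\<kappa> p))\<^sup>2 \<partial>P)"
    using bessel_inequality[OF assms]
    by (intro integral_mono Bochner_Integration.integrable_sum integrable_inner_square square_integrable)
  finally show ?thesis .
qed

text \<open>An eigenvector is a maximiser of the quadratic form on the unit ball, which is weakly
  compact; the form is weakly continuous by dominated convergence.\<close>

lemma exists_eigenvector:
  assumes inv: "\<And>v. (\<forall>u\<in>E. v \<bullet> u = 0) \<Longrightarrow> (\<forall>u\<in>E. T v \<bullet> u = 0)"
    and v0: "\<forall>u\<in>E. v0 \<bullet> u = 0" "T v0 \<noteq> 0"
  shows "\<exists>u \<mu>. (\<forall>x\<in>E. u \<bullet> x = 0) \<and> \<mu> > 0 \<and> u \<noteq> 0 \<and> T u = \<mu> *\<^sub>R u"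
proof -
  interpret T: linear T by (rule linear_T)
  define S where "S = {v. \<forall>u\<in>E. v \<bullet> u = 0}"
  have S: "subspace S"
    unfolding S_def by (auto simp: subspace_def inner_add_left)
  define q where "q v = T v \<bullet> v" for v
  define V where "V = q ` {v\<in>S. norm v \<le> 1}"
  have q_scale: "q (c *\<^sub>R v) = c\<^sup>2 * q v" for c v
    unfolding q_def T.scaleR by (simp add: power2_eq_square)
  have q_le: "q v \<le> (\<integral>p. (norm (\<kappa> p))\<^sup>2 \<partial>P)" if "norm v \<le> 1" for v
    unfolding q_def T_inner_self
  proof (intro integral_mono integrable_inner_square square_integrable)
    fix p
    have "\<bar>\<kappa> p \<bullet> v\<bar> \<le> norm (\<kappa> p) * norm v" by (rule Cauchy_Schwarz_ineq2)
    also have "\<dots> \<le> norm (\<kappa> p)" using that by (simp add: mult_left_le)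
    finally show "(\<kappa> p \<bullet> v)\<^sup>2 \<le> (norm (\<kappa> p))\<^sup>2" by (simp add: abs_le_square_iff[symmetric])
  qed
  have bdd: "bdd_above V" unfolding V_def using q_le by (intro bdd_aboveI) auto
  define \<mu> where "\<mu> = Sup V"
  have le_\<mu>: "q v \<le> \<mu>" if "v \<in> S" "norm v \<le> 1" for v
    unfolding \<mu>_def using bdd that by (intro cSup_upper) (auto simp: V_def)
  have q_le_\<mu>: "q v \<le> \<mu> * (norm v)\<^sup>2" if "v \<in> S" for v
  proof (cases "v = 0")
    case True then show ?thesis by (simp add: q_def)
  next
    case False
    have "q ((1 / norm v) *\<^sub>R v) \<le> \<mu>"
      using False that S by (intro le_\<mu> subspace_scale) auto
    then show ?thesis using False by (simp add: q_scale field_simps)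
  qed
  have "q v0 > 0" using T_eq_0[of v0] T_nonneg[of v0] v0(2) unfolding q_def by fastforce
  then have "\<mu> * (norm v0)\<^sup>2 > 0"
    using q_le_\<mu>[of v0] v0(1) unfolding S_def by auto
  then have "\<mu> > 0" using zero_le_power2[of "norm v0"] by (metis zero_less_mult_pos2 mult_eq_0_iff less_irrefl less_eq_real_def)
  have "V \<noteq> {}" unfolding V_def using subspace_0[OF S] by auto
  have "\<exists>v\<in>S. norm v \<le> 1 \<and> \<mu> - inverse (real (Suc n)) < q v" for n
    using less_cSupD[OF \<open>V \<noteq> {}\<close>, of "\<mu> - inverse (real (Suc n))"] unfolding \<mu>_def V_def by auto
  then obtain v where v: "\<And>n. v n \<in> S" "\<And>n. norm (v n) \<le> 1" "\<And>n. \<mu> - inverse (real (Suc n)) < q (v n)"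
    by metis
  from weak_sequential_compactness[of v, OF v(2)] obtain r u
    where r: "strict_mono r" and u: "norm u \<le> 1" "\<And>w. (\<lambda>n. v (r n) \<bullet> w) \<longlonglongrightarrow> u \<bullet> w" by blast
  have "u \<bullet> x = 0" if "x \<in> E" for x
  proof (rule LIMSEQ_unique[OF u(2)])
    show "(\<lambda>n. v (r n) \<bullet> x) \<longlonglongrightarrow> 0" using v(1) that unfolding S_def by simp
  qed
  then have "u \<in> S" unfolding S_def by simp
  have lim_q: "(\<lambda>n. q (v (r n))) \<longlonglongrightarrow> q u"
    unfolding q_def T_inner_self
  proof (rule integral_dominated_convergence)
    show "integrable P (\<lambda>p. (norm (\<kappa> p))\<^sup>2)" by (rule square_integrable)
    show "AE p in P. (\<lambda>n. (\<kappa> p \<bullet> v (r n))\<^sup>2) \<longlonglongrightarrow> (\<kappa> p \<bullet> u)\<^sup>2"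
      using u(2) by (intro AE_I2 tendsto_power) (simp add: inner_commute[of "\<kappa> _"])
    show "AE p in P. norm ((\<kappa> p \<bullet> v (r n))\<^sup>2) \<le> (norm (\<kappa> p))\<^sup>2" for n
    proof (rule AE_I2)
      fix p
      have "\<bar>\<kappa> p \<bullet> v (r n)\<bar> \<le> norm (\<kappa> p) * norm (v (r n))" by (rule Cauchy_Schwarz_ineq2)
      also have "\<dots> \<le> norm (\<kappa> p)" using v(2) by (simp add: mult_left_le)
      finally show "norm ((\<kappa> p \<bullet> v (r n))\<^sup>2) \<le> (norm (\<kappa> p))\<^sup>2" by (simp add: abs_le_square_iff[symmetric])
    qed
  qed measurable
  have "(\<lambda>n. q (v n) - \<mu>) \<longlonglongrightarrow> 0"
  proof (rule Lim_null_comparison)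
    show "\<forall>\<^sub>F n in sequentially. norm (q (v n) - \<mu>) \<le> inverse (real (Suc n))"
    proof (rule always_eventually, rule allI)
      fix n show "norm (q (v n) - \<mu>) \<le> inverse (real (Suc n))"
        using v(3)[of n] le_\<mu>[OF v(1,2)[of n]] unfolding real_norm_def abs_le_iff by argo
    qed
  qed (rule LIMSEQ_inverse_real_of_nat)
  then have "(\<lambda>n. q (v n)) \<longlonglongrightarrow> \<mu>" by (simp add: LIM_zero_iff)
  then have "(\<lambda>n. q (v (r n))) \<longlonglongrightarrow> \<mu>"
    using LIMSEQ_subseq_LIMSEQ[OF _ r] by (simp add: o_def)
  then have qu: "q u = \<mu>" using lim_q LIMSEQ_unique by blast
  \<comment> \<open>A weak limit may lose norm. Here it cannot: u attains the supremum \<mu> > 0,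
    while the form at u is at most \<mu> |u|^2.\<close>
  have "\<mu> * 1 \<le> \<mu> * (norm u)\<^sup>2" using q_le_\<mu>[OF \<open>u \<in> S\<close>] qu by simp
  then have "1 \<le> (norm u)\<^sup>2" using \<open>\<mu> > 0\<close> by (simp only: mult_le_cancel_left_pos)
  moreover have "(norm u)\<^sup>2 \<le> 1" using u(1) by (simp add: power_le_one)
  ultimately have uu: "u \<bullet> u = 1" by (simp add: power2_norm_eq_inner)
  have stationary: "T u \<bullet> w = \<mu> * (u \<bullet> w)" if "w \<in> S" for w
  proof (rule ccontr)
    define d where "d = T u \<bullet> w - \<mu> * (u \<bullet> w)"
    define c where "c = \<mu> * (w \<bullet> w) - q w"
    assume "T u \<bullet> w \<noteq> \<mu> * (u \<bullet> w)"
    then have "d \<noteq> 0" unfolding d_def by simp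
    have "c \<ge> 0" unfolding c_def using q_le_\<mu>[OF that] by (simp add: power2_norm_eq_inner)
    \<comment> \<open>Here d is half the first order gain of moving along w and c the second order
      loss. Since c may be 0, the denominator is c + 1; it makes the loss at most t d, half of the
      gain 2 t d.\<close>
    define t where "t = d / (c + 1)"
    have "u + t *\<^sub>R w \<in> S" using \<open>u \<in> S\<close> that S by (intro subspace_add subspace_scale)
    from q_le_\<mu>[OF this]
    have "q u + 2 * t * (T u \<bullet> w) + t\<^sup>2 * q w \<le> \<mu> * (u \<bullet> u + 2 * t * (u \<bullet> w) + t\<^sup>2 * (w \<bullet> w))"
      unfolding q_def power2_norm_eq_inner T.add T.scaleR
      using T_symmetric[of w u]
      by (simp add: inner_add_left inner_add_right inner_commute power2_eq_square algebra_simps)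
    then have "2 * t * d \<le> t\<^sup>2 * c"
      unfolding qu uu d_def c_def by (simp add: algebra_simps)
    also have "t\<^sup>2 * c \<le> t\<^sup>2 * (c + 1)" by (simp add: algebra_simps)
    also have "\<dots> = t * d" unfolding t_def using \<open>c \<ge> 0\<close> by (simp add: power2_eq_square)
    finally have "t * d \<le> 0" by (simp add: mult.commute)
    moreover have "t * d > 0"
      unfolding t_def using \<open>d \<noteq> 0\<close> \<open>c \<ge> 0\<close> by (simp add: power2_eq_square[symmetric])
    ultimately show False by simp
  qed
  \<comment> \<open>Stationarity can be tested only against \<open>S\<close>; invariance of
    \<open>S\<close> under T allows T u - \<mu> u itself as the test vector.\<close>
  have "T u \<in> S" using inv[of u] \<open>u \<in> S\<close> unfolding S_def by simp
  then have "T u - \<mu> *\<^sub>R u \<in> S" using \<open>u \<in> S\<close> S by (intro subspace_diff subspace_scale)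
  from stationary[OF this] have "(T u - \<mu> *\<^sub>R u) \<bullet> (T u - \<mu> *\<^sub>R u) = 0"
    by (simp add: inner_diff_left)
  then have "T u = \<mu> *\<^sub>R u" by simp
  moreover have "u \<noteq> 0" using uu by auto
  ultimately show ?thesis using \<open>\<mu> > 0\<close> \<open>u \<in> S\<close> unfolding S_def by auto
qed

section \<open>Eigenspaces and eigenvalue sequences\<close>

lemma subspace_eigenspace: "subspace {v. T v = \<mu> *\<^sub>R v}"
proof -
  interpret T: linear T by (rule linear_T)
  show ?thesis by (auto simp: subspace_def T.add T.scaleR scaleR_add_right)
qed

lemma eigenvectors_orthogonal:
  assumes "T v = \<mu> *\<^sub>R v" "T w = \<nu> *\<^sub>R w" "\<mu> \<noteq> \<nu>"
  shows "v \<bullet> w = 0"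
  using T_symmetric[of v w] assms by simp

lemma eigenvalue_nonneg: "T v = \<mu> *\<^sub>R v \<Longrightarrow> v \<noteq> 0 \<Longrightarrow> 0 \<le> \<mu>"
  using T_nonneg[of v] by (simp add: zero_le_mult_iff)
     (metis inner_gt_zero_iff not_less)

text \<open>Each unit eigenvector for \<mu> contributes \<mu> to the trace, so an orthonormal set in
  the eigenspace has at most trace / \<mu> elements. For negative \<mu> the eigenspace is
  trivial.\<close>

lemma eigenspace_basis:
  assumes "\<mu> \<noteq> 0"
  shows "\<exists>B. finite B \<and> independent B \<and> span B = {v. T v = \<mu> *\<^sub>R v} \<and>
    pairwise orthogonal B \<and> (\<forall>b\<in>B. norm b = 1)"
proof (rule finite_span_orthonormal_basis[OF subspace_eigenspace])
  fix B assume B: "B \<subseteq> {v. T v = \<mu> *\<^sub>R v}" "finite B" "pairwise orthogonal B" "\<forall>b\<in>B. norm b = 1"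
  let ?tr = "\<integral>p. (norm (\<kappa> p))\<^sup>2 \<partial>P"
  show "card B \<le> nat \<lceil>?tr / \<mu>\<rceil>"
  proof (cases "B = {}")
    case False
    then obtain b where "b \<in> B" by auto
    then have "b \<noteq> 0" "T b = \<mu> *\<^sub>R b" using B(1,4) by auto
    then have "\<mu> > 0" using eigenvalue_nonneg[of b \<mu>] assms by auto
    have "orthonormal_or_zero (\<lambda>b. if b \<in> B then b else 0)"
      using B(3,4) unfolding orthonormal_or_zero_def pairwise_def orthogonal_def by auto
    from sum_T_inner_le_trace[OF this \<open>finite B\<close>] have "(\<Sum>b\<in>B. T b \<bullet> b) \<le> ?tr"
      by (simp cong: sum.cong)
    also have "(\<Sum>b\<in>B. T b \<bullet> b) = (\<Sum>b\<in>B. \<mu>)"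
      using B(1,4) by (intro sum.cong) (auto simp: dot_square_norm)
    finally have "real (card B) \<le> ?tr / \<mu>" using \<open>\<mu> > 0\<close> by (simp add: field_simps)
    then show ?thesis by linarith
  qed simp
qed

text \<open>A claim about all eigenvalue sequences has content only if there is one. The orthonormal
  bases of all eigenspaces for nonzero eigenvalues are pooled; by the trace bound only finitely many
  members have an eigenvalue above 1 / (n + 1), so the pool is countable and can be
  enumerated.\<close>

lemma eigenvalue_sequence_exists: "\<exists>lam. eigenvalue_sequence T lam"
proof -
  obtain Bs where Bs: "\<And>\<mu>. \<mu> \<noteq> 0 \<Longrightarrow> finite (Bs \<mu>) \<and> independent (Bs \<mu>) \<and>
      span (Bs \<mu>) = {v. T v = \<mu> *\<^sub>R v} \<and> pairwise orthogonal (Bs \<mu>) \<and> (\<forall>b\<in>Bs \<mu>. norm b = 1)"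
    using eigenspace_basis by metis
  define J where "J = (\<Union>\<mu>\<in>-{0}. Bs \<mu>)"
  have eig: "T b = \<mu> *\<^sub>R b" "b \<bullet> b = 1" if "b \<in> Bs \<mu>" "\<mu> \<noteq> 0" for b \<mu>
    using Bs[OF that(2)] that(1) span_base[of b "Bs \<mu>"] by (auto simp: dot_square_norm)
  have ev: "T b \<bullet> b = \<mu>" if "b \<in> Bs \<mu>" "\<mu> \<noteq> 0" for b \<mu>
    using eig[OF that] by simp
  have pos: "0 < T b \<bullet> b" if "b \<in> J" for b
  proof -
    obtain \<mu> where "b \<in> Bs \<mu>" "\<mu> \<noteq> 0" using \<open>b \<in> J\<close> unfolding J_def by auto
    then show ?thesis using ev[of b \<mu>] T_nonneg[of b] by auto
  qed
  have orth: "orthonormal_or_zero (\<lambda>b. if b \<in> J then b else 0)"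
  proof -
    have "b \<bullet> c = 0" if bc: "b \<in> J" "c \<in> J" "b \<noteq> c" for b c
    proof -
      obtain \<mu> \<nu> where *: "b \<in> Bs \<mu>" "\<mu> \<noteq> 0" "c \<in> Bs \<nu>" "\<nu> \<noteq> 0"
        using bc(1,2) unfolding J_def by blast
      show ?thesis
      proof (cases "\<mu> = \<nu>")
        case True
        then show ?thesis
          using Bs[OF *(2)] *(1,3) bc(3) by (auto simp: pairwise_def orthogonal_def)
      next
        case False
        then show ?thesis using eigenvectors_orthogonal eig * by blast
      qed
    qed
    moreover have "norm b = 1" if "b \<in> J" for b
      using that Bs unfolding J_def by auto
    ultimately show ?thesis unfolding orthonormal_or_zero_def by auto
  qed
  have fin: "finite {b\<in>J. inverse (real (Suc n)) < T b \<bullet> b}" for n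
  proof -
    let ?tr = "\<integral>p. (norm (\<kappa> p))\<^sup>2 \<partial>P"
    have "card G \<le> nat \<lceil>?tr * real (Suc n)\<rceil>"
      if G: "G \<subseteq> {b\<in>J. inverse (real (Suc n)) < T b \<bullet> b}" "finite G" for G
    proof -
      have "(\<Sum>b\<in>G. T b \<bullet> b) = (\<Sum>b\<in>G. T (if b \<in> J then b else 0) \<bullet> (if b \<in> J then b else 0))"
        using G(1) by (intro sum.cong) auto
      then have "(\<Sum>b\<in>G. T b \<bullet> b) \<le> ?tr"
        using sum_T_inner_le_trace[OF orth G(2)] by simp
      moreover have "(\<Sum>b\<in>G. inverse (real (Suc n))) \<le> (\<Sum>b\<in>G. T b \<bullet> b)"
        using G(1) by (intro sum_mono) auto
      ultimately have "real (card G) * inverse (real (Suc n)) \<le> ?tr" by simp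
      then have "real (card G) \<le> ?tr * real (Suc n)" by (simp add: field_simps)
      then show ?thesis by linarith
    qed
    then show ?thesis using finite_if_finite_subsets_card_bdd by blast
  qed
  have "J = (\<Union>n. {b\<in>J. inverse (real (Suc n)) < T b \<bullet> b})"
    using reals_Archimedean[OF pos] by auto
  moreover have "countable (\<Union>n. {b\<in>J. inverse (real (Suc n)) < T b \<bullet> b})"
    by (rule countable_UN[OF _ countable_finite[OF fin]]) simp
  ultimately have "countable J" by (rule ssubst)
  \<comment> \<open>Indices that enumerate no eigenvector get the value 0, whose multiplicity in an
    eigenvalue sequence is free. This covers a finite pool.\<close>
  define lam where "lam i = (if i \<in> to_nat_on J ` J then T (from_nat_into J i) \<bullet> from_nat_into J i else 0)" for i
  have lam: "lam (to_nat_on J b) = T b \<bullet> b" if "b \<in> J" for b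
    using that \<open>countable J\<close> unfolding lam_def by simp
  have "\<exists>B b. independent B \<and> span B = {v. T v = \<mu> *\<^sub>R v} \<and> bij_betw b {i. lam i = \<mu>} B"
    if "\<mu> \<noteq> 0" for \<mu>
  proof -
    have sub: "Bs \<mu> \<subseteq> J" unfolding J_def using that by auto
    have "{i. lam i = \<mu>} = to_nat_on J ` Bs \<mu>"
    proof
      show "to_nat_on J ` Bs \<mu> \<subseteq> {i. lam i = \<mu>}"
        using lam ev[OF _ that] sub by auto
      show "{i. lam i = \<mu>} \<subseteq> to_nat_on J ` Bs \<mu>"
      proof
        fix i assume "i \<in> {i. lam i = \<mu>}"
        then have i: "lam i = \<mu>" by simp
        with that have "i \<in> to_nat_on J ` J" unfolding lam_def by (auto split: if_splits)
        then obtain b where b: "b \<in> J" "i = to_nat_on J b" by auto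
        then have "T b \<bullet> b = \<mu>" using lam i by simp
        moreover obtain \<nu> where "b \<in> Bs \<nu>" "\<nu> \<noteq> 0" using b(1) unfolding J_def by auto
        ultimately show "i \<in> to_nat_on J ` Bs \<mu>" using ev b by auto
      qed
    qed
    moreover have "inj_on (to_nat_on J) (Bs \<mu>)"
      using inj_on_to_nat_on[OF \<open>countable J\<close>] sub inj_on_subset by blast
    ultimately have "bij_betw (to_nat_on J) (Bs \<mu>) {i. lam i = \<mu>}" by (simp add: bij_betw_def)
    then obtain b where "bij_betw b {i. lam i = \<mu>} (Bs \<mu>)" using bij_betw_inv by blast
    then show ?thesis using Bs[OF that] by blast
  qed
  then show ?thesis unfolding eigenvalue_sequence_def by blast
qed

text \<open>The bases that come with \<open>lam\<close> need not be orthonormal. An orthonormal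
  basis of the same eigenspace has the same cardinality, so it can be indexed by the same set
  \<open>{i. lam i = \<mu>}\<close>. Indices with value 0 get the zero vector; the last conjunct
  says that at most vectors of the kernel of T are missed.\<close>

lemma eigenvalue_sequence_eigenvectors:
  assumes lam: "eigenvalue_sequence T lam"
  shows "\<exists>e. orthonormal_or_zero e \<and> (\<forall>i. T (e i) = lam i *\<^sub>R e i) \<and> (\<forall>i. e i = 0 \<longleftrightarrow> lam i = 0) \<and>
    (\<forall>v. (\<forall>i. v \<bullet> e i = 0) \<longrightarrow> T v = 0)"
proof -
  obtain Bs where Bs: "\<And>\<mu>. \<mu> \<noteq> 0 \<Longrightarrow> finite (Bs \<mu>) \<and> independent (Bs \<mu>) \<and>
      span (Bs \<mu>) = {v. T v = \<mu> *\<^sub>R v} \<and> pairwise orthogonal (Bs \<mu>) \<and> (\<forall>b\<in>Bs \<mu>. norm b = 1)"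
    using eigenspace_basis by metis
  have "\<exists>c. bij_betw c {i. lam i = \<mu>} (Bs \<mu>)" if \<mu>: "\<mu> \<noteq> 0" for \<mu>
  proof -
    obtain B b where B: "independent B" "span B = {v. T v = \<mu> *\<^sub>R v}" "bij_betw b {i. lam i = \<mu>} B"
      using lam \<mu> unfolding eigenvalue_sequence_def by blast
    obtain g where "bij_betw g B (Bs \<mu>)"
      using real_vector.bij_if_span_eq_span_bases[of B "Bs \<mu>"] B(1,2) Bs[OF \<mu>] by auto
    then show ?thesis using bij_betw_trans[OF B(3)] by blast
  qed
  then obtain c where c: "\<And>\<mu>. \<mu> \<noteq> 0 \<Longrightarrow> bij_betw (c \<mu>) {i. lam i = \<mu>} (Bs \<mu>)" by metis
  define e where "e i = (if lam i = 0 then 0 else c (lam i) i)" for i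
  interpret T: linear T by (rule linear_T)
  have mem: "e i \<in> Bs (lam i)" if "lam i \<noteq> 0" for i
    using c[OF that] that unfolding e_def bij_betw_def by auto
  have norm_e: "norm (e i) = 1" if "lam i \<noteq> 0" for i
    using mem[OF that] Bs[OF that] by blast
  have T_e: "T (e i) = lam i *\<^sub>R e i" for i
  proof (cases "lam i = 0")
    case False
    then show ?thesis using mem[OF False] Bs[OF False] span_base[of "e i" "Bs (lam i)"] by auto
  qed (simp add: e_def)
  have e0: "e i = 0 \<longleftrightarrow> lam i = 0" for i
    using norm_e[of i] by (auto simp: e_def)
  have "e i \<bullet> e j = 0" if "i \<noteq> j" for i j
  proof (cases "lam i = lam j")
    case True
    show ?thesis
    proof (cases "lam i = 0")
      case False
      have "e i \<noteq> e j"
        using c[OF False] True False that unfolding e_def bij_betw_def inj_on_def by auto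
      then show ?thesis
        using Bs[OF False] mem[of i] mem[of j] True False by (auto simp: pairwise_def orthogonal_def)
    qed (simp add: e_def)
  next
    case False
    then show ?thesis using eigenvectors_orthogonal T_e by blast
  qed
  then have "orthonormal_or_zero e"
    unfolding orthonormal_or_zero_def using norm_e e0 by auto
  moreover have "T v = 0" if v: "\<forall>i. v \<bullet> e i = 0" for v
  proof (rule ccontr)
    assume "T v \<noteq> 0"
    \<comment> \<open>The orthogonal complement of the system is invariant under T, so it would
      contain an eigenvector u with positive eigenvalue. But the whole eigenspace of that eigenvalue
      is spanned by members of the system, and u would be orthogonal to itself.\<close>
    have "\<exists>u \<mu>. (\<forall>x\<in>range e. u \<bullet> x = 0) \<and> \<mu> > 0 \<and> u \<noteq> 0 \<and> T u = \<mu> *\<^sub>R u"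
    proof (rule exists_eigenvector)
      show "\<forall>u\<in>range e. v \<bullet> u = 0" using v by auto
      show "T v \<noteq> 0" by fact
      show "\<forall>u\<in>range e. T v \<bullet> u = 0" if "\<forall>u\<in>range e. v \<bullet> u = 0" for v
        using that T_e by (auto simp: T_symmetric)
    qed
    then obtain u \<mu> where u: "\<And>i. u \<bullet> e i = 0" "\<mu> > 0" "u \<noteq> 0" "T u = \<mu> *\<^sub>R u" by auto
    have "\<mu> \<noteq> 0" using u(2) by simp
    have "u \<in> span (Bs \<mu>)" using Bs[OF \<open>\<mu> \<noteq> 0\<close>] u(4) by auto
    moreover have "orthogonal u b" if "b \<in> Bs \<mu>" for b
    proof -
      obtain i where "lam i = \<mu>" "b = c \<mu> i" using c[OF \<open>\<mu> \<noteq> 0\<close>] \<open>b \<in> Bs \<mu>\<close> unfolding bij_betw_def by auto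
      then have "b = e i" using \<open>\<mu> \<noteq> 0\<close> unfolding e_def by simp
      then show ?thesis using u(1) by (simp add: orthogonal_def)
    qed
    ultimately have "orthogonal u u" by (rule orthogonal_to_span)
    then show False using u(3) by (simp add: orthogonal_def)
  qed
  ultimately show ?thesis using T_e e0 by blast
qed

text \<open>Parseval's identity may fail for a given vector, since the system may miss the kernel of
  T. It holds for almost every value of \<kappa>: the part of d outside the closed span is killed by
  T, so \<kappa> is almost surely orthogonal to it, and countably many d suffice.\<close>

lemma AE_expansion:
  assumes e: "orthonormal_or_zero e" and complete: "\<And>v. (\<And>i. v \<bullet> e i = 0) \<Longrightarrow> T v = 0"
  shows "AE p in P. (\<lambda>n. \<Sum>i<n. (\<kappa> p \<bullet> e i)\<^sup>2) \<longlonglongrightarrow> (norm (\<kappa> p))\<^sup>2"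
proof -
  obtain D :: "'h set" where D: "countable D"
    and dense: "\<And>X. open X \<Longrightarrow> X \<noteq> {} \<Longrightarrow> \<exists>d\<in>D. d \<in> X"
    using countable_dense_setE by blast
  obtain pr where pr: "\<And>x. (\<lambda>n. \<Sum>i<n. (x \<bullet> e i) *\<^sub>R e i) \<longlonglongrightarrow> pr x" "\<And>x i. pr x \<bullet> e i = x \<bullet> e i"
    using orthonormal_projection[OF e] by metis
  have pr_sym: "pr x \<bullet> y = x \<bullet> pr y" for x y
  proof (rule LIMSEQ_unique)
    show "(\<lambda>n. (\<Sum>i<n. (x \<bullet> e i) *\<^sub>R e i) \<bullet> y) \<longlonglongrightarrow> pr x \<bullet> y" by (intro tendsto_intros pr)
    have "(\<lambda>n. x \<bullet> (\<Sum>i<n. (y \<bullet> e i) *\<^sub>R e i)) \<longlonglongrightarrow> x \<bullet> pr y" by (intro tendsto_intros pr)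
    then show "(\<lambda>n. (\<Sum>i<n. (x \<bullet> e i) *\<^sub>R e i) \<bullet> y) \<longlonglongrightarrow> x \<bullet> pr y"
      by (simp add: inner_sum_left inner_sum_right inner_commute mult.commute)
  qed
  have "AE p in P. \<kappa> p \<bullet> (d - pr d) = 0" for d
  proof (rule AE_orthogonal)
    have "T (d - pr d) = 0" by (rule complete) (simp add: inner_diff_left pr)
    then show "T (d - pr d) \<bullet> (d - pr d) = 0" by simp
  qed
  then have "AE p in P. \<forall>d\<in>D. \<kappa> p \<bullet> (d - pr d) = 0"
    using D by (subst AE_ball_countable) auto
  then show ?thesis
  proof eventually_elim
    case (elim p)
    have "\<kappa> p = pr (\<kappa> p)"
    proof (rule ccontr)
      define x where "x = \<kappa> p - pr (\<kappa> p)"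
      assume "\<kappa> p \<noteq> pr (\<kappa> p)"
      then have "x \<bullet> x > 0" unfolding x_def by simp
      moreover have "open {d. 0 < x \<bullet> d}" by (intro open_Collect_less continuous_intros)
      ultimately obtain d where "d \<in> D" "0 < x \<bullet> d" using dense[of "{d. 0 < x \<bullet> d}"] by blast
      moreover have "x \<bullet> d = \<kappa> p \<bullet> (d - pr d)"
        unfolding x_def by (simp add: inner_diff_left inner_diff_right pr_sym)
      ultimately show False using elim by simp
    qed
    then have "(\<lambda>n. \<Sum>i<n. (\<kappa> p \<bullet> e i) *\<^sub>R e i) \<longlonglongrightarrow> \<kappa> p"
      using pr(1)[of "\<kappa> p"] by metis
    then have "(\<lambda>n. norm (\<kappa> p - (\<Sum>i<n. (\<kappa> p \<bullet> e i) *\<^sub>R e i))) \<longlonglongrightarrow> norm (\<kappa> p - \<kappa> p)"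
      by (intro tendsto_norm tendsto_diff tendsto_const)
    then have "(\<lambda>n. (norm (\<kappa> p))\<^sup>2 - (norm (\<kappa> p - (\<Sum>i<n. (\<kappa> p \<bullet> e i) *\<^sub>R e i)))\<^sup>2)
        \<longlonglongrightarrow> (norm (\<kappa> p))\<^sup>2 - (norm (\<kappa> p - \<kappa> p))\<^sup>2"
      by (intro tendsto_diff tendsto_const tendsto_power)
    then show ?case by (simp add: orthonormal_or_zero_norm_diff[OF e])
  qed
qed

text \<open>Equality in the trace bound. It identifies the tail of the eigenvalue series with the
  mean squared norm of what a partial expansion of \<kappa> leaves out.\<close>

lemma trace_formula:
  assumes e: "orthonormal_or_zero e" and complete: "\<And>v. (\<And>i. v \<bullet> e i = 0) \<Longrightarrow> T v = 0"
    and T_e: "\<And>i. T (e i) = lam i *\<^sub>R e i" and e0: "\<And>i. e i = 0 \<longleftrightarrow> lam i = 0"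
  shows "(\<integral>p. (\<kappa> p \<bullet> e i)\<^sup>2 \<partial>P) = lam i" and "lam sums (\<integral>p. (norm (\<kappa> p))\<^sup>2 \<partial>P)"
proof -
  have "e i \<bullet> e i = 1" if "lam i \<noteq> 0" for i
    using e that e0 unfolding orthonormal_or_zero_def by (auto simp: dot_square_norm)
  then show int: "(\<integral>p. (\<kappa> p \<bullet> e i)\<^sup>2 \<partial>P) = lam i" for i
    unfolding T_inner_self[symmetric] T_e by (cases "lam i = 0") auto
  have "(\<lambda>n. \<integral>p. (\<Sum>i<n. (\<kappa> p \<bullet> e i)\<^sup>2) \<partial>P) \<longlonglongrightarrow> (\<integral>p. (norm (\<kappa> p))\<^sup>2 \<partial>P)"
  proof (rule integral_dominated_convergence[OF _ _ square_integrable AE_expansion[OF e complete]])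
    show "AE p in P. norm (\<Sum>i<n. (\<kappa> p \<bullet> e i)\<^sup>2) \<le> (norm (\<kappa> p))\<^sup>2" for n
      using bessel_inequality[OF e] by (simp add: sum_nonneg)
  qed measurable
  moreover have "(\<integral>p. (\<Sum>i<n. (\<kappa> p \<bullet> e i)\<^sup>2) \<partial>P) = (\<Sum>i<n. lam i)" for n
    using int by (subst Bochner_Integration.integral_sum) (auto intro: integrable_inner_square)
  ultimately show "lam sums (\<integral>p. (norm (\<kappa> p))\<^sup>2 \<partial>P)" unfolding sums_def by simp
qed

end

section \<open>Convergence of Laplace transforms\<close>

text \<open>Substituting \<open>u = exp (- a)\<close> turns the Laplace transform at integers into moments on \<open>[0, 1]\<close>,
  where the Weierstrass approximation theorem applies.\<close>

lemma laplace_transform_imp_weak_conv: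
  fixes A :: "nat \<Rightarrow> 'm \<Rightarrow> real" and L :: "'q \<Rightarrow> real"
  assumes M: "prob_space M" and N: "prob_space N"
    and A [measurable]: "\<And>n. A n \<in> borel_measurable M" and L [measurable]: "L \<in> borel_measurable N"
    and A_nonneg: "\<And>n x. 0 \<le> A n x" and L_nonneg: "AE q in N. 0 \<le> L q"
    and lim: "\<And>s. 0 \<le> s \<Longrightarrow> (\<lambda>n. \<integral>x. exp (- (s * A n x)) \<partial>M) \<longlonglongrightarrow> (\<integral>q. exp (- (s * L q)) \<partial>N)"
  shows "weak_conv_m (\<lambda>n. distr M borel (A n)) (distr N borel L)"
proof (rule integral_cts_step_conv_imp_weak_conv)
  interpret M: prob_space M by fact
  interpret N: prob_space N by fact
  show "real_distribution (distr M borel (A n))" for n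
    by (rule M.real_distribution_distr) simp
  show "real_distribution (distr N borel L)"
    by (rule N.real_distribution_distr) simp
  fix x y :: real assume "x < y"
  \<comment> \<open>The test function \<open>cts_step x y\<close> in the variable u = exp (- a).
    Cutting u off below at exp (- y) changes nothing, because the step is 0 from y on, and keeps the
    logarithm away from u \<le> 0, so that h is continuous on the whole line.\<close>
  define h where "h u = cts_step x y (- ln (max u (exp (- y))))" for u
  have cont_step: "continuous_on UNIV (cts_step x y)"
    using cts_step_uniformly_continuous[OF \<open>x < y\<close>] by (rule uniformly_continuous_imp_continuous)
  have cont_h: "continuous_on UNIV h"
    unfolding h_def
    by (intro continuous_on_compose2[OF cont_step] continuous_intros) (auto simp: less_max_iff_disj not_less max_def)
  have [measurable]: "h \<in> borel_measurable borel" "cts_step x y \<in> borel_measurable borel"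
    using cont_h cont_step by (auto intro: borel_measurable_continuous_onI)
  have h_exp: "h (exp (- a)) = cts_step x y a" for a
  proof (cases "a \<le> y")
    case True then show ?thesis by (simp add: h_def max_def)
  next
    case False then show ?thesis using \<open>x < y\<close> by (simp add: h_def max_def cts_step_def)
  qed
  have h_le: "\<bar>h u\<bar> \<le> 1" for u
    using \<open>x < y\<close> unfolding h_def cts_step_def by (auto simp: field_simps)
  have "(\<lambda>n. \<integral>x. h (exp (- A n x)) \<partial>M) \<longlonglongrightarrow> (\<integral>q. h (exp (- L q)) \<partial>N)"
  proof (rule LIMSEQ_I)
    fix r :: real assume "r > 0"
    then obtain g where g: "real_polynomial_function g" "\<And>u. u \<in> {0..1} \<Longrightarrow> \<bar>h u - g u\<bar> < r / 4"
      using Stone_Weierstrass_real_polynomial_function[of "{0..1::real}" h "r / 4"] cont_h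
      by (metis compact_Icc continuous_on_subset top_greatest zero_less_divide_iff zero_less_numeral)
    then obtain a m where poly: "g = (\<lambda>u. \<Sum>i\<le>m. a i * u ^ i)"
      unfolding real_polynomial_function_iff_sum by auto
    have g_exp: "g (exp (- b)) = (\<Sum>i\<le>m. a i * exp (- (real i * b)))" for b
      unfolding poly by (simp add: exp_of_nat_mult[symmetric])
    have intM: "integrable M (\<lambda>x. exp (- (real i * A n x)))" for i n
      using A_nonneg by (intro M.integrable_const_bound[where B = 1]) auto
    have intN: "integrable N (\<lambda>q. exp (- (real i * L q)))" for i
      using L_nonneg by (intro N.integrable_const_bound[where B = 1]) auto
    have int_gM: "integrable M (\<lambda>x. g (exp (- A n x)))" for n
      unfolding g_exp using intM by simp
    have int_gN: "integrable N (\<lambda>q. g (exp (- L q)))"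
      unfolding g_exp using intN by simp
    have int_hM: "integrable M (\<lambda>x. h (exp (- A n x)))" for n
      using h_le by (intro M.integrable_const_bound[where B = 1]) auto
    have int_hN: "integrable N (\<lambda>q. h (exp (- L q)))"
      using h_le by (intro N.integrable_const_bound[where B = 1]) auto
    have "(\<lambda>n. \<Sum>i\<le>m. a i * (\<integral>x. exp (- (real i * A n x)) \<partial>M))
        \<longlonglongrightarrow> (\<Sum>i\<le>m. a i * (\<integral>q. exp (- (real i * L q)) \<partial>N))"
      by (intro tendsto_intros lim) auto
    then have "(\<lambda>n. \<integral>x. g (exp (- A n x)) \<partial>M) \<longlonglongrightarrow> (\<integral>q. g (exp (- L q)) \<partial>N)"
      unfolding g_exp using intM intN by simp
    from LIMSEQ_D[OF this, of "r / 4"] \<open>r > 0\<close> obtain n0 where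
      n0: "\<And>n. n \<ge> n0 \<Longrightarrow> norm ((\<integral>x. g (exp (- A n x)) \<partial>M) - (\<integral>q. g (exp (- L q)) \<partial>N)) < r / 4"
      by auto
    have closeM: "\<bar>(\<integral>x. h (exp (- A n x)) \<partial>M) - (\<integral>x. g (exp (- A n x)) \<partial>M)\<bar> \<le> r / 4" for n
    proof -
      have "\<bar>\<integral>x. h (exp (- A n x)) - g (exp (- A n x)) \<partial>M\<bar> \<le> (\<integral>x. \<bar>h (exp (- A n x)) - g (exp (- A n x))\<bar> \<partial>M)"
        by (rule integral_abs_bound)
      also have "\<dots> \<le> (\<integral>x. r / 4 \<partial>M)"
        using g(2) A_nonneg int_hM int_gM
          by (intro integral_mono less_imp_le[OF g(2)]) auto
      finally show ?thesis using int_hM int_gM by (simp add: M.prob_space)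
    qed
    have closeN: "\<bar>(\<integral>q. h (exp (- L q)) \<partial>N) - (\<integral>q. g (exp (- L q)) \<partial>N)\<bar> \<le> r / 4"
    proof -
      have "\<bar>\<integral>q. h (exp (- L q)) - g (exp (- L q)) \<partial>N\<bar> \<le> (\<integral>q. \<bar>h (exp (- L q)) - g (exp (- L q))\<bar> \<partial>N)"
        by (rule integral_abs_bound)
      also have "\<dots> \<le> (\<integral>q. r / 4 \<partial>N)"
      proof (intro integral_mono_AE)
        show "AE q in N. \<bar>h (exp (- L q)) - g (exp (- L q))\<bar> \<le> r / 4"
          using L_nonneg by eventually_elim (rule less_imp_le, rule g(2), simp)
      qed (use int_hN int_gN in auto)
      finally show ?thesis using int_hN int_gN by (simp add: N.prob_space)
    qed
    have "norm ((\<integral>x. h (exp (- A n x)) \<partial>M) - (\<integral>q. h (exp (- L q)) \<partial>N)) < r" if "n \<ge> n0" for n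
      using n0[OF that] closeM[of n] closeN \<open>r > 0\<close> unfolding real_norm_def by linarith
    then show "\<exists>n0. \<forall>n\<ge>n0. norm ((\<integral>x. h (exp (- A n x)) \<partial>M) - (\<integral>q. h (exp (- L q)) \<partial>N)) < r"
      by blast
  qed
  then show "(\<lambda>n. integral\<^sup>L (distr M borel (A n)) (cts_step x y)) \<longlonglongrightarrow> integral\<^sup>L (distr N borel L) (cts_step x y)"
    unfolding h_exp by (simp add: integral_distr)
qed

text \<open>Scaling by sqrt n instead of the standard deviation admits variance 0, where the
  summands vanish almost surely and both sides are 1. This case does occur, for linear forms in
  directions on which the quadratic form of T vanishes.\<close>

lemma (in prob_space) central_limit_char:
  fixes X :: "nat \<Rightarrow> 'a \<Rightarrow> real"
  assumes indep: "indep_vars (\<lambda>i. borel) X UNIV"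
    and mean: "\<And>n. expectation (X n) = 0"
    and sq: "\<And>n. integrable M (\<lambda>x. (X n x)\<^sup>2)"
    and var: "\<And>n. expectation (\<lambda>x. (X n x)\<^sup>2) = v"
    and distr: "\<And>n. distr M borel (X n) = \<mu>"
  shows "(\<lambda>n. CLINT x|M. iexp ((\<Sum>i<n. X i x) / sqrt (real n))) \<longlonglongrightarrow> exp (- v / 2)"
proof -
  have [measurable]: "X i \<in> borel_measurable M" for i
    using indep unfolding indep_vars_def2 by auto
  have "v \<ge> 0" unfolding var[of 0, symmetric] by simp
  show ?thesis
  proof (cases "v = 0")
    case True
    have "AE x in M. X i x = 0" for i
      using integral_nonneg_eq_0_iff_AE[OF sq[of i]] var[of i] True by simp
    then have "AE x in M. \<forall>i. X i x = 0" by (simp add: AE_all_countable)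
    then have "AE x in M. iexp ((\<Sum>i<n. X i x) / sqrt (real n)) = 1" for n
      by eventually_elim simp
    then have "(CLINT x|M. iexp ((\<Sum>i<n. X i x) / sqrt (real n))) = (CLINT x|M. 1)" for n
      by (intro integral_cong_AE) measurable
    moreover have "(CLINT x|M. 1) = 1" by (simp add: prob_space)
    ultimately show ?thesis using True by simp
  next
    case False
    define \<sigma> where "\<sigma> = sqrt v"
    have \<sigma>: "\<sigma> > 0" "\<sigma>\<^sup>2 = v" using False \<open>v \<ge> 0\<close> unfolding \<sigma>_def by auto
    have "weak_conv_m (\<lambda>n. distr M borel (\<lambda>x. (\<Sum>i<n. X i x) / sqrt (n * \<sigma>\<^sup>2))) std_normal_distribution"
      using assms \<sigma> by (intro central_limit_theorem_zero_mean[where \<mu> = \<mu>]) auto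
    \<comment> \<open>Evaluating the characteristic function at \<sigma> undoes the
      standardisation.\<close>
    then have "(\<lambda>n. char (distr M borel (\<lambda>x. (\<Sum>i<n. X i x) / sqrt (n * \<sigma>\<^sup>2))) \<sigma>)
        \<longlonglongrightarrow> char std_normal_distribution \<sigma>"
      by (intro levy_continuity1 real_dist_normal_dist) (auto intro!: real_distribution_distr)
    moreover have "char (distr M borel (\<lambda>x. (\<Sum>i<n. X i x) / sqrt (n * \<sigma>\<^sup>2))) \<sigma> =
        (CLINT x|M. iexp ((\<Sum>i<n. X i x) / sqrt (real n)))" for n
    proof -
      have "\<sigma> * ((\<Sum>i<n. X i x) / sqrt (real n * \<sigma>\<^sup>2)) = (\<Sum>i<n. X i x) / sqrt (real n)" for x
        using \<sigma>(1) by (simp add: real_sqrt_mult)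
      then show ?thesis unfolding char_def by (subst integral_distr) simp_all
    qed
    ultimately show ?thesis using \<sigma> by (simp add: char_std_normal_distribution exp_of_real)
  qed
qed

section \<open>Weighted sums of squared standard normal variables\<close>

locale std_normal_sequence = prob_space N for N :: "'q measure" +
  fixes Q :: "nat \<Rightarrow> 'q \<Rightarrow> real"
  assumes indep_Q: "indep_vars (\<lambda>_. borel) Q UNIV"
    and distributed_Q: "\<And>i. distributed N lborel (Q i) std_normal_density"
begin

lemma Q_measurable [measurable]: "Q i \<in> borel_measurable N"
  using indep_Q unfolding indep_vars_def2 by auto

lemma distr_Q: "distr N borel (Q i) = std_normal_distribution"
proof -
  have "distr N borel (Q i) = distr N lborel (Q i)" by (rule distr_cong) auto
  then show ?thesis using distributed_Q[of i] by (simp add: distributed_def)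
qed

lemma nn_integral_Q_square: "(\<integral>\<^sup>+ q. ennreal ((Q i q)\<^sup>2) \<partial>N) = 1"
proof -
  have "(\<integral>\<^sup>+ q. ennreal ((Q i q)\<^sup>2) \<partial>N) = (\<integral>\<^sup>+ x. ennreal (x\<^sup>2) \<partial>distr N borel (Q i))"
    by (subst nn_integral_distr) auto
  also have "\<dots> = ennreal (\<integral>x. x\<^sup>2 \<partial>std_normal_distribution)"
    unfolding distr_Q using std_normal_distribution_even_moments(2)[of 1]
    by (intro nn_integral_eq_integral) auto
  also have "(\<integral>x. x\<^sup>2 \<partial>std_normal_distribution) = 1"
    using std_normal_distribution_even_moments(1)[of 1] by (simp add: fact_numeral)
  finally show ?thesis by simp
qed

lemma char_linear_combination: "(CLINT q|N. iexp (\<Sum>i<m. c i * Q i q)) = exp (- (\<Sum>i<m. (c i)\<^sup>2) / 2)"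
proof -
  have "(CLINT q|N. iexp (\<Sum>i<m. c i * Q i q)) = char (distr N borel (\<lambda>q. \<Sum>i<m. c i * Q i q)) 1"
    unfolding char_def by (subst integral_distr) simp_all
  also have "\<dots> = (\<Prod>i<m. char (distr N borel (\<lambda>q. c i * Q i q)) 1)"
    by (intro char_distr_sum indep_vars_compose2[OF indep_vars_subset[OF indep_Q]]) auto
  also have "\<dots> = (\<Prod>i<m. complex_of_real (exp (- (c i)\<^sup>2 / 2)))"
  proof (rule prod.cong)
    fix i
    have "char (distr N borel (\<lambda>q. c i * Q i q)) 1 = char (distr N borel (Q i)) (c i)"
      unfolding char_def by (subst (1 2) integral_distr) simp_all
    then show "char (distr N borel (\<lambda>q. c i * Q i q)) 1 = complex_of_real (exp (- (c i)\<^sup>2 / 2))"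
      by (simp add: distr_Q char_std_normal_distribution)
  qed simp
  also have "\<dots> = complex_of_real (exp (\<Sum>i<m. - (c i)\<^sup>2 / 2))"
    by (simp only: exp_sum[OF finite_lessThan] of_real_prod)
  also have "(\<Sum>i<m. - (c i)\<^sup>2 / 2) = - (\<Sum>i<m. (c i)\<^sup>2) / 2"
    by (simp only: sum_divide_distrib[symmetric] sum_negf)
  finally show ?thesis .
qed

text \<open>The mean of the series in [0, \<infinity>] is the sum of \<open>lam\<close>, as E(Q_i^2)
  = 1, and a nonnegative variable with finite mean is almost surely finite.\<close>

lemma AE_summable_weighted_squares:
  assumes nonneg: "\<And>i. 0 \<le> lam i" and "summable lam"
  shows "AE q in N. summable (\<lambda>i. lam i * (Q i q)\<^sup>2)"
proof -
  have "(\<integral>\<^sup>+ q. (\<Sum>i. ennreal (lam i * (Q i q)\<^sup>2)) \<partial>N) = (\<Sum>i. \<integral>\<^sup>+ q. ennreal (lam i * (Q i q)\<^sup>2) \<partial>N)"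
    by (intro nn_integral_suminf) simp
  also have "\<dots> = (\<Sum>i. ennreal (lam i))"
    using nonneg by (simp add: ennreal_mult nn_integral_cmult nn_integral_Q_square)
  also have "\<dots> \<noteq> \<infinity>" using assms by (simp add: suminf_ennreal2)
  finally have "AE q in N. (\<Sum>i. ennreal (lam i * (Q i q)\<^sup>2)) \<noteq> \<infinity>"
    by (intro nn_integral_PInf_AE) simp_all
  then show ?thesis
    by eventually_elim (use nonneg in \<open>auto intro!: summable_suminf_not_top\<close>)
qed

end

section \<open>Central limit theorem for squared norms in Hilbert spaces\<close>

locale iid_sample = prob_space M for M :: "'m measure" +
  fixes P :: "'p measure" and W :: "nat \<Rightarrow> 'm \<Rightarrow> 'p"
  assumes indep_W: "indep_vars (\<lambda>_. P) W UNIV"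
    and distr_W: "\<And>i. distr M P (W i) = P"
begin

lemma W_measurable [measurable]: "W i \<in> measurable M P"
  using indep_W unfolding indep_vars_def2 by auto

lemma prob_space_P: "prob_space P"
  using prob_space_distr[OF W_measurable[of 0]] unfolding distr_W .

lemma integral_W: "f \<in> borel_measurable P \<Longrightarrow> (\<integral>x. f (W i x) \<partial>M) = (\<integral>p. f p \<partial>P)"
  for f :: "'p \<Rightarrow> 'b::{banach, second_countable_topology}"
  using integral_distr[OF W_measurable[of i], of f] unfolding distr_W by simp

lemma integrable_W: "integrable P f \<Longrightarrow> integrable M (\<lambda>x. f (W i x))"
  for f :: "'p \<Rightarrow> 'b::{banach, second_countable_topology}"
  using integrable_distr_eq[OF W_measurable[of i], of f] unfolding distr_W by auto

lemma distr_pair_W: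
  assumes "i \<noteq> j"
  shows "distr M (P \<Otimes>\<^sub>M P) (\<lambda>x. (W i x, W j x)) = P \<Otimes>\<^sub>M P"
proof -
  have "indep_var P (W i) P (W j)"
  proof -
    have "indep_var (PiM {i} (\<lambda>_. P)) (\<lambda>x. restrict (\<lambda>k. W k x) {i}) (PiM {j} (\<lambda>_. P)) (\<lambda>x. restrict (\<lambda>k. W k x) {j})"
      using assms by (intro indep_var_restrict[OF indep_W]) auto
    then have "indep_var P ((\<lambda>f. f i) \<circ> (\<lambda>x. restrict (\<lambda>k. W k x) {i})) P ((\<lambda>f. f j) \<circ> (\<lambda>x. restrict (\<lambda>k. W k x) {j}))"
      by (rule indep_var_compose) (auto intro: measurable_component_singleton)
    then show ?thesis by (simp add: o_def)
  qed
  then show ?thesis unfolding indep_var_distribution_eq distr_W by simp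
qed

text \<open>Mixed terms vanish by independence: with one factor frozen, the inner product is a
  linear form in the other, to which the weakly stated centring applies. It is used for the image of
  the observations under a linear remainder map.\<close>

lemma norm_sum_square:
  fixes \<kappa> :: "'p \<Rightarrow> 'h::{real_inner, second_countable_topology}"
  assumes [measurable]: "\<kappa> \<in> borel_measurable P"
    and sq: "integrable P (\<lambda>p. (norm (\<kappa> p))\<^sup>2)"
    and mean: "\<And>v. (\<integral>p. v \<bullet> \<kappa> p \<partial>P) = 0"
  shows "integrable M (\<lambda>x. (norm (\<Sum>l<n. \<kappa> (W l x)))\<^sup>2)"
    and "(\<integral>x. (norm (\<Sum>l<n. \<kappa> (W l x)))\<^sup>2 \<partial>M) = real n * (\<integral>p. (norm (\<kappa> p))\<^sup>2 \<partial>P)"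
proof -
  have expand: "(norm (\<Sum>l<n. \<kappa> (W l x)))\<^sup>2 = (\<Sum>l<n. \<Sum>k<n. \<kappa> (W l x) \<bullet> \<kappa> (W k x))" for x
    unfolding power2_norm_eq_inner by (simp add: inner_sum_left inner_sum_right) (rule sum.swap)
  have int: "integrable M (\<lambda>x. \<kappa> (W l x) \<bullet> \<kappa> (W k x))" for l k
  proof (rule Bochner_Integration.integrable_bound)
    show "integrable M (\<lambda>x. (norm (\<kappa> (W l x)))\<^sup>2 + (norm (\<kappa> (W k x)))\<^sup>2)"
      using integrable_W[OF sq] by simp
    have "\<bar>u \<bullet> w\<bar> \<le> (norm u)\<^sup>2 + (norm w)\<^sup>2" for u w :: 'h
      using Cauchy_Schwarz_ineq2[of u w] sum_squares_bound[of "norm u" "norm w"]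
        mult_nonneg_nonneg[OF norm_ge_zero[of u] norm_ge_zero[of w]] by linarith
    then show "AE x in M. norm (\<kappa> (W l x) \<bullet> \<kappa> (W k x)) \<le> norm ((norm (\<kappa> (W l x)))\<^sup>2 + (norm (\<kappa> (W k x)))\<^sup>2)"
      by simp
  qed measurable
  show "integrable M (\<lambda>x. (norm (\<Sum>l<n. \<kappa> (W l x)))\<^sup>2)"
    unfolding expand using int by simp
  interpret P: prob_space P by (rule prob_space_P)
  interpret PP: pair_prob_space P P ..
  have off: "(\<integral>x. \<kappa> (W l x) \<bullet> \<kappa> (W k x) \<partial>M) = 0" if "l \<noteq> k" for l k
  proof -
    have pair [measurable]: "(\<lambda>x. (W l x, W k x)) \<in> measurable M (P \<Otimes>\<^sub>M P)" by measurable
    have "integrable (distr M (P \<Otimes>\<^sub>M P) (\<lambda>x. (W l x, W k x))) (\<lambda>z. \<kappa> (fst z) \<bullet> \<kappa> (snd z))"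
      using int[of l k] by (subst integrable_distr_eq) auto
    then have "integrable (P \<Otimes>\<^sub>M P) (\<lambda>z. \<kappa> (fst z) \<bullet> \<kappa> (snd z))"
      unfolding distr_pair_W[OF that] .
    from PP.integral_fst'[OF this]
    have "(\<integral>z. \<kappa> (fst z) \<bullet> \<kappa> (snd z) \<partial>(P \<Otimes>\<^sub>M P)) = 0" by (simp add: mean)
    moreover have "(\<integral>x. \<kappa> (W l x) \<bullet> \<kappa> (W k x) \<partial>M) =
        (\<integral>z. \<kappa> (fst z) \<bullet> \<kappa> (snd z) \<partial>distr M (P \<Otimes>\<^sub>M P) (\<lambda>x. (W l x, W k x)))"
      by (subst integral_distr) auto
    ultimately show ?thesis unfolding distr_pair_W[OF that] by simp
  qed
  have diag: "(\<integral>x. \<kappa> (W l x) \<bullet> \<kappa> (W l x) \<partial>M) = (\<integral>p. (norm (\<kappa> p))\<^sup>2 \<partial>P)" for l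
    using integral_W[of "\<lambda>p. (norm (\<kappa> p))\<^sup>2" l] by (simp add: power2_norm_eq_inner)
  have "(\<integral>x. (norm (\<Sum>l<n. \<kappa> (W l x)))\<^sup>2 \<partial>M) = (\<Sum>l<n. \<Sum>k<n. (\<integral>x. \<kappa> (W l x) \<bullet> \<kappa> (W k x) \<partial>M))"
    unfolding expand using int by (simp add: Bochner_Integration.integral_sum)
  also have "\<dots> = (\<Sum>l<n. \<Sum>k<n. if k = l then (\<integral>p. (norm (\<kappa> p))\<^sup>2 \<partial>P) else 0)"
    using off diag by (intro sum.cong) auto
  also have "\<dots> = real n * (\<integral>p. (norm (\<kappa> p))\<^sup>2 \<partial>P)" by simp
  finally show "(\<integral>x. (norm (\<Sum>l<n. \<kappa> (W l x)))\<^sup>2 \<partial>M) = real n * (\<integral>p. (norm (\<kappa> p))\<^sup>2 \<partial>P)" .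
qed

end

locale centered_sample = iid_sample M P W + covariance_operator P \<kappa> T
  for M :: "'m measure" and P :: "'p measure" and W
    and \<kappa> :: "'p \<Rightarrow> 'h::{real_inner, complete_space, second_countable_topology}" and T +
  assumes mean: "\<And>v. (\<integral>p. v \<bullet> \<kappa> p \<partial>P) = 0"
begin

definition V :: "nat \<Rightarrow> 'm \<Rightarrow> 'h" where
  "V n x = (1 / sqrt (real n)) *\<^sub>R (\<Sum>l<n. \<kappa> (W l x))"

lemma V_measurable [measurable]: "V n \<in> borel_measurable M"
  unfolding V_def by measurable

lemma char_V: "(\<lambda>n. CLINT x|M. iexp (v \<bullet> V n x)) \<longlonglongrightarrow> exp (- (T v \<bullet> v) / 2)"
proof -
  have "(\<lambda>n. CLINT x|M. iexp ((\<Sum>l<n. v \<bullet> \<kappa> (W l x)) / sqrt (real n))) \<longlonglongrightarrow> exp (- (T v \<bullet> v) / 2)"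
  proof (rule central_limit_char)
    show "indep_vars (\<lambda>i. borel) (\<lambda>l x. v \<bullet> \<kappa> (W l x)) UNIV"
      by (intro indep_vars_compose2[OF indep_W]) measurable
    show "(\<integral>x. v \<bullet> \<kappa> (W n x) \<partial>M) = 0" for n
      by (subst integral_W) (simp_all add: mean)
    show "integrable M (\<lambda>x. (v \<bullet> \<kappa> (W n x))\<^sup>2)" for n
      using integrable_W[OF integrable_inner_square[of v]] by (simp add: inner_commute)
    show "(\<integral>x. (v \<bullet> \<kappa> (W n x))\<^sup>2 \<partial>M) = T v \<bullet> v" for n
      unfolding T_inner_self by (subst integral_W) (simp_all add: inner_commute)
    show "distr M borel (\<lambda>x. v \<bullet> \<kappa> (W n x)) = distr P borel (\<lambda>p. v \<bullet> \<kappa> p)" for n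
      using distr_distr[of "\<lambda>p. v \<bullet> \<kappa> p" P borel "W n" M] unfolding distr_W by (simp add: o_def)
  qed
  then show ?thesis unfolding V_def by (simp add: inner_sum_right)
qed

text \<open>The defect in Bessel's inequality is the squared norm of a linear remainder
  \<open>R\<close> of V_n, again a normalised sum of i.i.d. centred vectors. Its mean therefore does
  not depend on n, which provides the uniformity needed to exchange the limits in n and m.\<close>

lemma norm_V_diff_expansion:
  fixes e :: "nat \<Rightarrow> 'h"
  assumes e: "orthonormal_or_zero e" and lam: "\<And>i. (\<integral>p. (\<kappa> p \<bullet> e i)\<^sup>2 \<partial>P) = lam i" and "n > 0"
  shows "integrable M (\<lambda>x. (norm (V n x))\<^sup>2 - (\<Sum>i<m. (V n x \<bullet> e i)\<^sup>2))"
    and "(\<integral>x. ((norm (V n x))\<^sup>2 - (\<Sum>i<m. (V n x \<bullet> e i)\<^sup>2)) \<partial>M) =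
      (\<integral>p. (norm (\<kappa> p))\<^sup>2 \<partial>P) - (\<Sum>i<m. lam i)"
proof -
  define R where "R v = v - (\<Sum>i<m. (v \<bullet> e i) *\<^sub>R e i)" for v
  have linR: "linear R"
    unfolding R_def
    by (intro linearI)
       (simp_all add: inner_add_left scaleR_add_left sum.distrib scaleR_sum_right algebra_simps)
  interpret R: linear R by (rule linR)
  have norm_R: "(norm (R v))\<^sup>2 = (norm v)\<^sup>2 - (\<Sum>i<m. (v \<bullet> e i)\<^sup>2)" for v
    unfolding R_def by (rule orthonormal_or_zero_norm_diff[OF e]) simp
  have R_meas [measurable]: "(\<lambda>p. R (\<kappa> p)) \<in> borel_measurable P" unfolding R_def by measurable
  have int_R: "integrable P (\<lambda>p. (norm (R (\<kappa> p)))\<^sup>2)"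
    unfolding norm_R using square_integrable integrable_inner_square by simp
  have mean_R: "(\<integral>p. v \<bullet> R (\<kappa> p) \<partial>P) = 0" for v
  proof -
    have "v \<bullet> R (\<kappa> p) = R v \<bullet> \<kappa> p" for p
      unfolding R_def
      by (simp add: inner_diff_left inner_diff_right inner_sum_left inner_sum_right inner_commute mult.commute)
    then show ?thesis by (simp add: mean)
  qed
  have R_V: "(norm (R (V n x)))\<^sup>2 = (1 / real n) * (norm (\<Sum>l<n. R (\<kappa> (W l x))))\<^sup>2" for x
    unfolding V_def R.scaleR R.sum using \<open>n > 0\<close>
    by (simp add: power_divide)
  note sum_sq = norm_sum_square[OF R_meas int_R mean_R, of n]
  show "integrable M (\<lambda>x. (norm (V n x))\<^sup>2 - (\<Sum>i<m. (V n x \<bullet> e i)\<^sup>2))"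
    unfolding norm_R[symmetric] R_V using sum_sq(1) by simp
  have "(\<integral>x. (norm (R (V n x)))\<^sup>2 \<partial>M) = (\<integral>p. (norm (R (\<kappa> p)))\<^sup>2 \<partial>P)"
    unfolding R_V using sum_sq(2) \<open>n > 0\<close> by simp
  also have "\<dots> = (\<integral>p. (norm (\<kappa> p))\<^sup>2 \<partial>P) - (\<Sum>i<m. lam i)"
    unfolding norm_R using square_integrable integrable_inner_square
    by (simp add: Bochner_Integration.integral_diff Bochner_Integration.integral_sum lam)
  finally show "(\<integral>x. ((norm (V n x))\<^sup>2 - (\<Sum>i<m. (V n x \<bullet> e i)\<^sup>2)) \<partial>M) =
      (\<integral>p. (norm (\<kappa> p))\<^sup>2 \<partial>P) - (\<Sum>i<m. lam i)" unfolding norm_R .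
qed

text \<open>By \<open>exp (- c\<^sup>2 / 2) = E (exp (\<i> c Q))\<close> for standard normal \<open>Q\<close>, the Laplace transform of a sum of
  squares is a mixture of characteristic functions of linear forms, to which the one-dimensional
  central limit theorem applies.\<close>

lemma laplace_transform_finite_sum:
  assumes N: "std_normal_sequence N Q"
    and e: "orthonormal_or_zero e" and T_e: "\<And>i. T (e i) = lam i *\<^sub>R e i"
    and e0: "\<And>i. e i = 0 \<longleftrightarrow> lam i = 0" and "0 \<le> s"
  shows "(\<lambda>n. \<integral>x. exp (- (s * (\<Sum>i<m. (V n x \<bullet> e i)\<^sup>2))) \<partial>M)
    \<longlonglongrightarrow> (\<integral>q. exp (- (s * (\<Sum>i<m. lam i * (Q i q)\<^sup>2))) \<partial>N)"
proof -
  interpret N: std_normal_sequence N Q by fact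
  interpret MN: pair_prob_space M N ..
  interpret T: linear T by (rule linear_T)
  \<comment> \<open>Chosen so that c = r (V_n \<bullet> e_i) satisfies c^2 / 2 = s (V_n \<bullet>
    e_i)^2.\<close>
  define r where "r = sqrt (2 * s)"
  have r: "r\<^sup>2 = 2 * s" unfolding r_def using \<open>0 \<le> s\<close> by simp
  define F where "F n x q = iexp (\<Sum>i<m. (r * (V n x \<bullet> e i)) * Q i q)" for n x q
  define v where "v q = (\<Sum>i<m. (r * Q i q) *\<^sub>R e i)" for q
  have F_v: "F n x q = iexp (v q \<bullet> V n x)" for n x q
  proof -
    have "(\<Sum>i<m. (r * (V n x \<bullet> e i)) * Q i q) = v q \<bullet> V n x"
      unfolding v_def by (simp add: inner_sum_left inner_commute[of "V n x"] mult_ac)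
    then show ?thesis unfolding F_def by simp
  qed
  have F_meas [measurable]: "(\<lambda>z. F n (fst z) (snd z)) \<in> borel_measurable (M \<Otimes>\<^sub>M N)" for n
    unfolding F_def by measurable
  have F_norm: "norm (F n x q) = 1" for n x q
    unfolding F_def by (simp only: norm_exp_i_times)
  have F_int: "integrable (M \<Otimes>\<^sub>M N) (case_prod (F n))" for n
    using F_meas by (intro MN.integrable_const_bound[where B = 1]) (auto simp: F_norm split_beta')
  have lhs: "complex_of_real (\<integral>x. exp (- (s * (\<Sum>i<m. (V n x \<bullet> e i)\<^sup>2))) \<partial>M) = (CLINT q|N. CLINT x|M. F n x q)" for n
  proof -
    have "(CLINT q|N. F n x q) = complex_of_real (exp (- (s * (\<Sum>i<m. (V n x \<bullet> e i)\<^sup>2))))" for x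
    proof -
      have "(\<Sum>i<m. (r * (V n x \<bullet> e i))\<^sup>2) / 2 = s * (\<Sum>i<m. (V n x \<bullet> e i)\<^sup>2)"
        unfolding power_mult_distrib r by (simp add: sum_distrib_left sum_divide_distrib mult.assoc)
      then show ?thesis unfolding F_def N.char_linear_combination by (metis minus_divide_left)
    qed
    then have "complex_of_real (\<integral>x. exp (- (s * (\<Sum>i<m. (V n x \<bullet> e i)\<^sup>2))) \<partial>M) = (CLINT x|M. CLINT q|N. F n x q)"
      by simp
    also have "\<dots> = (CLINT q|N. CLINT x|M. F n x q)"
      by (rule MN.Fubini_integral[OF F_int, symmetric])
    finally show ?thesis .
  qed
  \<comment> \<open>Half the limiting variance in the random direction \<open>v q\<close> is exactly
    the exponent in the claim. The sequence Q thus serves both as the mixing variable and as the one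
    that describes the limit.\<close>
  have Tv: "T (v q) \<bullet> v q / 2 = s * (\<Sum>i<m. lam i * (Q i q)\<^sup>2)" for q
  proof -
    have ee: "lam i * (e i \<bullet> e j) = (if i = j then lam i else 0)" for i j
      using e e0 unfolding orthonormal_or_zero_def by (cases "lam i = 0") (auto simp: dot_square_norm)
    have "T (v q) \<bullet> v q = (\<Sum>i<m. \<Sum>j<m. (r * Q i q) * (r * Q j q) * (lam i * (e i \<bullet> e j)))"
      unfolding v_def T.sum T.scaleR T_e
      by (simp add: inner_sum_left inner_sum_right mult_ac sum_distrib_left)
         (subst sum.swap, simp add: mult_ac)
    also have "\<dots> = (\<Sum>i<m. r\<^sup>2 * (lam i * (Q i q)\<^sup>2))"
      unfolding ee by (simp add: power2_eq_square mult_ac if_distrib cong: if_cong)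
    finally show ?thesis unfolding r by (simp add: sum_distrib_left sum_divide_distrib)
  qed
  have "(\<lambda>n. CLINT q|N. CLINT x|M. F n x q) \<longlonglongrightarrow>
      (CLINT q|N. complex_of_real (exp (- (s * (\<Sum>i<m. lam i * (Q i q)\<^sup>2)))))"
  proof (rule integral_dominated_convergence[where w = "\<lambda>_. 1"])
    show "(\<lambda>q. CLINT x|M. F n x q) \<in> borel_measurable N" for n
    proof -
      have "(\<lambda>z. F n (snd z) (fst z)) \<in> borel_measurable (N \<Otimes>\<^sub>M M)" unfolding F_def by measurable
      then show ?thesis by (intro borel_measurable_lebesgue_integral) (simp add: split_beta')
    qed
    show "AE q in N. (\<lambda>n. CLINT x|M. F n x q) \<longlonglongrightarrow> complex_of_real (exp (- (s * (\<Sum>i<m. lam i * (Q i q)\<^sup>2))))"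
    proof (rule AE_I2)
      fix q
      show "(\<lambda>n. CLINT x|M. F n x q) \<longlonglongrightarrow> complex_of_real (exp (- (s * (\<Sum>i<m. lam i * (Q i q)\<^sup>2))))"
        using char_V[of "v q"] unfolding F_v Tv[symmetric] by simp
    qed
    show "AE q in N. norm (CLINT x|M. F n x q) \<le> 1" for n
    proof (rule AE_I2)
      fix q
      have "norm (CLINT x|M. F n x q) \<le> (\<integral>x. norm (F n x q) \<partial>M)" by (rule integral_norm_bound)
      then show "norm (CLINT x|M. F n x q) \<le> 1" by (simp add: F_norm prob_space)
    qed
  qed simp_all
  then have "(\<lambda>n. complex_of_real (\<integral>x. exp (- (s * (\<Sum>i<m. (V n x \<bullet> e i)\<^sup>2))) \<partial>M)) \<longlonglongrightarrow>
      complex_of_real (\<integral>q. exp (- (s * (\<Sum>i<m. lam i * (Q i q)\<^sup>2))) \<partial>N)"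
    unfolding lhs by simp
  then show ?thesis by (simp only: tendsto_of_real_iff)
qed

text \<open>Since exp (- s u) is Lipschitz with constant s for u \<ge> 0, truncating at m changes
  the transform by at most s times the eigenvalue tail, for every n > 0. Hence m can be fixed first,
  and n sent to infinity afterwards.\<close>

lemma laplace_transform_norm_square:
  assumes N: "std_normal_sequence N Q" and lam: "eigenvalue_sequence T lam" and "0 \<le> s"
  shows "AE q in N. summable (\<lambda>i. lam i * (Q i q)\<^sup>2)"
    and "AE q in N. 0 \<le> (\<Sum>i. lam i * (Q i q)\<^sup>2)"
    and "(\<lambda>n. \<integral>x. exp (- (s * (norm (V n x))\<^sup>2)) \<partial>M)
      \<longlonglongrightarrow> (\<integral>q. exp (- (s * (\<Sum>i. lam i * (Q i q)\<^sup>2))) \<partial>N)"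
proof -
  interpret N: std_normal_sequence N Q by fact
  obtain e where e: "orthonormal_or_zero e" and T_e: "\<And>i. T (e i) = lam i *\<^sub>R e i"
    and e0: "\<And>i. e i = 0 \<longleftrightarrow> lam i = 0"
    and complete: "\<And>v. (\<And>i. v \<bullet> e i = 0) \<Longrightarrow> T v = 0"
    using eigenvalue_sequence_eigenvectors[OF lam] by blast
  have trace: "\<And>i. (\<integral>p. (\<kappa> p \<bullet> e i)\<^sup>2 \<partial>P) = lam i" "lam sums (\<integral>p. (norm (\<kappa> p))\<^sup>2 \<partial>P)"
    using trace_formula[of e lam] e complete T_e e0 by blast+
  have lam_nonneg: "0 \<le> lam i" for i
  proof -
    have "0 \<le> (\<integral>p. (\<kappa> p \<bullet> e i)\<^sup>2 \<partial>P)" by simp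
    then show ?thesis using trace(1)[of i] by simp
  qed
  show summ: "AE q in N. summable (\<lambda>i. lam i * (Q i q)\<^sup>2)"
    using N.AE_summable_weighted_squares lam_nonneg sums_summable[OF trace(2)] by blast
  then show "AE q in N. 0 \<le> (\<Sum>i. lam i * (Q i q)\<^sup>2)"
    by eventually_elim (simp add: suminf_nonneg lam_nonneg)
  define tr where "tr = (\<integral>p. (norm (\<kappa> p))\<^sup>2 \<partial>P)"
  define a where "a m n = (\<integral>x. exp (- (s * (\<Sum>i<m. (V n x \<bullet> e i)\<^sup>2))) \<partial>M)" for m n
  define b where "b m = (\<integral>q. exp (- (s * (\<Sum>i<m. lam i * (Q i q)\<^sup>2))) \<partial>N)" for m
  define c where "c = (\<integral>q. exp (- (s * (\<Sum>i. lam i * (Q i q)\<^sup>2))) \<partial>N)"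
  have a_lim: "a m \<longlonglongrightarrow> b m" for m
    unfolding a_def[abs_def] b_def by (rule laplace_transform_finite_sum[OF N e T_e e0 \<open>0 \<le> s\<close>])
  have b_lim: "b \<longlonglongrightarrow> c"
    unfolding b_def[abs_def] c_def
  proof (rule integral_dominated_convergence[where w = "\<lambda>_. 1"])
    show "AE q in N. (\<lambda>m. exp (- (s * (\<Sum>i<m. lam i * (Q i q)\<^sup>2)))) \<longlonglongrightarrow> exp (- (s * (\<Sum>i. lam i * (Q i q)\<^sup>2)))"
      using summ by eventually_elim (intro tendsto_intros summable_LIMSEQ)
    show "AE q in N. norm (exp (- (s * (\<Sum>i<m. lam i * (Q i q)\<^sup>2)))) \<le> 1" for m
      using lam_nonneg \<open>0 \<le> s\<close> by (simp add: sum_nonneg)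
  qed simp_all
  have bound: "\<bar>(\<integral>x. exp (- (s * (norm (V n x))\<^sup>2)) \<partial>M) - a m n\<bar> \<le> s * (tr - (\<Sum>i<m. lam i))" if "n > 0" for m n
  proof -
    note diff = norm_V_diff_expansion[OF e trace(1) that, of m]
    have le: "(\<Sum>i<m. (V n x \<bullet> e i)\<^sup>2) \<le> (norm (V n x))\<^sup>2" for x
      by (rule bessel_inequality[OF e]) simp
    have exp_le: "\<bar>exp (- (s * u)) - exp (- (s * w))\<bar> \<le> s * (u - w)" if "0 \<le> w" "w \<le> u" for u w
    proof -
      have "1 + (- (s * (u - w))) \<le> exp (- (s * (u - w)))" by (rule exp_ge_add_one_self)
      moreover have "exp (- (s * w)) \<le> 1" using \<open>0 \<le> s\<close> that by simp
      moreover have "exp (- (s * u)) = exp (- (s * w)) * exp (- (s * (u - w)))"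
        by (simp add: exp_add[symmetric] algebra_simps)
      moreover have "exp (- (s * w)) * (1 - exp (- (s * (u - w)))) \<le> 1 * (1 - exp (- (s * (u - w))))"
        using \<open>0 \<le> s\<close> that by (intro mult_right_mono) auto
      moreover have "exp (- (s * u)) \<le> exp (- (s * w))" using that \<open>0 \<le> s\<close> by (simp add: mult_left_mono)
      ultimately show ?thesis by (simp add: algebra_simps)
    qed
    have int1: "integrable M (\<lambda>x. exp (- (s * (norm (V n x))\<^sup>2)))"
      using \<open>0 \<le> s\<close> by (intro integrable_const_bound[where B = 1]) auto
    have int2: "integrable M (\<lambda>x. exp (- (s * (\<Sum>i<m. (V n x \<bullet> e i)\<^sup>2))))"
      using \<open>0 \<le> s\<close> by (intro integrable_const_bound[where B = 1]) (auto simp: sum_nonneg)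
    have "\<bar>(\<integral>x. exp (- (s * (norm (V n x))\<^sup>2)) - exp (- (s * (\<Sum>i<m. (V n x \<bullet> e i)\<^sup>2))) \<partial>M)\<bar>
        \<le> (\<integral>x. \<bar>exp (- (s * (norm (V n x))\<^sup>2)) - exp (- (s * (\<Sum>i<m. (V n x \<bullet> e i)\<^sup>2)))\<bar> \<partial>M)"
      by (rule integral_abs_bound)
    also have "\<dots> \<le> (\<integral>x. s * ((norm (V n x))\<^sup>2 - (\<Sum>i<m. (V n x \<bullet> e i)\<^sup>2)) \<partial>M)"
      using int1 int2 diff(1) le by (intro integral_mono exp_le) (auto simp: sum_nonneg)
    also have "\<dots> = s * (tr - (\<Sum>i<m. lam i))"
      using diff by (simp add: tr_def)
    finally show ?thesis unfolding a_def using int1 int2 by simp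
  qed
  have "(\<lambda>m. s * (tr - (\<Sum>i<m. lam i))) \<longlonglongrightarrow> s * (tr - tr)"
    using trace(2) unfolding tr_def sums_def by (intro tendsto_intros)
  then have tail: "(\<lambda>m. s * (tr - (\<Sum>i<m. lam i))) \<longlonglongrightarrow> 0" by simp
  show "(\<lambda>n. \<integral>x. exp (- (s * (norm (V n x))\<^sup>2)) \<partial>M) \<longlonglongrightarrow> (\<integral>q. exp (- (s * (\<Sum>i. lam i * (Q i q)\<^sup>2))) \<partial>N)"
    unfolding c_def[symmetric]
  proof (rule LIMSEQ_I)
    fix \<epsilon> :: real assume "\<epsilon> > 0"
    have "eventually (\<lambda>m. s * (tr - (\<Sum>i<m. lam i)) < \<epsilon> / 3 \<and> dist (b m) c < \<epsilon> / 3) sequentially"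
      using order_tendstoD(2)[OF tail, of "\<epsilon> / 3"] tendstoD[OF b_lim, of "\<epsilon> / 3"] \<open>\<epsilon> > 0\<close>
      by (intro eventually_conj) auto
    then obtain m where m: "s * (tr - (\<Sum>i<m. lam i)) < \<epsilon> / 3" "dist (b m) c < \<epsilon> / 3"
      using eventually_happens'[OF sequentially_bot] by blast
    obtain n0 where n0: "\<And>n. n \<ge> n0 \<Longrightarrow> norm (a m n - b m) < \<epsilon> / 3"
      using LIMSEQ_D[OF a_lim[of m], of "\<epsilon> / 3"] \<open>\<epsilon> > 0\<close> by auto
    have "norm ((\<integral>x. exp (- (s * (norm (V n x))\<^sup>2)) \<partial>M) - c) < \<epsilon>" if "n \<ge> Suc n0" for n
      using n0[of n] bound[of n m] m that unfolding dist_real_def real_norm_def by linarith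
    then show "\<exists>n0. \<forall>n\<ge>n0. norm ((\<integral>x. exp (- (s * (norm (V n x))\<^sup>2)) \<partial>M) - c) < \<epsilon>" by blast
  qed
qed

end

section \<open>Conditional independence\<close>

lemma (in prob_space) finite_measure_subalgebra_vimage:
  assumes "U \<in> borel_measurable M"
  shows "finite_measure_subalgebra M (vimage_algebra (space M) U borel)"
proof unfold_locales
  show "subalgebra M (vimage_algebra (space M) U borel)"
    unfolding subalgebra_def using assms
    by (auto simp: sets_vimage_algebra2 intro: measurable_sets)
qed

lemma measurable_comp_vimage_algebra:
  "f \<in> measurable borel N \<Longrightarrow> (\<lambda>x. f (U x)) \<in> measurable (vimage_algebra (space M) U borel) N"
  by (rule measurable_compose[OF measurable_vimage_algebra1]) auto

lemma (in prob_space) real_cond_exp_vimage_charact: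
  assumes U: "U \<in> borel_measurable M" and V: "integrable M V"
    and h: "h \<in> borel_measurable borel" "integrable M (\<lambda>x. h (U x))"
    and eq: "\<And>A. A \<in> sets borel \<Longrightarrow> (\<integral>x. indicator A (U x) * (V x - h (U x)) \<partial>M) = 0"
  shows "AE x in M. real_cond_exp M (vimage_algebra (space M) U borel) V x = h (U x)"
proof -
  let ?F = "vimage_algebra (space M) U borel"
  interpret finite_measure_subalgebra M ?F by (rule finite_measure_subalgebra_vimage[OF U])
  show ?thesis
  proof (rule real_cond_exp_charact)
    fix A assume "A \<in> sets ?F"
    then obtain B where B: "B \<in> sets borel" "A = U -` B \<inter> space M"
      by (auto simp: sets_vimage_algebra2)
    have ind: "indicator A x *\<^sub>R V x = indicator B (U x) * V x"
      "indicator A x *\<^sub>R h (U x) = indicator B (U x) * h (U x)" if "x \<in> space M" for x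
      using that unfolding B(2) by (auto simp: indicator_def)
    have [measurable]: "U \<in> borel_measurable M" "B \<in> sets borel" using U B by auto
    have "integrable M (\<lambda>x. indicator B (U x) * V x)" "integrable M (\<lambda>x. indicator B (U x) * h (U x))"
      by (rule Bochner_Integration.integrable_bound[OF V] Bochner_Integration.integrable_bound[OF h(2)];
          use V h in \<open>auto simp: indicator_def\<close>)+
    then have "(\<integral>x. indicator B (U x) * V x \<partial>M) = (\<integral>x. indicator B (U x) * h (U x) \<partial>M)"
      using eq[OF B(1)] by (simp add: right_diff_distrib)
    then show "(\<integral>x\<in>A. V x \<partial>M) = (\<integral>x\<in>A. h (U x) \<partial>M)"
      unfolding set_lebesgue_integral_def by (simp only: ind cong: Bochner_Integration.integral_cong)
  qed (use V h measurable_comp_vimage_algebra in auto)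
qed

text \<open>Rectangles form an intersection-stable generator, and the sets over which D integrates
  to 0 are closed under complements and countable disjoint unions. The full rectangle supplies the
  total integral 0 that complements require.\<close>

lemma (in prob_space) integral_indicator_pair_eq_0:
  fixes X :: "'a \<Rightarrow> 'b::second_countable_topology" and Z :: "'a \<Rightarrow> 'c::second_countable_topology"
    and D :: "'a \<Rightarrow> real"
  assumes [measurable]: "X \<in> borel_measurable M" "Z \<in> borel_measurable M" and D: "integrable M D"
    and rect: "\<And>A C. A \<in> sets borel \<Longrightarrow> C \<in> sets borel \<Longrightarrow>
      (\<integral>x. indicator A (X x) * indicator C (Z x) * D x \<partial>M) = 0"
    and S: "S \<in> sets borel"
  shows "(\<integral>x. indicator S (X x, Z x) * D x \<partial>M) = 0"
proof -
  note [measurable] = borel_measurable_integrable[OF D]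
  define G where "G = {A \<times> C | A C. A \<in> sets (borel :: 'b measure) \<and> C \<in> sets (borel :: 'c measure)}"
  have pair [measurable]: "(\<lambda>x. (X x, Z x)) \<in> borel_measurable M" by measurable
  have borel_G: "sets (borel :: ('b \<times> 'c) measure) = sigma_sets UNIV G"
    unfolding borel_prod[symmetric] sets_pair_measure G_def by simp
  have int: "integrable M (\<lambda>x. indicator S (X x, Z x) * D x)" if "S \<in> sets borel" for S
  proof (rule Bochner_Integration.integrable_bound[OF D])
    show "(\<lambda>x. indicator S (X x, Z x) * D x) \<in> borel_measurable M" using that by measurable
  qed (auto simp: indicator_def)
  have "Int_stable G" unfolding G_def by (rule Int_stable_pair_measure_generator)
  moreover have "G \<subseteq> Pow UNIV" by simp
  moreover have "S \<in> sigma_sets UNIV G" using S unfolding borel_G .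
  ultimately show ?thesis
  proof (induction rule: sigma_sets_induct_disjoint)
    case (basic S)
    then obtain A C where AC: "S = A \<times> C" "A \<in> sets borel" "C \<in> sets borel" unfolding G_def by auto
    have "indicator S (X x, Z x) = (indicator A (X x) * indicator C (Z x) :: real)" for x
      unfolding AC by (simp add: indicator_times)
    then show ?case using rect[OF AC(2,3)] by simp
  next
    case empty
    then show ?case by simp
  next
    case (compl S)
    then have "S \<in> sets borel" unfolding borel_G by simp
    have "indicator (UNIV - S) (X x, Z x) * D x = D x - indicator S (X x, Z x) * D x" for x
      by (simp add: indicator_def)
    moreover have "(\<integral>x. D x \<partial>M) = 0" using rect[of UNIV UNIV] by simp
    ultimately show ?case using compl D int[OF \<open>S \<in> sets borel\<close>] by simp
  next
    case (union S)
    then have meas [measurable]: "S i \<in> sets borel" for i unfolding borel_G by auto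
    have part: "(\<integral>x. indicator (\<Union>i<n. S i) (X x, Z x) * D x \<partial>M) = 0" for n
    proof -
      have "indicator (\<Union>i<n. S i) (X x, Z x) * D x = (\<Sum>i<n. indicator (S i) (X x, Z x) * D x)" for x
        using union(1) unfolding sum_distrib_right[symmetric]
        by (subst indicator_UN_disjoint) (auto simp: disjoint_family_on_def)
      then have "(\<integral>x. indicator (\<Union>i<n. S i) (X x, Z x) * D x \<partial>M) =
          (\<integral>x. (\<Sum>i<n. indicator (S i) (X x, Z x) * D x) \<partial>M)"
        by (simp only:)
      also have "\<dots> = (\<Sum>i<n. \<integral>x. indicator (S i) (X x, Z x) * D x \<partial>M)"
        by (intro Bochner_Integration.integral_sum int meas)
      finally show ?thesis using union(3) by simp
    qed
    have [measurable]: "(\<Union>i. S i) \<in> sets borel" "(\<Union>i<n. S i) \<in> sets borel" for n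
      using meas by auto
    have "(\<lambda>n. \<integral>x. indicator (\<Union>i<n. S i) (X x, Z x) * D x \<partial>M) \<longlonglongrightarrow>
        (\<integral>x. indicator (\<Union>i. S i) (X x, Z x) * D x \<partial>M)"
    proof (rule integral_dominated_convergence[where w = "\<lambda>x. \<bar>D x\<bar>"])
      show "AE x in M. (\<lambda>n. indicator (\<Union>i<n. S i) (X x, Z x) * D x) \<longlonglongrightarrow> indicator (\<Union>i. S i) (X x, Z x) * D x"
        by (intro AE_I2 tendsto_mult tendsto_const LIMSEQ_indicator_UN)
      show "AE x in M. norm (indicator (\<Union>i<n. S i) (X x, Z x) * D x) \<le> \<bar>D x\<bar>" for n
        by (auto simp: indicator_def)
      show "integrable M (\<lambda>x. \<bar>D x\<bar>)" using D by simp
    qed measurable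
    then show ?case unfolding part by (simp add: LIMSEQ_const_iff)
  qed
qed

text \<open>The form in which the null hypothesis is used: adding X to the conditioning on Z changes
  nothing for functions of (Z, Y). The definition only provides indicators. They show that D, the
  indicator of A at X minus its conditional expectation given Z, integrates to 0 over rectangles in
  (Z, Y), so that E(D | Z, Y) = 0; pairing D with \<phi>(Z, Y), which may be unbounded, gives the
  claim on rectangles in (Z, X).\<close>

lemma (in prob_space) cond_indep_real_cond_exp:
  fixes X :: "'a \<Rightarrow> 'b::second_countable_topology" and Y :: "'a \<Rightarrow> 'c::second_countable_topology"
    and Z :: "'a \<Rightarrow> 'd::second_countable_topology"
  assumes [measurable]: "X \<in> borel_measurable M" "Y \<in> borel_measurable M" "Z \<in> borel_measurable M"
    and ci: "cond_indep_given M X Y Z"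
    and \<phi> [measurable]: "\<phi> \<in> borel_measurable borel" and int: "integrable M (\<lambda>x. \<phi> (Z x, Y x))"
    and h [measurable]: "h \<in> borel_measurable borel"
    and cond: "AE x in M. real_cond_exp M (vimage_algebra (space M) Z borel) (\<lambda>x. \<phi> (Z x, Y x)) x = h (Z x)"
  shows "AE x in M. real_cond_exp M (vimage_algebra (space M) (\<lambda>x. (Z x, X x)) borel) (\<lambda>x. \<phi> (Z x, Y x)) x = h (Z x)"
proof -
  define F where "F = vimage_algebra (space M) Z borel"
  define F2 where "F2 = vimage_algebra (space M) (\<lambda>x. (Z x, Y x)) borel"
  interpret F: finite_measure_subalgebra M F
    unfolding F_def by (rule finite_measure_subalgebra_vimage) measurable
  interpret F2: finite_measure_subalgebra M F2
    unfolding F2_def by (rule finite_measure_subalgebra_vimage) measurable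
  have Z_F [measurable]: "Z \<in> measurable F borel"
    unfolding F_def using measurable_comp_vimage_algebra[of "\<lambda>z. z" borel Z M] by simp
  have cond_F: "AE x in M. real_cond_exp M F (\<lambda>x. \<phi> (Z x, Y x)) x = h (Z x)"
    using cond unfolding F_def .
  have int_h: "integrable M (\<lambda>x. h (Z x))"
  proof -
    have "integrable M (real_cond_exp M F (\<lambda>x. \<phi> (Z x, Y x)))" using int by (rule F.real_cond_exp_int(1))
    then show ?thesis
      by (rule integrable_cong_AE_imp) (use cond_F in \<open>auto elim: eventually_mono\<close>)
  qed
  have zero: "(\<integral>x. indicator C (Z x) * indicator A (X x) * (\<phi> (Z x, Y x) - h (Z x)) \<partial>M) = 0"
    if AC [measurable]: "A \<in> sets borel" "C \<in> sets borel" for A C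
  proof -
    define a where "a x = (indicator A (X x) :: real)" for x
    define c where "c x = (indicator C (Z x) :: real)" for x
    define u where "u = real_cond_exp M F a"
    have [measurable]: "a \<in> borel_measurable M" "c \<in> borel_measurable M" "c \<in> borel_measurable F"
      "u \<in> borel_measurable F" "u \<in> borel_measurable M"
      unfolding a_def[abs_def] c_def[abs_def] u_def by measurable
    have a01: "0 \<le> a x" "a x \<le> 1" and c01: "\<bar>c x\<bar> \<le> 1" for x by (auto simp: a_def c_def)
    have int_a: "integrable M a" using a01 by (intro integrable_const_bound[where B = 1]) auto
    have u01: "AE x in M. 0 \<le> u x \<and> u x \<le> 1"
      unfolding u_def using F.real_cond_exp_ge_c[OF int_a, of 0] F.real_cond_exp_le_c[OF int_a, of 1] a01 by auto
    have bounded_int: "integrable M (\<lambda>x. v x * w x)"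
      if "AE x in M. \<bar>v x\<bar> \<le> 1" "v \<in> borel_measurable M" "integrable M w" for v w :: "'a \<Rightarrow> real"
    proof (rule Bochner_Integration.integrable_bound[OF that(3)])
      show "AE x in M. norm (v x * w x) \<le> norm (w x)"
        using that(1) by eventually_elim (simp add: abs_mult mult_left_le_one_le)
    qed (use that in measurable)
    have cu: "AE x in M. \<bar>c x * u x\<bar> \<le> 1"
      using u01 by eventually_elim (use c01 in \<open>auto simp: abs_mult intro: mult_le_one\<close>)
    have ca: "AE x in M. \<bar>c x * a x\<bar> \<le> 1"
      by (auto simp: a_def c_def indicator_def)
    define D where "D x = a x - u x" for x
    have [measurable]: "D \<in> borel_measurable M" unfolding D_def by measurable
    have D1: "AE x in M. \<bar>D x\<bar> \<le> 1"
      using u01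
    proof eventually_elim
      case (elim x)
      then show ?case using a01[of x] unfolding D_def by linarith
    qed
    have int_D: "integrable M D" using D1 by (intro integrable_const_bound[where B = 1]) auto
    have rect: "(\<integral>x. indicator C' (Z x) * indicator B (Y x) * D x \<partial>M) = 0"
      if [measurable]: "C' \<in> sets borel" "B \<in> sets borel" for B C'
    proof -
      define b where "b x = (indicator B (Y x) :: real)" for x
      define c' where "c' x = (indicator C' (Z x) :: real)" for x
      have [measurable]: "b \<in> borel_measurable M" "c' \<in> borel_measurable M" "c' \<in> borel_measurable F"
        unfolding b_def[abs_def] c'_def[abs_def] by measurable
      have b1: "\<bar>b x\<bar> \<le> 1" and c'1: "\<bar>c' x\<bar> \<le> 1" for x by (auto simp: b_def c'_def)
      have int_b: "integrable M b" using b1 by (intro integrable_const_bound[where B = 1]) auto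
      have int_ab: "integrable M (\<lambda>x. a x * b x)" by (rule bounded_int) (use a01 int_b in auto)
      have int_cab: "integrable M (\<lambda>x. c' x * (a x * b x))" by (rule bounded_int) (use c'1 int_ab in auto)
      have c'u: "AE x in M. \<bar>c' x * u x\<bar> \<le> 1"
        using u01 by eventually_elim (use c'1 in \<open>auto simp: abs_mult intro: mult_le_one\<close>)
      have int_cub: "integrable M (\<lambda>x. (c' x * u x) * b x)" by (rule bounded_int) (use c'u int_b in auto)
      have "AE x in M. real_cond_exp M F (\<lambda>x. a x * b x) x = u x * real_cond_exp M F b x"
        using ci AC(1) that(2) unfolding cond_indep_given_def Let_def F_def u_def a_def[abs_def] b_def[abs_def] by blast
      then have "(\<integral>x. c' x * real_cond_exp M F (\<lambda>x. a x * b x) x \<partial>M) = (\<integral>x. (c' x * u x) * real_cond_exp M F b x \<partial>M)"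
        by (intro integral_cong_AE) (auto elim: eventually_mono)
      then have "(\<integral>x. c' x * (a x * b x) \<partial>M) = (\<integral>x. (c' x * u x) * b x \<partial>M)"
        using F.real_cond_exp_intg(2)[OF int_cab] F.real_cond_exp_intg(2)[OF int_cub] by simp
      moreover have "(\<integral>x. c' x * b x * D x \<partial>M) = (\<integral>x. c' x * (a x * b x) - (c' x * u x) * b x \<partial>M)"
        by (simp add: D_def algebra_simps)
      ultimately show ?thesis using int_cab int_cub by (simp add: b_def c'_def)
    qed
    have "AE x in M. real_cond_exp M F2 D x = 0"
      unfolding F2_def
    proof (rule real_cond_exp_vimage_charact[where h = "\<lambda>_. 0"])
      show "(\<integral>x. indicator S (Z x, Y x) * (D x - 0) \<partial>M) = 0" if "S \<in> sets borel" for S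
        using integral_indicator_pair_eq_0[of Z Y D S] rect int_D that by simp
    qed (use int_D in auto)
    then have "(\<integral>x. (c x * \<phi> (Z x, Y x)) * real_cond_exp M F2 D x \<partial>M) = (\<integral>x. 0 \<partial>M)"
      by (intro integral_cong_AE) (auto elim: eventually_mono)
    moreover have "(\<integral>x. (c x * \<phi> (Z x, Y x)) * real_cond_exp M F2 D x \<partial>M) = (\<integral>x. (c x * \<phi> (Z x, Y x)) * D x \<partial>M)"
    proof (rule F2.real_cond_exp_intg(2))
      have "AE x in M. \<bar>c x * D x\<bar> \<le> 1"
        using D1 by eventually_elim (use c01 in \<open>auto simp: abs_mult intro: mult_le_one\<close>)
      from bounded_int[OF this _ int] show "integrable M (\<lambda>x. (c x * \<phi> (Z x, Y x)) * D x)"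
        by (simp add: mult_ac)
      have [measurable]: "\<phi> \<in> borel_measurable (borel \<Otimes>\<^sub>M borel)" using \<phi> unfolding borel_prod .
      have "(\<lambda>p. indicator C (fst p) * \<phi> p) \<in> borel_measurable (borel \<Otimes>\<^sub>M borel)" by measurable
      then have "(\<lambda>p. indicator C (fst p) * \<phi> p) \<in> borel_measurable borel" unfolding borel_prod .
      from measurable_comp_vimage_algebra[OF this, of "\<lambda>x. (Z x, Y x)" M]
      show "(\<lambda>x. c x * \<phi> (Z x, Y x)) \<in> borel_measurable F2" unfolding F2_def c_def by simp
    qed simp
    ultimately have *: "(\<integral>x. (c x * \<phi> (Z x, Y x)) * D x \<partial>M) = 0" by simp
    have i1: "integrable M (\<lambda>x. (c x * a x) * \<phi> (Z x, Y x))" by (rule bounded_int) (use ca int in auto)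
    have i2: "integrable M (\<lambda>x. (c x * u x) * \<phi> (Z x, Y x))" by (rule bounded_int) (use cu int in auto)
    have i3: "integrable M (\<lambda>x. (c x * a x) * h (Z x))" by (rule bounded_int) (use ca int_h in auto)
    have "(\<integral>x. (c x * a x) * \<phi> (Z x, Y x) \<partial>M) = (\<integral>x. (c x * u x) * \<phi> (Z x, Y x) \<partial>M)"
    proof -
      have "(\<integral>x. (c x * a x) * \<phi> (Z x, Y x) \<partial>M) - (\<integral>x. (c x * u x) * \<phi> (Z x, Y x) \<partial>M) = (\<integral>x. (c x * \<phi> (Z x, Y x)) * D x \<partial>M)"
        using i1 i2 by (simp add: D_def algebra_simps flip: Bochner_Integration.integral_diff)
      then show ?thesis using * by simp
    qed
    \<comment> \<open>The weight c u is a function of Z up to measurability in \<open>F\<close>, so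
      \<phi>(Z, Y) may be replaced by h(Z). Then u, the conditional expectation of a, is turned back
      into a against the weight c h(Z).\<close>
    also have "\<dots> = (\<integral>x. (c x * u x) * real_cond_exp M F (\<lambda>x. \<phi> (Z x, Y x)) x \<partial>M)"
      using i2 by (intro F.real_cond_exp_intg(2)[symmetric]) measurable
    also have "\<dots> = (\<integral>x. (c x * h (Z x)) * u x \<partial>M)"
      using cond_F by (intro integral_cong_AE) (auto elim: eventually_mono)
    also have "\<dots> = (\<integral>x. (c x * h (Z x)) * a x \<partial>M)"
      unfolding u_def using i3 by (intro F.real_cond_exp_intg(2)) (auto simp: mult_ac)
    finally have "(\<integral>x. (c x * a x) * \<phi> (Z x, Y x) \<partial>M) - (\<integral>x. (c x * a x) * h (Z x) \<partial>M) = 0"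
      by (simp add: mult_ac)
    then show ?thesis
      using i1 i3 by (simp add: right_diff_distrib a_def c_def)
  qed
  have "AE x in M. real_cond_exp M (vimage_algebra (space M) (\<lambda>x. (Z x, X x)) borel) (\<lambda>x. \<phi> (Z x, Y x)) x =
      (\<lambda>p. h (fst p)) (Z x, X x)"
  proof (rule real_cond_exp_vimage_charact)
    show "(\<integral>x. indicator S (Z x, X x) * (\<phi> (Z x, Y x) - (\<lambda>p. h (fst p)) (Z x, X x)) \<partial>M) = 0"
      if "S \<in> sets borel" for S
      using zero int int_h that by (simp add: integral_indicator_pair_eq_0)
    have "(\<lambda>p :: 'd \<times> 'b. h (fst p)) \<in> borel_measurable (borel \<Otimes>\<^sub>M borel)" by measurable
    then show "(\<lambda>p :: 'd \<times> 'b. h (fst p)) \<in> borel_measurable borel" unfolding borel_prod .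
  qed (use int int_h in auto)
  then show ?thesis by simp
qed

lemma cond_indep_given_commute:
  fixes X :: "'m \<Rightarrow> 'b::topological_space" and Y :: "'m \<Rightarrow> 'c::topological_space"
    and Z :: "'m \<Rightarrow> 'd::topological_space"
  assumes "cond_indep_given M X Y Z"
  shows "cond_indep_given M Y X Z"
  unfolding cond_indep_given_def Let_def
proof (intro ballI)
  fix A B assume "A \<in> sets (borel :: 'c measure)" "B \<in> sets (borel :: 'b measure)"
  with assms show "AE x in M. real_cond_exp M (vimage_algebra (space M) Z borel) (\<lambda>x. indicator A (Y x) * indicator B (X x)) x =
      real_cond_exp M (vimage_algebra (space M) Z borel) (\<lambda>x. indicator A (Y x)) x *
      real_cond_exp M (vimage_algebra (space M) Z borel) (\<lambda>x. indicator B (X x)) x"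
    unfolding cond_indep_given_def Let_def
    by (subst (1 2) mult.commute) blast
qed

section \<open>Weighted sums of conditionally centred noise\<close>

context iid_sample
begin

lemma integral_split_coordinate:
  fixes H :: "'p \<times> (nat \<Rightarrow> 'p) \<Rightarrow> real"
  assumes "i \<notin> J" and H [measurable]: "H \<in> borel_measurable (P \<Otimes>\<^sub>M PiM J (\<lambda>_. P))"
    and int: "integrable M (\<lambda>x. H (W i x, \<lambda>k\<in>J. W k x))"
  defines "R \<equiv> distr M (PiM J (\<lambda>_. P)) (\<lambda>x. \<lambda>k\<in>J. W k x)"
  shows "integrable R (\<lambda>r. \<integral>p. H (p, r) \<partial>P)"
    and "(\<integral>x. H (W i x, \<lambda>k\<in>J. W k x) \<partial>M) = (\<integral>r. (\<integral>p. H (p, r) \<partial>P) \<partial>R)"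
proof -
  interpret P: prob_space P by (rule prob_space_P)
  have R_meas [measurable]: "(\<lambda>x. \<lambda>k\<in>J. W k x) \<in> measurable M (PiM J (\<lambda>_. P))" by measurable
  interpret R: prob_space R unfolding R_def by (rule prob_space_distr) measurable
  have sets_R [measurable_cong]: "sets R = sets (PiM J (\<lambda>_. P))" unfolding R_def by simp
  interpret PR: pair_prob_space P R ..
  define R0 where "R0 = distr M (PiM {i} (\<lambda>_. P)) (\<lambda>x. \<lambda>k\<in>{i}. W k x)"
  have [measurable]: "(\<lambda>x. \<lambda>k\<in>{i}. W k x) \<in> measurable M (PiM {i} (\<lambda>_. P))" by measurable
  have sets_R0 [measurable_cong]: "sets R0 = sets (PiM {i} (\<lambda>_. P))" unfolding R0_def by simp
  have "indep_var (PiM {i} (\<lambda>_. P)) (\<lambda>x. \<lambda>k\<in>{i}. W k x) (PiM J (\<lambda>_. P)) (\<lambda>x. \<lambda>k\<in>J. W k x)"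
    using assms by (intro indep_var_restrict[OF indep_W]) auto
  then have prod: "R0 \<Otimes>\<^sub>M R = distr M (PiM {i} (\<lambda>_. P) \<Otimes>\<^sub>M PiM J (\<lambda>_. P)) (\<lambda>x. (\<lambda>k\<in>{i}. W k x, \<lambda>k\<in>J. W k x))"
    unfolding indep_var_distribution_eq R_def R0_def by simp
  have "distr R0 P (\<lambda>r. r i) = P"
    unfolding R0_def by (subst distr_distr) (auto simp: o_def distr_W)
  moreover have "distr R (PiM J (\<lambda>_. P)) (\<lambda>r. r) = R"
    by (rule distr_id2) (simp add: sets_R)
  ultimately have "P \<Otimes>\<^sub>M R = distr R0 P (\<lambda>r. r i) \<Otimes>\<^sub>M distr R (PiM J (\<lambda>_. P)) (\<lambda>r. r)" by simp
  also have "\<dots> = distr (R0 \<Otimes>\<^sub>M R) (P \<Otimes>\<^sub>M PiM J (\<lambda>_. P)) (\<lambda>(r0, r). (r0 i, r))"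
  proof (rule pair_measure_distr)
    show "sigma_finite_measure (distr R (PiM J (\<lambda>_. P)) (\<lambda>r. r))"
      unfolding \<open>distr R (PiM J (\<lambda>_. P)) (\<lambda>r. r) = R\<close> by (rule R.sigma_finite_measure_axioms)
  qed measurable
  also have "\<dots> = distr M (P \<Otimes>\<^sub>M PiM J (\<lambda>_. P)) (\<lambda>x. (W i x, \<lambda>k\<in>J. W k x))"
    unfolding prod by (subst distr_distr) (auto simp: o_def)
  finally have distr: "P \<Otimes>\<^sub>M R = distr M (P \<Otimes>\<^sub>M PiM J (\<lambda>_. P)) (\<lambda>x. (W i x, \<lambda>k\<in>J. W k x))" .
  have pair [measurable]: "(\<lambda>x. (W i x, \<lambda>k\<in>J. W k x)) \<in> measurable M (P \<Otimes>\<^sub>M PiM J (\<lambda>_. P))" by measurable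
  have intH: "integrable (P \<Otimes>\<^sub>M R) H"
    unfolding distr using int by (subst integrable_distr_eq) auto
  then have intH': "integrable (P \<Otimes>\<^sub>M R) (case_prod (\<lambda>p r. H (p, r)))" by simp
  show "integrable R (\<lambda>r. \<integral>p. H (p, r) \<partial>P)" by (rule PR.integrable_snd[OF intH'])
  have "(\<integral>x. H (W i x, \<lambda>k\<in>J. W k x) \<partial>M) = (\<integral>z. H z \<partial>(P \<Otimes>\<^sub>M R))"
    unfolding distr by (subst integral_distr) auto
  also have "\<dots> = (\<integral>r. (\<integral>p. H (p, r) \<partial>P) \<partial>R)"
    using PR.integral_snd[OF intH'] by simp
  finally show "(\<integral>x. H (W i x, \<lambda>k\<in>J. W k x) \<partial>M) = (\<integral>r. (\<integral>p. H (p, r) \<partial>P) \<partial>R)" .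
qed

end

text \<open>Noise \<open>\<xi>\<close> with conditional mean zero and bounded conditional variance given the
  observation \<open>U\<close>, in terms of bounded test functions.\<close>

locale conditional_noise = iid_sample M P W for M :: "'m measure" and P :: "'p measure" and W +
  fixes S :: "'u measure" and U :: "'p \<Rightarrow> 'u" and \<xi> :: "'p \<Rightarrow> real" and B :: real
  assumes U_measurable [measurable]: "U \<in> measurable P S"
    and \<xi>_measurable [measurable]: "\<xi> \<in> borel_measurable P"
    and \<xi>_square_integrable: "integrable P (\<lambda>p. (\<xi> p)\<^sup>2)"
    and \<xi>_mean: "\<And>\<psi> c. \<psi> \<in> borel_measurable S \<Longrightarrow> (\<And>u. \<bar>\<psi> u\<bar> \<le> c) \<Longrightarrow> (\<integral>p. \<psi> (U p) * \<xi> p \<partial>P) = 0"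
    and \<xi>_variance: "\<And>\<psi> c. \<psi> \<in> borel_measurable S \<Longrightarrow> (\<And>u. 0 \<le> \<psi> u \<and> \<psi> u \<le> c) \<Longrightarrow>
      (\<integral>p. \<psi> (U p) * (\<xi> p)\<^sup>2 \<partial>P) \<le> B * (\<integral>p. \<psi> (U p) \<partial>P)"
    and B_nonneg: "0 \<le> B"
begin

definition data :: "nat \<Rightarrow> 'm \<Rightarrow> nat \<Rightarrow> 'u" where
  "data n x = (\<lambda>i\<in>{..<n}. U (W i x))"

lemma data_measurable [measurable]: "data n \<in> measurable M (PiM {..<n} (\<lambda>_. S))"
  unfolding data_def by measurable

lemma bounded_times_noise_integrable:
  assumes [measurable]: "g \<in> borel_measurable M" and g: "\<And>x. \<bar>g x\<bar> \<le> c"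
  shows "integrable M (\<lambda>x. g x * (\<xi> (W i x) * \<xi> (W j x)))"
proof (rule Bochner_Integration.integrable_bound)
  show "integrable M (\<lambda>x. c * ((\<xi> (W i x))\<^sup>2 + (\<xi> (W j x))\<^sup>2))"
    using integrable_W[OF \<xi>_square_integrable] by simp
  have "\<bar>u * w\<bar> \<le> u\<^sup>2 + w\<^sup>2" for u w :: real
  proof -
    have "2 * (\<bar>u\<bar> * \<bar>w\<bar>) \<le> u\<^sup>2 + w\<^sup>2" using sum_squares_bound[of "\<bar>u\<bar>" "\<bar>w\<bar>"] by simp
    moreover have "0 \<le> \<bar>u\<bar> * \<bar>w\<bar>" by simp
    ultimately show ?thesis unfolding abs_mult by linarith
  qed
  moreover have "0 \<le> c" using g[of undefined] by linarith
  ultimately show "AE x in M. norm (g x * (\<xi> (W i x) * \<xi> (W j x))) \<le> norm (c * ((\<xi> (W i x))\<^sup>2 + (\<xi> (W j x))\<^sup>2))"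
    using g by (simp add: abs_mult[of "g _"] mult_mono)
qed measurable

lemma
  assumes i: "i < n" and g [measurable]: "g \<in> borel_measurable (PiM {..<n} (\<lambda>_. S))" and g_le: "\<And>D. \<bar>g D\<bar> \<le> c"
  shows integral_noise_cross: "j < n \<Longrightarrow> i \<noteq> j \<Longrightarrow> (\<integral>x. g (data n x) * (\<xi> (W i x) * \<xi> (W j x)) \<partial>M) = 0"
    and integral_noise_square: "(\<And>D. 0 \<le> g D) \<Longrightarrow>
      (\<integral>x. g (data n x) * (\<xi> (W i x) * \<xi> (W i x)) \<partial>M) \<le> B * (\<integral>x. g (data n x) \<partial>M)"
proof -
  interpret P: prob_space P by (rule prob_space_P)
  define J where "J = {..<n} - {i}"
  have J: "i \<notin> J" "{..<n} = J \<union> {i}" using i unfolding J_def by auto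
  define R where "R = distr M (PiM J (\<lambda>_. P)) (\<lambda>x. \<lambda>k\<in>J. W k x)"
  interpret R: prob_space R unfolding R_def by (rule prob_space_distr) measurable
  have sets_R [measurable_cong]: "sets R = sets (PiM J (\<lambda>_. P))" unfolding R_def by simp
  define \<psi> where "\<psi> r u = g ((\<lambda>k\<in>J. U (r k))(i := u))" for r u
  have upd: "data n x = (\<lambda>k\<in>J. U ((\<lambda>k\<in>J. W k x) k))(i := U (W i x))" for x
    unfolding data_def J(2) by (auto simp: fun_eq_iff restrict_def)
  have g_data: "g (data n x) = \<psi> (\<lambda>k\<in>J. W k x) (U (W i x))" for x
    unfolding \<psi>_def upd ..
  have \<psi>_meas [measurable]: "(\<lambda>z. \<psi> (fst z) (snd z)) \<in> borel_measurable (PiM J (\<lambda>_. P) \<Otimes>\<^sub>M S)"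
  proof -
    have "(\<lambda>z. (\<lambda>k\<in>J. U (fst z k))(i := snd z)) \<in> measurable (PiM J (\<lambda>_. P) \<Otimes>\<^sub>M S) (PiM {..<n} (\<lambda>_. S))"
      by (rule measurable_fun_upd[OF J(2)]) measurable
    from measurable_compose[OF this g] show ?thesis unfolding \<psi>_def .
  qed
  have \<psi>_pair [measurable]: "(\<lambda>z. \<psi> (snd z) (U (fst z))) \<in> borel_measurable (P \<Otimes>\<^sub>M PiM J (\<lambda>_. P))"
  proof -
    have "(\<lambda>z. (snd z, U (fst z))) \<in> measurable (P \<Otimes>\<^sub>M PiM J (\<lambda>_. P)) (PiM J (\<lambda>_. P) \<Otimes>\<^sub>M S)" by measurable
    from measurable_compose[OF this \<psi>_meas] show ?thesis by simp
  qed
  have \<psi>_r: "\<psi> r \<in> borel_measurable S" if "r \<in> space (PiM J (\<lambda>_. P))" for r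
    using measurable_compose[OF measurable_Pair1'[OF that] \<psi>_meas] by simp
  have space_R: "space R = space (PiM J (\<lambda>_. P))" unfolding R_def by simp
  have \<psi>_le: "\<bar>\<psi> r u\<bar> \<le> c" for r u unfolding \<psi>_def by (rule g_le)
  have [measurable]: "(\<lambda>x. g (data n x)) \<in> borel_measurable M" by measurable
  {
    assume j: "j < n" "i \<noteq> j"
    then have "j \<in> J" unfolding J_def by auto
    define H where "H z = \<psi> (snd z) (U (fst z)) * (\<xi> (fst z) * \<xi> (snd z j))" for z
    have H [measurable]: "H \<in> borel_measurable (P \<Otimes>\<^sub>M PiM J (\<lambda>_. P))"
      unfolding H_def using \<open>j \<in> J\<close> by measurable
    have H_eq: "g (data n x) * (\<xi> (W i x) * \<xi> (W j x)) = H (W i x, \<lambda>k\<in>J. W k x)" for x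
      unfolding H_def g_data using \<open>j \<in> J\<close> by simp
    have "integrable M (\<lambda>x. H (W i x, \<lambda>k\<in>J. W k x))"
      unfolding H_eq[symmetric] by (rule bounded_times_noise_integrable[where c = c]) (auto simp: g_le)
    from integral_split_coordinate(2)[OF J(1) H this]
    have "(\<integral>x. g (data n x) * (\<xi> (W i x) * \<xi> (W j x)) \<partial>M) = (\<integral>r. (\<integral>p. H (p, r) \<partial>P) \<partial>R)"
      unfolding H_eq R_def .
    also have "\<dots> = (\<integral>r. 0 \<partial>R)"
    proof (rule Bochner_Integration.integral_cong)
      fix r assume "r \<in> space R"
      then have "(\<integral>p. \<psi> r (U p) * \<xi> p \<partial>P) = 0"
        using \<psi>_r \<psi>_le unfolding space_R by (intro \<xi>_mean) auto
      moreover have "(\<integral>p. H (p, r) \<partial>P) = (\<integral>p. \<xi> (r j) * (\<psi> r (U p) * \<xi> p) \<partial>P)"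
        unfolding H_def by (simp add: mult_ac)
      ultimately show "(\<integral>p. H (p, r) \<partial>P) = 0" by simp
    qed simp
    finally show "(\<integral>x. g (data n x) * (\<xi> (W i x) * \<xi> (W j x)) \<partial>M) = 0" by simp
  }
  {
    assume g0: "\<And>D. 0 \<le> g D"
    then have \<psi>_nonneg: "0 \<le> \<psi> r u" for r u unfolding \<psi>_def by blast
    define H where "H z = \<psi> (snd z) (U (fst z)) * (\<xi> (fst z) * \<xi> (fst z))" for z :: "'p \<times> (nat \<Rightarrow> 'p)"
    have H [measurable]: "H \<in> borel_measurable (P \<Otimes>\<^sub>M PiM J (\<lambda>_. P))"
      unfolding H_def by measurable
    have H_eq: "g (data n x) * (\<xi> (W i x) * \<xi> (W i x)) = H (W i x, \<lambda>k\<in>J. W k x)" for x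
      unfolding H_def g_data by simp
    have intH: "integrable M (\<lambda>x. H (W i x, \<lambda>k\<in>J. W k x))"
      unfolding H_eq[symmetric] by (rule bounded_times_noise_integrable[where c = c]) (auto simp: g_le)
    define G where "G z = \<psi> (snd z) (U (fst z))" for z :: "'p \<times> (nat \<Rightarrow> 'p)"
    have G [measurable]: "G \<in> borel_measurable (P \<Otimes>\<^sub>M PiM J (\<lambda>_. P))"
      unfolding G_def by measurable
    have G_eq: "g (data n x) = G (W i x, \<lambda>k\<in>J. W k x)" for x
      unfolding G_def g_data by simp
    have intG: "integrable M (\<lambda>x. G (W i x, \<lambda>k\<in>J. W k x))"
      unfolding G_eq[symmetric] by (intro integrable_const_bound[where B = c]) (auto simp: g_le)
    note splitH = integral_split_coordinate[OF J(1) H intH, folded R_def]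
    note splitG = integral_split_coordinate[OF J(1) G intG, folded R_def]
    have "(\<integral>r. (\<integral>p. H (p, r) \<partial>P) \<partial>R) \<le> (\<integral>r. B * (\<integral>p. G (p, r) \<partial>P) \<partial>R)"
    proof (rule integral_mono)
      fix r assume "r \<in> space R"
      then have "(\<integral>p. \<psi> r (U p) * (\<xi> p)\<^sup>2 \<partial>P) \<le> B * (\<integral>p. \<psi> r (U p) \<partial>P)"
        using \<psi>_r \<psi>_le \<psi>_nonneg unfolding space_R
        by (intro \<xi>_variance[where c = c]) (auto simp: abs_le_iff)
      then show "(\<integral>p. H (p, r) \<partial>P) \<le> B * (\<integral>p. G (p, r) \<partial>P)"
        unfolding H_def G_def by (simp add: power2_eq_square)
    qed (use splitH(1) splitG(1) in auto)
    also have "\<dots> = B * (\<integral>x. g (data n x) \<partial>M)" unfolding G_eq using splitG(2) by simp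
    finally show "(\<integral>x. g (data n x) * (\<xi> (W i x) * \<xi> (W i x)) \<partial>M) \<le> B * (\<integral>x. g (data n x) \<partial>M)"
      unfolding H_eq using splitH(2) by simp
  }
qed

text \<open>The weights are functions of the data alone, so in the expanded square the coefficient
  of each product of two noises is one as well. Off-diagonal terms thus vanish although every weight
  may depend on the whole sample, and the conditional variance bounds the diagonal.\<close>

lemma noise_second_moment:
  fixes k :: "'u \<Rightarrow> 'h::{real_inner, second_countable_topology}"
  assumes k [measurable]: "k \<in> borel_measurable S" and k_le: "\<And>u. (norm (k u))\<^sup>2 \<le> C"
    and b [measurable]: "\<And>i. i < n \<Longrightarrow> b i \<in> borel_measurable (PiM {..<n} (\<lambda>_. S))"
    and b_le: "\<And>i D. \<bar>b i D\<bar> \<le> c"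
  defines "Y \<equiv> \<lambda>x. \<Sum>i<n. (b i (data n x) * \<xi> (W i x)) *\<^sub>R k (U (W i x))"
  shows "integrable M (\<lambda>x. (norm (Y x))\<^sup>2)"
    and "(\<integral>x. (norm (Y x))\<^sup>2 \<partial>M) \<le> B * C * (\<integral>x. (\<Sum>i<n. (b i (data n x))\<^sup>2) \<partial>M)"
proof -
  define g where "g i j D = b i D * b j D * (k (D i) \<bullet> k (D j))" for i j and D :: "nat \<Rightarrow> 'u"
  have g_meas [measurable]: "g i j \<in> borel_measurable (PiM {..<n} (\<lambda>_. S))" if [simp]: "i < n" "j < n" for i j
    unfolding g_def using that by measurable
  have C0: "0 \<le> C" using order_trans[OF zero_le_power2 k_le] .
  have c0: "0 \<le> c" using b_le[of undefined undefined] by linarith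
  have kk: "\<bar>k u \<bullet> k w\<bar> \<le> C" for u w
  proof -
    have "norm (k u) \<le> sqrt C" for u using k_le[of u] by (simp add: real_le_rsqrt)
    then have "norm (k u) * norm (k w) \<le> sqrt C * sqrt C" by (intro mult_mono) (auto simp: C0)
    then show ?thesis using Cauchy_Schwarz_ineq2[of "k u" "k w"] C0 by simp
  qed
  have g_le: "\<bar>g i j D\<bar> \<le> c * c * C" for i j D
    unfolding g_def abs_mult by (intro mult_mono b_le kk) (auto simp: c0)
  have expand: "(norm (Y x))\<^sup>2 = (\<Sum>i<n. \<Sum>j<n. g i j (data n x) * (\<xi> (W i x) * \<xi> (W j x)))" for x
  proof -
    have "(norm (Y x))\<^sup>2 = (\<Sum>i<n. \<Sum>j<n. (b i (data n x) * \<xi> (W i x)) * ((b j (data n x) * \<xi> (W j x)) * (k (U (W i x)) \<bullet> k (U (W j x)))))"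
      unfolding power2_norm_eq_inner Y_def inner_sum_left inner_sum_right
      by (subst sum.swap) (simp add: inner_commute)
    also have "\<dots> = (\<Sum>i<n. \<Sum>j<n. g i j (data n x) * (\<xi> (W i x) * \<xi> (W j x)))"
      by (intro sum.cong refl) (simp add: g_def data_def)
    finally show ?thesis .
  qed
  have int: "integrable M (\<lambda>x. g i j (data n x) * (\<xi> (W i x) * \<xi> (W j x)))" if "i < n" "j < n" for i j
    using that by (intro bounded_times_noise_integrable[where c = "c * c * C"]) (auto simp: g_le)
  show "integrable M (\<lambda>x. (norm (Y x))\<^sup>2)"
    unfolding expand using int by (intro Bochner_Integration.integrable_sum) auto
  have b_int: "integrable M (\<lambda>x. (b i (data n x))\<^sup>2)" if "i < n" for i
  proof (rule integrable_const_bound[where B = "c\<^sup>2"])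
    show "AE x in M. norm ((b i (data n x))\<^sup>2) \<le> c\<^sup>2"
      using b_le c0 by (auto simp: abs_le_square_iff[symmetric])
  qed (use that in measurable)
  have "(\<integral>x. (norm (Y x))\<^sup>2 \<partial>M) = (\<Sum>i<n. \<Sum>j<n. \<integral>x. g i j (data n x) * (\<xi> (W i x) * \<xi> (W j x)) \<partial>M)"
  proof -
    have "(\<integral>x. (norm (Y x))\<^sup>2 \<partial>M) = (\<Sum>i<n. \<integral>x. (\<Sum>j<n. g i j (data n x) * (\<xi> (W i x) * \<xi> (W j x))) \<partial>M)"
      unfolding expand by (intro Bochner_Integration.integral_sum Bochner_Integration.integrable_sum int) auto
    also have "\<dots> = (\<Sum>i<n. \<Sum>j<n. \<integral>x. g i j (data n x) * (\<xi> (W i x) * \<xi> (W j x)) \<partial>M)"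
      by (intro sum.cong refl Bochner_Integration.integral_sum int) auto
    finally show ?thesis .
  qed
  also have "\<dots> = (\<Sum>i<n. \<Sum>j<n. if j = i then \<integral>x. g i i (data n x) * (\<xi> (W i x) * \<xi> (W i x)) \<partial>M else 0)"
    by (intro sum.cong refl) (auto intro!: integral_noise_cross[where c = "c * c * C"] g_le)
  also have "\<dots> = (\<Sum>i<n. \<integral>x. g i i (data n x) * (\<xi> (W i x) * \<xi> (W i x)) \<partial>M)" by simp
  also have "\<dots> \<le> (\<Sum>i<n. B * C * (\<integral>x. (b i (data n x))\<^sup>2 \<partial>M))"
  proof (rule sum_mono)
    fix i assume "i \<in> {..<n}"
    then have "i < n" by simp
    have "(\<integral>x. g i i (data n x) * (\<xi> (W i x) * \<xi> (W i x)) \<partial>M) \<le> B * (\<integral>x. g i i (data n x) \<partial>M)"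
      using \<open>i < n\<close> by (intro integral_noise_square[where c = "c * c * C"] g_le g_meas) (auto simp: g_def)
    also have "(\<integral>x. g i i (data n x) \<partial>M) \<le> (\<integral>x. C * (b i (data n x))\<^sup>2 \<partial>M)"
    proof (rule integral_mono)
      show "integrable M (\<lambda>x. g i i (data n x))"
        using \<open>i < n\<close> by (intro integrable_const_bound[where B = "c * c * C"]) (auto simp: g_le)
      show "g i i (data n x) \<le> C * (b i (data n x))\<^sup>2" for x
        using mult_right_mono[OF k_le[of "data n x i"], of "(b i (data n x))\<^sup>2"]
        unfolding g_def power2_norm_eq_inner by (simp add: power2_eq_square mult_ac)
    qed (use b_int[OF \<open>i < n\<close>] in simp)
    finally show "(\<integral>x. g i i (data n x) * (\<xi> (W i x) * \<xi> (W i x)) \<partial>M) \<le> B * C * (\<integral>x. (b i (data n x))\<^sup>2 \<partial>M)"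
      using B_nonneg by (simp add: mult_left_mono mult.assoc)
  qed
  also have "\<dots> = B * C * (\<integral>x. (\<Sum>i<n. (b i (data n x))\<^sup>2) \<partial>M)"
    using b_int by (subst Bochner_Integration.integral_sum) (auto simp: sum_distrib_left)
  finally show "(\<integral>x. (norm (Y x))\<^sup>2 \<partial>M) \<le> B * C * (\<integral>x. (\<Sum>i<n. (b i (data n x))\<^sup>2) \<partial>M)" .
qed

text \<open>The weights may fail to be square integrable, so they are cut off on the event that their
  mean square is large. This event depends on the data only.\<close>

lemma weighted_noise_tendsto_0:
  fixes k :: "'u \<Rightarrow> 'h::{real_inner, second_countable_topology}"
  assumes k [measurable]: "k \<in> borel_measurable S" and k_le: "\<And>u. (norm (k u))\<^sup>2 \<le> C"
    and a [measurable]: "\<And>n i. i < n \<Longrightarrow> a n i \<in> borel_measurable (PiM {..<n} (\<lambda>_. S))"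
    and small: "small_o_p M (\<lambda>n x. (1 / real n) * (\<Sum>i<n. (a n i (data n x))\<^sup>2)) (\<lambda>_. 1)"
  shows "small_o_p M (\<lambda>n x. norm ((1 / sqrt (real n)) *\<^sub>R
    (\<Sum>i<n. (a n i (data n x) * \<xi> (W i x)) *\<^sub>R k (U (W i x))))) (\<lambda>_. 1)"
  unfolding small_o_p_def
proof (intro allI impI)
  fix e :: real assume "e > 0"
  define m where "m n D = (1 / real n) * (\<Sum>i<n. (a n i D)\<^sup>2)" for n D
  define Y where "Y n x = (1 / sqrt (real n)) *\<^sub>R (\<Sum>i<n. (a n i (data n x) * \<xi> (W i x)) *\<^sub>R k (U (W i x)))" for n x
  have m_meas [measurable]: "m n \<in> borel_measurable (PiM {..<n} (\<lambda>_. S))" for n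
    unfolding m_def by measurable
  have Y_meas [measurable]: "Y n \<in> borel_measurable M" for n
    unfolding Y_def by measurable
  have m0: "0 \<le> m n D" for n D unfolding m_def by (simp add: sum_nonneg)
  have C0: "0 \<le> C" using order_trans[OF zero_le_power2 k_le] .
  have bound: "measure M {x\<in>space M. e < norm (Y n x)} \<le>
      measure M {x\<in>space M. d < m n (data n x)} + B * C * d / e\<^sup>2" if "n > 0" "d > 0" for n d
  proof -
    \<comment> \<open>On the event that the mean square is at most d these are the original weights,
      each at most sqrt (n d) in absolute value; elsewhere they are 0. The value 0 for i \<ge> n
      makes the bound hold at all indices, as the moment lemma demands.\<close>
    define b where "b i D = (if m n D \<le> d then if i < n then a n i D else 0 else 0)" for i D
    have b_le: "\<bar>b i D\<bar> \<le> sqrt (real n * d)" for i D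
    proof (cases "m n D \<le> d \<and> i < n")
      case True
      have "(a n i D)\<^sup>2 \<le> (\<Sum>i<n. (a n i D)\<^sup>2)"
        using True by (intro member_le_sum) auto
      also have "\<dots> \<le> real n * d" using True \<open>n > 0\<close> unfolding m_def by (simp add: field_simps)
      finally show ?thesis using True unfolding b_def by (simp add: real_le_rsqrt)
    qed (use that in \<open>auto simp: b_def\<close>)
    have b_meas [measurable]: "b i \<in> borel_measurable (PiM {..<n} (\<lambda>_. S))" if "i < n" for i
      unfolding b_def using that by (intro measurable_If) (auto intro!: a)
    define Z where "Z x = (\<Sum>i<n. (b i (data n x) * \<xi> (W i x)) *\<^sub>R k (U (W i x)))" for x
    have moment: "integrable M (\<lambda>x. (norm (Z x))\<^sup>2)"
      "(\<integral>x. (norm (Z x))\<^sup>2 \<partial>M) \<le> B * C * (\<integral>x. (\<Sum>i<n. (b i (data n x))\<^sup>2) \<partial>M)"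
      unfolding Z_def by (rule noise_second_moment[OF k k_le b_meas b_le]; assumption)+
    have Z_meas [measurable]: "Z \<in> borel_measurable M" unfolding Z_def by measurable
    have sum_b: "(\<Sum>i<n. (b i (data n x))\<^sup>2) \<le> real n * d" for x
    proof (cases "m n (data n x) \<le> d")
      case True
      then have "(\<Sum>i<n. (b i (data n x))\<^sup>2) = (\<Sum>i<n. (a n i (data n x))\<^sup>2)"
        unfolding b_def by (intro sum.cong) auto
      then show ?thesis using True \<open>n > 0\<close> unfolding m_def by (simp add: field_simps)
    next
      case False
      then show ?thesis using \<open>d > 0\<close> by (simp add: b_def)
    qed
    have "(\<integral>x. (norm (Z x))\<^sup>2 \<partial>M) \<le> B * C * (\<integral>x. (\<Sum>i<n. (b i (data n x))\<^sup>2) \<partial>M)"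
      by (rule moment(2))
    also have "\<dots> \<le> B * C * (real n * d)"
    proof (intro mult_left_mono)
      have "integrable M (\<lambda>x. (\<Sum>i<n. (b i (data n x))\<^sup>2))"
        using sum_b by (intro integrable_const_bound[where B = "real n * d"]) (auto simp: sum_nonneg)
      then have "(\<integral>x. (\<Sum>i<n. (b i (data n x))\<^sup>2) \<partial>M) \<le> (\<integral>x. real n * d \<partial>M)"
        using sum_b by (intro integral_mono) auto
      then show "(\<integral>x. (\<Sum>i<n. (b i (data n x))\<^sup>2) \<partial>M) \<le> real n * d" by (simp add: prob_space)
    qed (simp add: B_nonneg C0)
    finally have Z_moment: "(\<integral>x. (norm (Z x))\<^sup>2 \<partial>M) \<le> B * C * (real n * d)" .
    have "measure M {x\<in>space M. e < norm (Y n x)} \<le>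
        measure M ({x\<in>space M. d < m n (data n x)} \<union> {x\<in>space M. (norm (Z x))\<^sup>2 \<ge> real n * e\<^sup>2})"
    proof (rule finite_measure_mono)
      show "{x\<in>space M. e < norm (Y n x)} \<subseteq> {x\<in>space M. d < m n (data n x)} \<union> {x\<in>space M. (norm (Z x))\<^sup>2 \<ge> real n * e\<^sup>2}"
      proof
        fix x assume x: "x \<in> {x\<in>space M. e < norm (Y n x)}"
        show "x \<in> {x\<in>space M. d < m n (data n x)} \<union> {x\<in>space M. (norm (Z x))\<^sup>2 \<ge> real n * e\<^sup>2}"
        proof (cases "d < m n (data n x)")
          case False
          then have "Z x = (\<Sum>i<n. (a n i (data n x) * \<xi> (W i x)) *\<^sub>R k (U (W i x)))"
            unfolding Z_def b_def by (intro sum.cong) auto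
          then have "norm (Y n x) = norm (Z x) / sqrt (real n)"
            unfolding Y_def by simp
          moreover have "e * sqrt (real n) < norm (Y n x) * sqrt (real n)"
            using x \<open>n > 0\<close> by (intro mult_strict_right_mono) auto
          ultimately have "e * sqrt (real n) < norm (Z x)" using \<open>n > 0\<close> by simp
          then have "(e * sqrt (real n))\<^sup>2 \<le> (norm (Z x))\<^sup>2"
            using \<open>e > 0\<close> by (intro power_mono) auto
          then show ?thesis using x by (simp add: power_mult_distrib mult.commute)
        qed (use x in auto)
      qed
    qed measurable
    also have "\<dots> \<le> measure M {x\<in>space M. d < m n (data n x)} + measure M {x\<in>space M. (norm (Z x))\<^sup>2 \<ge> real n * e\<^sup>2}"
      by (rule measure_Un_le) measurable
    also have "measure M {x\<in>space M. (norm (Z x))\<^sup>2 \<ge> real n * e\<^sup>2} \<le> (\<integral>x. (norm (Z x))\<^sup>2 \<partial>M) / (real n * e\<^sup>2)"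
      using moment(1) \<open>e > 0\<close> \<open>n > 0\<close> by (intro integral_Markov_inequality_measure[where A = "{}"]) auto
    also have "\<dots> \<le> B * C * (real n * d) / (real n * e\<^sup>2)"
      using Z_moment by (intro divide_right_mono) auto
    also have "\<dots> = B * C * d / e\<^sup>2" using \<open>n > 0\<close> by simp
    finally show ?thesis by simp
  qed
  have small': "(\<lambda>n. measure M {x\<in>space M. d < m n (data n x)}) \<longlonglongrightarrow> 0" if "d > 0" for d
  proof -
    have "{x\<in>space M. \<bar>(1 / real n) * (\<Sum>i<n. (a n i (data n x))\<^sup>2)\<bar> > d * 1} = {x\<in>space M. d < m n (data n x)}" for n
      unfolding m_def[symmetric] using m0 by auto
    with small that show ?thesis unfolding small_o_p_def by auto
  qed
  have "(\<lambda>n. measure M {x\<in>space M. e < norm (Y n x)}) \<longlonglongrightarrow> 0"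
  proof (rule LIMSEQ_I)
    fix r :: real assume "r > 0"
    define K where "K = B * C"
    have K: "0 \<le> K" unfolding K_def using B_nonneg C0 by simp
    \<comment> \<open>Chosen to make the Markov term B C d / e^2 at most r / 2; since B C may be 0,
      the denominator has K + 1.\<close>
    define d where "d = r * e\<^sup>2 / (2 * (K + 1))"
    have d: "d > 0" unfolding d_def using \<open>r > 0\<close> \<open>e > 0\<close> K by (intro divide_pos_pos mult_pos_pos) auto
    have "K + 1 \<noteq> 0" "e \<noteq> 0" using K \<open>e > 0\<close> by auto
    then have "K * d / e\<^sup>2 = (K / (K + 1)) * (r / 2)"
      unfolding d_def by (simp add: divide_simps)
    also have "\<dots> \<le> 1 * (r / 2)" using K \<open>r > 0\<close> by (intro mult_right_mono) auto
    finally have BCd: "B * C * d / e\<^sup>2 \<le> r / 2" unfolding K_def by simp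
    obtain n0 where n0: "\<And>n. n \<ge> n0 \<Longrightarrow> norm (measure M {x\<in>space M. d < m n (data n x)} - 0) < r / 2"
      using LIMSEQ_D[OF small'[OF d], of "r / 2"] \<open>r > 0\<close> by auto
    have "norm (measure M {x\<in>space M. e < norm (Y n x)} - 0) < r" if "n \<ge> Suc n0" for n
    proof -
      have "measure M {x\<in>space M. d < m n (data n x)} < r / 2" using n0[of n] that by simp
      then have "measure M {x\<in>space M. e < norm (Y n x)} < r" using bound[of n d] BCd d that by linarith
      then show ?thesis by simp
    qed
    then show "\<exists>n0. \<forall>n\<ge>n0. norm (measure M {x\<in>space M. e < norm (Y n x)} - 0) < r" by blast
  qed
  then show "(\<lambda>n. measure M {x\<in>space M. \<bar>norm ((1 / sqrt (real n)) *\<^sub>R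
      (\<Sum>i<n. (a n i (data n x) * \<xi> (W i x)) *\<^sub>R k (U (W i x))))\<bar> > e * 1}) \<longlonglongrightarrow> 0"
    unfolding Y_def by simp
qed

end

section \<open>Small perturbations\<close>

context prob_space
begin

lemma small_o_p_add:
  assumes X: "small_o_p M X (\<lambda>_. 1)" and Y: "small_o_p M Y (\<lambda>_. 1)"
    and [measurable]: "\<And>n. X n \<in> borel_measurable M" "\<And>n. Y n \<in> borel_measurable M"
  shows "small_o_p M (\<lambda>n x. X n x + Y n x) (\<lambda>_. 1)"
  unfolding small_o_p_def
proof (intro allI impI)
  fix e :: real assume "e > 0"
  then have lim: "(\<lambda>n. prob {x \<in> space M. \<bar>X n x\<bar> > (e/2) * 1} + prob {x \<in> space M. \<bar>Y n x\<bar> > (e/2) * 1}) \<longlonglongrightarrow> 0 + 0"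
    (is "?S \<longlonglongrightarrow> _")
    using X[unfolded small_o_p_def, rule_format, of "e/2"] Y[unfolded small_o_p_def, rule_format, of "e/2"]
    by (intro tendsto_add) auto
  have le: "prob {x \<in> space M. \<bar>X n x + Y n x\<bar> > e * 1} \<le>
      prob {x \<in> space M. \<bar>X n x\<bar> > (e/2) * 1} + prob {x \<in> space M. \<bar>Y n x\<bar> > (e/2) * 1}" for n
  proof -
    have "prob {x \<in> space M. \<bar>X n x + Y n x\<bar> > e * 1} \<le>
        prob ({x \<in> space M. \<bar>X n x\<bar> > (e/2) * 1} \<union> {x \<in> space M. \<bar>Y n x\<bar> > (e/2) * 1})"
      by (intro finite_measure_mono) auto
    also have "\<dots> \<le> prob {x \<in> space M. \<bar>X n x\<bar> > (e/2) * 1} + prob {x \<in> space M. \<bar>Y n x\<bar> > (e/2) * 1}"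
      by (intro measure_Un_le) measurable
    finally show ?thesis .
  qed
  show "(\<lambda>n. prob {x \<in> space M. \<bar>X n x + Y n x\<bar> > e * 1}) \<longlonglongrightarrow> 0"
  proof (rule Lim_null_comparison)
    show "?S \<longlonglongrightarrow> 0" using lim by (simp only: add_0)
    show "\<forall>\<^sub>F n in sequentially. norm (prob {x \<in> space M. \<bar>X n x + Y n x\<bar> > e * 1}) \<le> ?S n"
      using le by (intro always_eventually allI) (simp only: real_norm_def abs_of_nonneg measure_nonneg)
  qed
qed

lemma small_o_p_rescale:
  assumes A: "small_o_p M A r" and "c > 0" and le: "\<And>n. n > 0 \<Longrightarrow> b n * r n \<le> c" and b: "\<And>n. 0 \<le> b n"
    and [measurable]: "\<And>n. A n \<in> borel_measurable M"
  shows "small_o_p M (\<lambda>n x. b n * A n x) (\<lambda>_. 1)"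
  unfolding small_o_p_def
proof (intro allI impI)
  fix e :: real assume "e > 0"
  then have "e / c > 0" using \<open>c > 0\<close> by simp
  have lim: "(\<lambda>n. prob {x \<in> space M. \<bar>A n x\<bar> > (e / c) * r n}) \<longlonglongrightarrow> 0"
    by (rule A[unfolded small_o_p_def, rule_format, OF \<open>e / c > 0\<close>])
  have ev: "eventually (\<lambda>n. prob {x \<in> space M. \<bar>b n * A n x\<bar> > e * 1} \<le> prob {x \<in> space M. \<bar>A n x\<bar> > (e / c) * r n}) sequentially"
    using eventually_gt_at_top[of 0]
  proof eventually_elim
    case (elim n)
    show ?case
    proof (rule finite_measure_mono)
      show "{x \<in> space M. \<bar>b n * A n x\<bar> > e * 1} \<subseteq> {x \<in> space M. \<bar>A n x\<bar> > (e / c) * r n}"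
      proof safe
        fix x assume "\<bar>b n * A n x\<bar> > e * 1"
        then have *: "e < b n * \<bar>A n x\<bar>" using b[of n] by (simp add: abs_mult)
        show "\<bar>A n x\<bar> > (e / c) * r n"
        proof (rule ccontr)
          assume "\<not> \<bar>A n x\<bar> > (e / c) * r n"
          then have "b n * \<bar>A n x\<bar> \<le> b n * ((e / c) * r n)"
            using b[of n] by (intro mult_left_mono) auto
          also have "\<dots> = (e / c) * (b n * r n)" by simp
          also have "\<dots> \<le> (e / c) * c" using le[OF elim] \<open>e / c > 0\<close> by (intro mult_left_mono) auto
          finally show False using * \<open>c > 0\<close> by simp
        qed
      qed
    qed measurable
  qed
  show "(\<lambda>n. prob {x \<in> space M. \<bar>b n * A n x\<bar> > e * 1}) \<longlonglongrightarrow> 0"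
  proof (rule Lim_null_comparison[OF _ lim])
    show "\<forall>\<^sub>F n in sequentially. norm (prob {x \<in> space M. \<bar>b n * A n x\<bar> > e * 1}) \<le> prob {x \<in> space M. \<bar>A n x\<bar> > (e / c) * r n}"
      using ev by eventually_elim (simp only: real_norm_def abs_of_nonneg measure_nonneg)
  qed
qed

text \<open>The function a -> exp (- s a^2) is Lipschitz on a \<ge> 0, although a^2 is not. Hence
  closeness of the norms in probability suffices, without tightness of the unperturbed
  sequence.\<close>

lemma laplace_transform_perturbation:
  fixes u v :: "nat \<Rightarrow> 'a \<Rightarrow> real"
  assumes [measurable]: "\<And>n. u n \<in> borel_measurable M" "\<And>n. v n \<in> borel_measurable M" "\<And>n. \<Delta> n \<in> borel_measurable M"
    and nonneg: "\<And>n x. 0 \<le> u n x" "\<And>n x. 0 \<le> v n x"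
    and close: "\<And>n x. \<bar>u n x - v n x\<bar> \<le> \<Delta> n x"
    and small: "small_o_p M \<Delta> (\<lambda>_. 1)" and "0 \<le> s"
    and lim: "(\<lambda>n. \<integral>x. exp (- (s * (v n x)\<^sup>2)) \<partial>M) \<longlonglongrightarrow> L"
  shows "(\<lambda>n. \<integral>x. exp (- (s * (u n x)\<^sup>2)) \<partial>M) \<longlonglongrightarrow> L"
proof -
  define \<omega> where "\<omega> d = (2 * s + 1) * d" for d :: real
  have mono: "exp (- (s * b\<^sup>2)) - exp (- (s * a\<^sup>2)) \<le> \<omega> d" if "0 \<le> b" "b \<le> a" "a - b \<le> d" "d \<le> 1" for a b d
  proof -
    have split: "exp (- (s * a\<^sup>2)) = exp (- (s * b\<^sup>2)) * exp (- (s * (a\<^sup>2 - b\<^sup>2)))"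
      by (simp add: exp_add[symmetric] algebra_simps)
    have "1 - exp (- (s * (a\<^sup>2 - b\<^sup>2))) \<le> s * (a\<^sup>2 - b\<^sup>2)"
      using exp_ge_add_one_self[of "- (s * (a\<^sup>2 - b\<^sup>2))"] by linarith
    also have "s * (a\<^sup>2 - b\<^sup>2) = s * ((a - b) * (2 * b + (a - b)))"
      by (simp add: power2_eq_square algebra_simps)
    also have "\<dots> \<le> s * (d * (2 * b + 1))"
      using that \<open>0 \<le> s\<close> by (intro mult_left_mono mult_mono) auto
    finally have 1: "1 - exp (- (s * (a\<^sup>2 - b\<^sup>2))) \<le> s * (d * (2 * b + 1))" .
    \<comment> \<open>The factor 2 b + 1, which comes from a^2 - b^2 and grows with b, is absorbed
      by exp (- s b^2): exp t \<ge> 1 + t reduces the claim to a polynomial inequality, and the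
      square (b - 1)^2 takes care of the linear term.\<close>
    have 2: "exp (- (s * b\<^sup>2)) * (s * (2 * b + 1)) \<le> 2 * s + 1"
    proof -
      have "1 + s * b\<^sup>2 \<le> exp (s * b\<^sup>2)" by (rule exp_ge_add_one_self)
      then have "(2 * s + 1) * (1 + s * b\<^sup>2) \<le> (2 * s + 1) * exp (s * b\<^sup>2)"
        using \<open>0 \<le> s\<close> by (intro mult_left_mono) auto
      moreover have "s * (2 * b + 1) \<le> (2 * s + 1) * (1 + s * b\<^sup>2)"
      proof -
        have "0 \<le> s * (b - 1)\<^sup>2" "0 \<le> s * s * b\<^sup>2" using \<open>0 \<le> s\<close> by auto
        then show ?thesis by (simp add: power2_eq_square algebra_simps)
      qed
      ultimately have "s * (2 * b + 1) \<le> (2 * s + 1) * exp (s * b\<^sup>2)" by linarith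
      then show ?thesis by (simp add: exp_minus field_simps)
    qed
    have "exp (- (s * b\<^sup>2)) - exp (- (s * a\<^sup>2)) = exp (- (s * b\<^sup>2)) * (1 - exp (- (s * (a\<^sup>2 - b\<^sup>2))))"
      unfolding split by (simp add: algebra_simps)
    also have "\<dots> \<le> exp (- (s * b\<^sup>2)) * (s * (d * (2 * b + 1)))" using 1 by (intro mult_left_mono) auto
    also have "\<dots> = (exp (- (s * b\<^sup>2)) * (s * (2 * b + 1))) * d" by (simp add: mult_ac)
    also have "\<dots> \<le> \<omega> d" unfolding \<omega>_def using 2 that by (intro mult_right_mono) auto
    finally show ?thesis .
  qed
  have lip: "\<bar>exp (- (s * a\<^sup>2)) - exp (- (s * b\<^sup>2))\<bar> \<le> \<omega> d" if "0 \<le> a" "0 \<le> b" "\<bar>a - b\<bar> \<le> d" "d \<le> 1" for a b d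
  proof (cases "b \<le> a")
    case True
    then have "exp (- (s * a\<^sup>2)) \<le> exp (- (s * b\<^sup>2))" using that \<open>0 \<le> s\<close> by (simp add: mult_left_mono power_mono)
    then show ?thesis using mono[of b a d] True that by auto
  next
    case False
    then have "exp (- (s * b\<^sup>2)) \<le> exp (- (s * a\<^sup>2))" using that \<open>0 \<le> s\<close> by (simp add: mult_left_mono power_mono)
    then show ?thesis using mono[of a b d] False that by auto
  qed
  have int: "integrable M (\<lambda>x. exp (- (s * (w n x)\<^sup>2)))" if [measurable]: "\<And>n. w n \<in> borel_measurable M" for w :: "nat \<Rightarrow> 'a \<Rightarrow> real" and n
    using \<open>0 \<le> s\<close> by (intro integrable_const_bound[where B = 1]) auto
  have bound: "\<bar>(\<integral>x. exp (- (s * (u n x)\<^sup>2)) \<partial>M) - (\<integral>x. exp (- (s * (v n x)\<^sup>2)) \<partial>M)\<bar> \<le>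
      \<omega> d + prob {x \<in> space M. \<bar>\<Delta> n x\<bar> > d * 1}" if "0 < d" "d \<le> 1" for d n
  proof -
    define E where "E = {x \<in> space M. \<bar>\<Delta> n x\<bar> > d * 1}"
    have E [measurable]: "E \<in> sets M" unfolding E_def by measurable
    have intE: "integrable M (indicator E :: _ \<Rightarrow> real)"
      using E by (intro integrable_const_bound[where B = 1]) auto
    have "\<bar>(\<integral>x. exp (- (s * (u n x)\<^sup>2)) - exp (- (s * (v n x)\<^sup>2)) \<partial>M)\<bar>
        \<le> (\<integral>x. \<bar>exp (- (s * (u n x)\<^sup>2)) - exp (- (s * (v n x)\<^sup>2))\<bar> \<partial>M)"
      by (rule integral_abs_bound)
    also have "\<dots> \<le> (\<integral>x. \<omega> d + indicator E x \<partial>M)"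
    proof (rule integral_mono)
      fix x assume x: "x \<in> space M"
      show "\<bar>exp (- (s * (u n x)\<^sup>2)) - exp (- (s * (v n x)\<^sup>2))\<bar> \<le> \<omega> d + indicator E x"
      proof (cases "\<bar>\<Delta> n x\<bar> > d")
        case True
        have "0 \<le> \<omega> d" unfolding \<omega>_def using that \<open>0 \<le> s\<close> by simp
        moreover have "0 < exp (- (s * w\<^sup>2)) \<and> exp (- (s * w\<^sup>2)) \<le> 1" for w using \<open>0 \<le> s\<close> by simp
        from this[of "u n x"] this[of "v n x"]
        have "\<bar>exp (- (s * (u n x)\<^sup>2)) - exp (- (s * (v n x)\<^sup>2))\<bar> \<le> 1" by linarith
        ultimately show ?thesis using True x unfolding E_def by simp
      next
        case False
        then show ?thesis using lip[of "u n x" "v n x" d] nonneg close[of n x] that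
          by (simp add: E_def)
      qed
    qed (use int[of u] int[of v] intE in auto)
    also have "\<dots> = \<omega> d + prob E"
      using intE E by (simp add: prob_space)
    finally show ?thesis using int[of u] int[of v] by (simp add: E_def)
  qed
  have "(\<lambda>n. (\<integral>x. exp (- (s * (u n x)\<^sup>2)) \<partial>M) - (\<integral>x. exp (- (s * (v n x)\<^sup>2)) \<partial>M)) \<longlonglongrightarrow> 0"
  proof (rule LIMSEQ_I)
    fix r :: real assume "r > 0"
    define d where "d = min 1 (r / (2 * (2 * s + 1)))"
    have d: "0 < d" "d \<le> 1" unfolding d_def using \<open>r > 0\<close> \<open>0 \<le> s\<close> by auto
    have "\<omega> d \<le> (2 * s + 1) * (r / (2 * (2 * s + 1)))"
      unfolding \<omega>_def d_def using \<open>0 \<le> s\<close> by (intro mult_left_mono) auto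
    also have "\<dots> = r / 2"
    proof -
      have "2 * s + 1 \<noteq> 0" using \<open>0 \<le> s\<close> by linarith
      then show ?thesis by (metis nonzero_mult_div_cancel_left times_divide_eq_right mult.commute divide_divide_eq_left)
    qed
    finally have \<omega>: "\<omega> d \<le> r / 2" .
    have "(\<lambda>n. prob {x \<in> space M. \<bar>\<Delta> n x\<bar> > d * 1}) \<longlonglongrightarrow> 0"
      by (rule small[unfolded small_o_p_def, rule_format, OF d(1)])
    from LIMSEQ_D[OF this, of "r / 2"] \<open>r > 0\<close> obtain n0 where
      n0: "\<And>n. n \<ge> n0 \<Longrightarrow> norm (prob {x \<in> space M. \<bar>\<Delta> n x\<bar> > d * 1} - 0) < r / 2" by auto
    have "norm ((\<integral>x. exp (- (s * (u n x)\<^sup>2)) \<partial>M) - (\<integral>x. exp (- (s * (v n x)\<^sup>2)) \<partial>M) - 0) < r" if "n \<ge> n0" for n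
      using n0[OF that] bound[OF d, of n] \<omega> unfolding real_norm_def diff_0_right by linarith
    then show "\<exists>n0. \<forall>n\<ge>n0. norm ((\<integral>x. exp (- (s * (u n x)\<^sup>2)) \<partial>M) - (\<integral>x. exp (- (s * (v n x)\<^sup>2)) \<partial>M) - 0) < r"
      by blast
  qed
  from tendsto_add[OF this lim] show ?thesis by simp
qed

end

text \<open>Cauchy-Schwarz, with equality at v / |v|. For v = 0 there may be no unit vector at all;
  the supremum in [0, \<infinity>] is 0 in either case.\<close>

lemma Sup_unit_sphere_inner_square:
  fixes v :: "'h::real_inner"
  shows "enn2real (SUP w\<in>{w. norm w = 1}. ennreal ((w \<bullet> v)\<^sup>2)) = (norm v)\<^sup>2"
proof (cases "v = 0")
  case True
  have "(SUP w\<in>{w :: 'h. norm w = 1}. ennreal ((w \<bullet> v)\<^sup>2)) \<le> 0"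
    using True by (intro SUP_least) simp
  then show ?thesis using True by simp
next
  case False
  have "(SUP w\<in>{w. norm w = 1}. ennreal ((w \<bullet> v)\<^sup>2)) = ennreal ((norm v)\<^sup>2)"
  proof (rule antisym)
    show "(SUP w\<in>{w. norm w = 1}. ennreal ((w \<bullet> v)\<^sup>2)) \<le> ennreal ((norm v)\<^sup>2)"
    proof (intro SUP_least ennreal_leI)
      fix w :: 'h assume "w \<in> {w. norm w = 1}"
      then have "\<bar>w \<bullet> v\<bar> \<le> norm v" using Cauchy_Schwarz_ineq2[of w v] by simp
      then show "(w \<bullet> v)\<^sup>2 \<le> (norm v)\<^sup>2" by (simp add: abs_le_square_iff[symmetric])
    qed
    define w where "w = (1 / norm v) *\<^sub>R v"
    have w: "norm w = 1" "w \<bullet> v = norm v"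
      unfolding w_def using False by (auto simp: dot_square_norm power2_eq_square)
    have "ennreal ((norm v)\<^sup>2) = ennreal ((w \<bullet> v)\<^sup>2)" using w by simp
    also have "\<dots> \<le> (SUP w\<in>{w. norm w = 1}. ennreal ((w \<bullet> v)\<^sup>2))"
      using w by (intro SUP_upper) simp
    finally show "ennreal ((norm v)\<^sup>2) \<le> (SUP w\<in>{w. norm w = 1}. ennreal ((w \<bullet> v)\<^sup>2))" .
  qed
  then show ?thesis by simp
qed

text \<open>Riesz applied to w -> E((v \<bullet> \<kappa>) (w \<bullet> \<kappa>)). This is what
  shows that the function prescribed for the image of v under \<open>T_sigma\<close> belongs to the
  Hilbert space.\<close>

lemma covariance_operator_exists:
  fixes \<kappa> :: "'p \<Rightarrow> 'h::{real_inner, complete_space, second_countable_topology}"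
  assumes [measurable]: "\<kappa> \<in> borel_measurable P" and sq: "integrable P (\<lambda>p. (norm (\<kappa> p))\<^sup>2)"
  shows "\<exists>t. \<forall>w. (\<integral>p. (v \<bullet> \<kappa> p) * (w \<bullet> \<kappa> p) \<partial>P) = t \<bullet> w"
proof (rule riesz_representation, rule bounded_linear_intro)
  have int: "integrable P (\<lambda>p. (v \<bullet> \<kappa> p) * (w \<bullet> \<kappa> p))" for w
    by (rule integrable_inner_mult[OF assms])
  show "(\<integral>p. (v \<bullet> \<kappa> p) * ((x + y) \<bullet> \<kappa> p) \<partial>P) =
      (\<integral>p. (v \<bullet> \<kappa> p) * (x \<bullet> \<kappa> p) \<partial>P) + (\<integral>p. (v \<bullet> \<kappa> p) * (y \<bullet> \<kappa> p) \<partial>P)" for x y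
    using int by (simp add: inner_add_left distrib_left)
  show "(\<integral>p. (v \<bullet> \<kappa> p) * ((r *\<^sub>R x) \<bullet> \<kappa> p) \<partial>P) = r *\<^sub>R (\<integral>p. (v \<bullet> \<kappa> p) * (x \<bullet> \<kappa> p) \<partial>P)" for r x
    by (simp add: mult.left_commute)
  show "norm (\<integral>p. (v \<bullet> \<kappa> p) * (x \<bullet> \<kappa> p) \<partial>P) \<le> norm x * (norm v * (\<integral>p. (norm (\<kappa> p))\<^sup>2 \<partial>P))" for x
  proof -
    have "norm (\<integral>p. (v \<bullet> \<kappa> p) * (x \<bullet> \<kappa> p) \<partial>P) \<le> (\<integral>p. norm ((v \<bullet> \<kappa> p) * (x \<bullet> \<kappa> p)) \<partial>P)"
      by (rule integral_norm_bound)
    also have "\<dots> \<le> (\<integral>p. norm x * norm v * (norm (\<kappa> p))\<^sup>2 \<partial>P)"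
    proof (rule integral_mono)
      show "norm ((v \<bullet> \<kappa> p) * (x \<bullet> \<kappa> p)) \<le> norm x * norm v * (norm (\<kappa> p))\<^sup>2" for p
        using mult_mono[OF Cauchy_Schwarz_ineq2[of v "\<kappa> p"] Cauchy_Schwarz_ineq2[of x "\<kappa> p"]]
        by (simp add: abs_mult power2_eq_square mult_ac)
    qed (use int sq in auto)
    finally show ?thesis by simp
  qed
qed

section \<open>Regression residuals\<close>

text \<open>Integrability is asked of the weighted product, because the weights used later, such as
  squared noise, are unbounded.\<close>

lemma (in prob_space) integral_real_cond_exp_vimage:
  fixes \<psi> :: "'b::topological_space \<Rightarrow> real"
  assumes U: "U \<in> borel_measurable M" and [measurable]: "\<psi> \<in> borel_measurable borel" "V \<in> borel_measurable M"
    and int: "integrable M (\<lambda>x. \<psi> (U x) * V x)"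
    and cond: "AE x in M. real_cond_exp M (vimage_algebra (space M) U borel) V x = v x"
    and [measurable]: "v \<in> borel_measurable M"
  shows "integrable M (\<lambda>x. \<psi> (U x) * v x)" and "(\<integral>x. \<psi> (U x) * V x \<partial>M) = (\<integral>x. \<psi> (U x) * v x \<partial>M)"
proof -
  interpret finite_measure_subalgebra M "vimage_algebra (space M) U borel"
    by (rule finite_measure_subalgebra_vimage[OF U])
  have [measurable]: "(\<lambda>x. \<psi> (U x)) \<in> borel_measurable M" using U by measurable
  have ae: "AE x in M. \<psi> (U x) * real_cond_exp M (vimage_algebra (space M) U borel) V x = \<psi> (U x) * v x"
    using cond by eventually_elim simp
  note intg = real_cond_exp_intg[OF int measurable_comp_vimage_algebra[of \<psi> borel U M]]
  show "integrable M (\<lambda>x. \<psi> (U x) * v x)"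
    by (rule integrable_cong_AE_imp[OF intg(1)]) (use ae in \<open>auto elim: eventually_mono\<close>)
  have "(\<integral>x. \<psi> (U x) * real_cond_exp M (vimage_algebra (space M) U borel) V x \<partial>M) = (\<integral>x. \<psi> (U x) * v x \<partial>M)"
    using ae by (intro integral_cong_AE) auto
  then show "(\<integral>x. \<psi> (U x) * V x \<partial>M) = (\<integral>x. \<psi> (U x) * v x \<partial>M)" using intg(2) by simp
qed

lemma borel_measurable_swap:
  fixes \<psi> :: "'b::second_countable_topology \<times> 'c::second_countable_topology \<Rightarrow> real"
  assumes "\<psi> \<in> borel_measurable borel"
  shows "(\<lambda>(z, x). \<psi> (x, z)) \<in> borel_measurable borel"
proof -
  have [measurable]: "\<psi> \<in> borel_measurable (borel \<Otimes>\<^sub>M borel)" using assms unfolding borel_prod .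
  have "(\<lambda>(z, x). \<psi> (x, z)) \<in> borel_measurable (borel \<Otimes>\<^sub>M borel)" by measurable
  then show ?thesis unfolding borel_prod .
qed

lemma measurable_coordinates:
  "xc \<in> borel_measurable (borel :: (real \<times> real \<times> 'c::second_countable_topology) measure)"
  "yc \<in> borel_measurable (borel :: (real \<times> real \<times> 'c) measure)"
  "zc \<in> borel_measurable (borel :: (real \<times> real \<times> 'c) measure)"
  by (intro borel_measurable_continuous_onI continuous_intros)+

lemma real_cond_exp_eps_eq_0:
  fixes P :: "(real \<times> real \<times> 'c::second_countable_topology) measure"
  assumes "prob_space P" and sets: "sets P = sets borel" and [measurable]: "r \<in> borel_measurable P"
    and h: "cond_exp_version P r zc h"
  shows "AE p in P. real_cond_exp P (vimage_algebra (space P) zc borel) (eps r h) p = 0"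
    and "integrable P (eps r h)"
proof -
  interpret prob_space P by fact
  have [measurable]: "zc \<in> borel_measurable P"
    using measurable_coordinates(3) by (simp cong: measurable_cong_sets add: sets measurable_cong_sets[OF sets refl])
  interpret F: finite_measure_subalgebra P "vimage_algebra (space P) zc borel"
    by (rule finite_measure_subalgebra_vimage) measurable
  from h have int: "integrable P r" and [measurable]: "h \<in> borel_measurable borel"
    and cond: "AE p in P. real_cond_exp P (vimage_algebra (space P) zc borel) r p = h (zc p)"
    unfolding cond_exp_version_def by auto
  have int_h: "integrable P (\<lambda>p. h (zc p))"
    by (rule integrable_cong_AE_imp[OF F.real_cond_exp_int(1)[OF int]]) (use cond in \<open>auto elim: eventually_mono\<close>)
  show "integrable P (eps r h)" unfolding eps_def[abs_def] using int int_h by simp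
  have "AE p in P. real_cond_exp P (vimage_algebra (space P) zc borel) (\<lambda>p. h (zc p)) p = h (zc p)"
    using int_h measurable_comp_vimage_algebra[of h borel zc P] by (intro F.real_cond_exp_F_meas) auto
  with F.real_cond_exp_diff[OF int int_h] cond
  show "AE p in P. real_cond_exp P (vimage_algebra (space P) zc borel) (eps r h) p = 0"
    unfolding eps_def[abs_def] by eventually_elim simp
qed

text \<open>The noise of one response and its square are functions of Z and that response only, so
  under conditional independence their conditional moments given Z persist when the other response
  is added.\<close>

lemma real_cond_exp_eps_given_other:
  fixes P :: "(real \<times> real \<times> 'c::second_countable_topology) measure"
    and r r' :: "real \<times> real \<times> 'c \<Rightarrow> real"
  assumes P: "prob_space P" and sets: "sets P = sets borel"
    and r [measurable]: "r \<in> borel_measurable P" "r' \<in> borel_measurable P"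
    and ci: "cond_indep_given P r r' zc" and h: "cond_exp_version P r' zc h"
  shows "AE p in P. real_cond_exp P (vimage_algebra (space P) (\<lambda>p. (zc p, r p)) borel) (eps r' h) p = 0"
    and "cond_exp_version P (\<lambda>p. (eps r' h p)\<^sup>2) zc s \<Longrightarrow>
      AE p in P. real_cond_exp P (vimage_algebra (space P) (\<lambda>p. (zc p, r p)) borel) (\<lambda>p. (eps r' h p)\<^sup>2) p = s (zc p)"
proof -
  interpret prob_space P by fact
  have zc [measurable]: "zc \<in> borel_measurable P"
    using measurable_coordinates(3) by (simp add: measurable_cong_sets[OF sets refl])
  have hm [measurable]: "h \<in> borel_measurable borel" using h unfolding cond_exp_version_def by simp
  have meas: "(\<lambda>(z, y). y - h z) \<in> borel_measurable (borel :: ('c \<times> real) measure)"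
    "(\<lambda>(z, y). (y - h z)\<^sup>2) \<in> borel_measurable (borel :: ('c \<times> real) measure)"
    unfolding borel_prod[symmetric] by measurable
  note eps0 = real_cond_exp_eps_eq_0[OF P sets r(2) h]
  show "AE p in P. real_cond_exp P (vimage_algebra (space P) (\<lambda>p. (zc p, r p)) borel) (eps r' h) p = 0"
    using cond_indep_real_cond_exp[OF r zc ci meas(1), of "\<lambda>_. 0"] eps0(1,2) unfolding eps_def[abs_def] by simp
  show "AE p in P. real_cond_exp P (vimage_algebra (space P) (\<lambda>p. (zc p, r p)) borel) (\<lambda>p. (eps r' h p)\<^sup>2) p = s (zc p)"
    if "cond_exp_version P (\<lambda>p. (eps r' h p)\<^sup>2) zc s"
    using cond_indep_real_cond_exp[OF r zc ci meas(2), of s] that unfolding eps_def cond_exp_version_def by simp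
qed

text \<open>The constant is any bound for the conditional variance \<open>v\<close>. Conditioning is
  on (covariate, response) while data pairs are (response, covariate), so test functions have to be
  swapped.\<close>

lemma conditional_noise_eps:
  fixes P :: "(real \<times> real \<times> 'c::second_countable_topology) measure"
    and r r' :: "real \<times> real \<times> 'c \<Rightarrow> real"
  assumes iid: "iid_sample M P W" and sets: "sets P = sets borel"
    and r [measurable]: "r \<in> borel_measurable P" "r' \<in> borel_measurable P"
    and ci: "cond_indep_given P r r' zc" and h: "cond_exp_version P r' zc h"
    and v: "cond_exp_version P (\<lambda>p. (eps r' h p)\<^sup>2) (\<lambda>p. (zc p, r p)) v" and bdd: "bounded (range v)"
  shows "\<exists>B. conditional_noise M P W borel (\<lambda>p. (r p, zc p)) (eps r' h) B"
proof -
  interpret iid_sample M P W by fact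
  interpret P: prob_space P by (rule prob_space_P)
  have zc [measurable]: "zc \<in> borel_measurable P"
    using measurable_coordinates(3) by (simp add: measurable_cong_sets[OF sets refl])
  have U: "(\<lambda>p. (zc p, r p)) \<in> borel_measurable P" by measurable
  obtain B where B: "\<And>u. \<bar>v u\<bar> \<le> B" using bdd unfolding bounded_iff by auto
  from v have sq: "integrable P (\<lambda>p. (eps r' h p)\<^sup>2)" and [measurable]: "v \<in> borel_measurable borel"
    and cond: "AE p in P. real_cond_exp P (vimage_algebra (space P) (\<lambda>p. (zc p, r p)) borel) (\<lambda>p. (eps r' h p)\<^sup>2) p = v (zc p, r p)"
    unfolding cond_exp_version_def by auto
  note eps0 = real_cond_exp_eps_eq_0[OF P.prob_space_axioms sets r(2) h]
  have [measurable]: "eps r' h \<in> borel_measurable P" using eps0(2) by simp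
  have vm [measurable]: "(\<lambda>p. v (zc p, r p)) \<in> borel_measurable P"
    by (rule measurable_compose[OF U]) measurable
  have bounded_int: "integrable P (\<lambda>p. \<psi> (r p, zc p) * w p)"
    if \<psi>: "\<psi> \<in> borel_measurable borel" "\<And>u. \<bar>\<psi> u\<bar> \<le> c" and w: "integrable P w" for \<psi> c and w :: "_ \<Rightarrow> real"
  proof (rule Bochner_Integration.integrable_bound)
    show "integrable P (\<lambda>p. c * w p)" using w by simp
    have "(\<lambda>p. \<psi> (r p, zc p)) \<in> borel_measurable P" using \<psi>(1) by measurable
    then show "(\<lambda>p. \<psi> (r p, zc p) * w p) \<in> borel_measurable P" using w by measurable
    show "AE p in P. norm (\<psi> (r p, zc p) * w p) \<le> norm (c * w p)"
      using \<psi>(2) by (auto simp: abs_mult intro!: mult_right_mono order_trans[OF \<psi>(2)])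
  qed
  have "conditional_noise M P W borel (\<lambda>p. (r p, zc p)) (eps r' h) B"
  proof unfold_locales
    show "(\<lambda>p. (r p, zc p)) \<in> borel_measurable P" by measurable
    show "eps r' h \<in> borel_measurable P" by measurable
    show "integrable P (\<lambda>p. (eps r' h p)\<^sup>2)" by (rule sq)
    show "0 \<le> B" using B[of undefined] by linarith
  next
    fix \<psi> :: "real \<times> 'c \<Rightarrow> real" and c
    assume \<psi>: "\<psi> \<in> borel_measurable borel" "\<And>u. \<bar>\<psi> u\<bar> \<le> c"
    show "(\<integral>p. \<psi> (r p, zc p) * eps r' h p \<partial>P) = 0"
      using P.integral_real_cond_exp_vimage(2)[OF U borel_measurable_swap[OF \<psi>(1)], of "eps r' h" "\<lambda>_. 0"]
        bounded_int[OF \<psi> eps0(2)] real_cond_exp_eps_given_other(1)[OF P.prob_space_axioms sets r ci h]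
      by simp
  next
    fix \<psi> :: "real \<times> 'c \<Rightarrow> real" and c
    assume \<psi>: "\<psi> \<in> borel_measurable borel" "\<And>u. 0 \<le> \<psi> u \<and> \<psi> u \<le> c"
    then have \<psi>_abs: "\<bar>\<psi> u\<bar> \<le> c" for u by (simp add: abs_of_nonneg)
    note int = bounded_int[OF \<psi>(1) \<psi>_abs]
    note cond_int = P.integral_real_cond_exp_vimage[OF U borel_measurable_swap[OF \<psi>(1)] _ _ cond vm, simplified, OF int[OF sq]]
    have "(\<integral>p. \<psi> (r p, zc p) * (eps r' h p)\<^sup>2 \<partial>P) = (\<integral>p. \<psi> (r p, zc p) * v (zc p, r p) \<partial>P)"
      by (rule cond_int(2))
    also have "\<dots> \<le> (\<integral>p. \<psi> (r p, zc p) * B \<partial>P)"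
    proof (rule integral_mono)
      show "integrable P (\<lambda>p. \<psi> (r p, zc p) * v (zc p, r p))" by (rule cond_int(1))
      show "integrable P (\<lambda>p. \<psi> (r p, zc p) * B)" by (rule int) simp
      show "\<psi> (r p, zc p) * v (zc p, r p) \<le> \<psi> (r p, zc p) * B" for p
        using \<psi>(2) B[of "(zc p, r p)"] by (intro mult_left_mono) auto
    qed
    finally show "(\<integral>p. \<psi> (r p, zc p) * (eps r' h p)\<^sup>2 \<partial>P) \<le> B * (\<integral>p. \<psi> (r p, zc p) \<partial>P)"
      by (simp add: mult.commute)
  qed
  then show ?thesis by blast
qed

text \<open>The variance bound is stated for bounded test functions, so \<eta>^2 is cut off at m;
  the resulting bound B E(\<eta>(U)^2) is uniform in m and survives monotone convergence. Taking
  \<eta>(U) to be the noise of the other response gives the square integrability of \<kappa>, as the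
  kernel is bounded.\<close>

lemma (in conditional_noise) integrable_product_square:
  assumes \<eta> [measurable]: "\<eta> \<in> borel_measurable S" and int: "integrable P (\<lambda>p. (\<eta> (U p))\<^sup>2)"
  shows "integrable P (\<lambda>p. (\<eta> (U p))\<^sup>2 * (\<xi> p)\<^sup>2)"
proof -
  define \<psi> where "\<psi> m u = min ((\<eta> u)\<^sup>2) (real m)" for m u
  define F where "F m p = \<psi> m (U p) * (\<xi> p)\<^sup>2" for m p
  interpret P: prob_space P by (rule prob_space_P)
  have \<psi>: "\<psi> m \<in> borel_measurable S" "0 \<le> \<psi> m u \<and> \<psi> m u \<le> real m" for m u
    unfolding \<psi>_def by auto
  have [measurable]: "(\<lambda>p. \<psi> m (U p)) \<in> borel_measurable P" for m
    using measurable_compose[OF U_measurable \<psi>(1)] .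
  have F_int: "integrable P (F m)" for m
  proof (rule Bochner_Integration.integrable_bound)
    show "integrable P (\<lambda>p. real m * (\<xi> p)\<^sup>2)" using \<xi>_square_integrable by simp
    show "AE p in P. norm (F m p) \<le> norm (real m * (\<xi> p)\<^sup>2)"
      unfolding F_def using \<psi>(2) by (auto simp: abs_mult intro!: mult_right_mono)
    show "F m \<in> borel_measurable P" unfolding F_def by measurable
  qed
  have F_le: "(\<integral>p. F m p \<partial>P) \<le> B * (\<integral>p. (\<eta> (U p))\<^sup>2 \<partial>P)" for m
  proof -
    have "(\<integral>p. F m p \<partial>P) \<le> B * (\<integral>p. \<psi> m (U p) \<partial>P)"
      unfolding F_def by (rule \<xi>_variance[OF \<psi>])
    also have "\<dots> \<le> B * (\<integral>p. (\<eta> (U p))\<^sup>2 \<partial>P)"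
    proof (intro mult_left_mono integral_mono)
      show "integrable P (\<lambda>p. \<psi> m (U p))"
        using \<psi>(2) by (intro P.integrable_const_bound[where B = "real m"]) auto
      show "\<psi> m (U p) \<le> (\<eta> (U p))\<^sup>2" for p unfolding \<psi>_def by simp
    qed (use int B_nonneg in auto)
    finally show ?thesis .
  qed
  have mono_F: "F m p \<le> F m' p" if "m \<le> m'" for m m' p
    unfolding F_def \<psi>_def using that by (intro mult_right_mono) auto
  then have "incseq (\<lambda>m. \<integral>p. F m p \<partial>P)"
    using F_int by (auto simp: incseq_def intro!: integral_mono)
  from incseq_convergent[OF this] F_le obtain L where L: "(\<lambda>m. \<integral>p. F m p \<partial>P) \<longlonglongrightarrow> L" by blast
  show ?thesis
  proof (rule integral_monotone_convergence_nonneg(1)[OF F_int _ _ _ L])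
    show "AE p in P. mono (\<lambda>n. F n p)" using mono_F by (auto simp: mono_def)
    show "AE p in P. 0 \<le> F i p" for i unfolding F_def using \<psi>(2) by auto
    show "AE p in P. (\<lambda>i. F i p) \<longlonglongrightarrow> (\<eta> (U p))\<^sup>2 * (\<xi> p)\<^sup>2"
    proof (rule AE_I2)
      fix p
      obtain m0 where m0: "(\<eta> (U p))\<^sup>2 \<le> real m0" using real_arch_simple by blast
      have "eventually (\<lambda>m. F m p = (\<eta> (U p))\<^sup>2 * (\<xi> p)\<^sup>2) sequentially"
        using eventually_ge_at_top[of m0]
        by eventually_elim (use m0 in \<open>simp add: F_def \<psi>_def min_absorb1\<close>)
      then show "(\<lambda>i. F i p) \<longlonglongrightarrow> (\<eta> (U p))\<^sup>2 * (\<xi> p)\<^sup>2" by (rule tendsto_eventually)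
    qed
  qed measurable
qed

section \<open>The feature map of the kernel\<close>

context rkhs
begin

definition feature :: "'a \<Rightarrow> 'h" where
  "feature z = (SOME k. fval k = K z \<and> (\<forall>w. fval w z = w \<bullet> k))"

lemma fval_feature: "fval (feature z) = K z" and fval_eq_inner: "fval w z = w \<bullet> feature z"
  using someI_ex[OF reproducing[of z]] unfolding feature_def by blast+

lemma norm_feature_square: "(norm (feature z))\<^sup>2 = K z z"
  unfolding power2_norm_eq_inner fval_eq_inner[symmetric] fval_feature ..

end

section \<open>The test statistic\<close>

theorem theorem21:
  fixes P :: "(real \<times> real \<times> (real ^ 'd)) measure"
    and M :: "'m measure"
    and W :: "nat \<Rightarrow> 'm \<Rightarrow> real \<times> real \<times> (real ^ 'd)"
    and f g sX sY :: "real ^ 'd \<Rightarrow> real"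
    and uf vg :: "(real ^ 'd) \<times> real \<Rightarrow> real"
    and fhat ghat :: "(real ^ 'd) estimator"
    and fval :: "'h::{real_inner, complete_space, second_countable_topology} \<Rightarrow> real ^ 'd \<Rightarrow> real"
    and K :: "real ^ 'd \<Rightarrow> real ^ 'd \<Rightarrow> real"
    and C :: real
    and N :: "'q measure"
    and Q :: "nat \<Rightarrow> 'q \<Rightarrow> real"
  assumes P: "prob_space P" "sets P = sets borel"
    and XY_integrable: "integrable P xc" "integrable P yc"
    and M: "prob_space M"
    and iid: "prob_space.indep_vars M (\<lambda>_. borel) W UNIV" "\<And>i. distr M borel (W i) = P"
    and rkhs: "rkhs fval K" "\<And>w. fval w \<in> borel_measurable borel"
    and f: "cond_exp_version P xc zc f"
    and g: "cond_exp_version P yc zc g"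
    and fhat: "regression_estimator fhat"
    and ghat: "regression_estimator ghat"
    and Af: "small_o_p M (mean_sq_error xc fhat f W) (\<lambda>n. real n powr (- 1/2))"
    and Ag: "small_o_p M (mean_sq_error yc ghat g W) (\<lambda>n. real n powr (- 1/2))"
    and uf: "cond_exp_version P (\<lambda>p. (eps xc f p)\<^sup>2) (\<lambda>p. (zc p, yc p)) uf" "bounded (range uf)"
    and vg: "cond_exp_version P (\<lambda>p. (eps yc g p)\<^sup>2) (\<lambda>p. (zc p, xc p)) vg" "bounded (range vg)"
    and nondegenerate: "0 < (\<integral>p. (eps xc f p)\<^sup>2 * (eps yc g p)\<^sup>2 \<partial>P)"
    and K_bounded: "C > 0" "\<And>z z'. \<bar>K z z'\<bar> \<le> C"
    and sX: "cond_exp_version P (\<lambda>p. (eps xc f p)\<^sup>2) zc sX"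
    and sY: "cond_exp_version P (\<lambda>p. (eps yc g p)\<^sup>2) zc sY"
    and null_hypothesis: "cond_indep_given P xc yc zc"
    and N: "prob_space N"
    and Q: "prob_space.indep_vars N (\<lambda>_. borel) Q UNIV"
           "\<And>i. distributed N lborel (Q i) std_normal_density"
  shows "let F = distr P borel zc; T = T_sigma fval K F sX sY in
         (\<forall>w z. fval (T w) z = sigma_form F sX sY (fval w) (K z)) \<and>
         (\<exists>lam. eigenvalue_sequence T lam) \<and>
         (\<forall>lam. eigenvalue_sequence T lam \<longrightarrow>
            (AE q in N. summable (\<lambda>i. lam i * (Q i q)\<^sup>2)) \<and>
            converges_in_distribution M (Psi_stat fval fhat ghat W)
              N (\<lambda>q. \<Sum>i. lam i * (Q i q)\<^sup>2))"
proof -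
  interpret P: prob_space P by (rule P(1))
  interpret M: prob_space M by (rule M)
  interpret rkhs fval K by (rule rkhs(1))
  have xyz [measurable]: "xc \<in> borel_measurable P" "yc \<in> borel_measurable P" "zc \<in> borel_measurable P"
    using measurable_coordinates by (simp_all add: measurable_cong_sets[OF P(2) refl])
  have [measurable]: "f \<in> borel_measurable borel" "g \<in> borel_measurable borel"
      "sX \<in> borel_measurable borel" "sY \<in> borel_measurable borel"
    using f g sX sY unfolding cond_exp_version_def by auto
  have fval_meas [measurable]: "fval w \<in> borel_measurable borel" for w by (rule rkhs(2))
  have feature_meas [measurable]: "feature \<in> borel_measurable borel"
  proof (rule borel_measurable_weakI)
    fix w
    have "(\<lambda>z. feature z \<bullet> w) = fval w" by (rule ext) (simp only: fval_eq_inner inner_commute)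
    then show "(\<lambda>z. feature z \<bullet> w) \<in> borel_measurable borel" using fval_meas[of w] by (simp only:)
  qed
  have feature_le: "(norm (feature z))\<^sup>2 \<le> C" for z
    unfolding norm_feature_square using K_bounded(2)[of z z] by simp
  then have norm_feature_le: "norm (feature z) \<le> sqrt C" for z by (simp add: real_le_rsqrt)
  have iid': "iid_sample M P W"
  proof unfold_locales
    show "M.indep_vars (\<lambda>_. P) W UNIV"
      using iid(1) unfolding M.indep_vars_def by (simp add: P(2) measurable_cong_sets[OF refl P(2)])
    show "distr M P (W i) = P" for i
      using iid(2)[of i] distr_cong[OF refl P(2), of M "W i" "W i"] by simp
  qed
  interpret iid_sample M P W by (rule iid')

  define F where "F = distr P borel zc"
  define T where "T = T_sigma fval K F sX sY"
  let ?ex = "eps xc f" and ?ey = "eps yc g"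
  have eps_meas [measurable]: "?ex \<in> borel_measurable P" "?ey \<in> borel_measurable P"
    unfolding eps_def[abs_def] by measurable
  \<comment> \<open>The observation is what the estimator of one response sees, the noise is that of
    the other response. The second instance is the mirror image and needs the symmetry of
    conditional independence.\<close>
  obtain B1 where noise1: "conditional_noise M P W borel (\<lambda>p. (xc p, zc p)) ?ey B1"
    using conditional_noise_eps[OF iid' P(2) xyz(1,2) null_hypothesis g vg] by blast
  obtain B2 where noise2: "conditional_noise M P W borel (\<lambda>p. (yc p, zc p)) ?ex B2"
    using conditional_noise_eps[OF iid' P(2) xyz(2,1) cond_indep_given_commute[OF null_hypothesis] f uf] by blast
  interpret n1: conditional_noise M P W borel "\<lambda>p. (xc p, zc p)" ?ey B1 by (rule noise1)
  interpret n2: conditional_noise M P W borel "\<lambda>p. (yc p, zc p)" ?ex B2 by (rule noise2)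

  have diff_meas: "(\<lambda>(x, z). x - f z) \<in> borel_measurable borel"
    unfolding borel_prod[symmetric] by measurable
  have prod_int: "integrable P (\<lambda>p. (?ex p)\<^sup>2 * (?ey p)\<^sup>2)"
    using n1.integrable_product_square[OF diff_meas] uf(1) unfolding cond_exp_version_def eps_def by simp
  have U: "(\<lambda>p. (zc p, xc p)) \<in> borel_measurable P" by measurable
  \<comment> \<open>The conditional variances are split off one at a time: given (Z, X) the squared
    noise of Y becomes \<open>sY\<close>, by the null hypothesis, and then given Z the squared noise
    of X becomes \<open>sX\<close>. For \<phi> a product of two elements of the space this turns
    \<open>sigma_form\<close> into a second moment of \<kappa>.\<close>
  have moment: "integrable P (\<lambda>p. \<phi> (zc p) * ((?ex p)\<^sup>2 * (?ey p)\<^sup>2))"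
      "(\<integral>z. \<phi> z * sX z * sY z \<partial>F) = (\<integral>p. \<phi> (zc p) * ((?ex p)\<^sup>2 * (?ey p)\<^sup>2) \<partial>P)"
    if \<phi> [measurable]: "\<phi> \<in> borel_measurable borel" and le: "\<And>z. \<bar>\<phi> z\<bar> \<le> c" for \<phi> c
  proof -
    show int: "integrable P (\<lambda>p. \<phi> (zc p) * ((?ex p)\<^sup>2 * (?ey p)\<^sup>2))"
    proof (rule Bochner_Integration.integrable_bound)
      show "integrable P (\<lambda>p. c * ((?ex p)\<^sup>2 * (?ey p)\<^sup>2))" using prod_int by simp
      show "AE p in P. norm (\<phi> (zc p) * ((?ex p)\<^sup>2 * (?ey p)\<^sup>2)) \<le> norm (c * ((?ex p)\<^sup>2 * (?ey p)\<^sup>2))"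
        using le by (auto simp: abs_mult intro!: mult_right_mono order_trans[OF le])
    qed measurable
    have 1: "(\<lambda>(z, x). \<phi> z * (x - f z)\<^sup>2) \<in> borel_measurable borel"
      unfolding borel_prod[symmetric] by measurable
    have 2: "(\<lambda>z. \<phi> z * sY z) \<in> borel_measurable borel" by measurable
    have eq: "(\<lambda>p. case (zc p, xc p) of (z, x) \<Rightarrow> \<phi> z * (x - f z)\<^sup>2) = (\<lambda>p. \<phi> (zc p) * (?ex p)\<^sup>2)"
      by (simp add: eps_def)
    have int1: "integrable P (\<lambda>p. (case (zc p, xc p) of (z, x) \<Rightarrow> \<phi> z * (x - f z)\<^sup>2) * (?ey p)\<^sup>2)"
      using int by (simp add: eps_def mult.assoc)
    note step1 = P.integral_real_cond_exp_vimage[OF U 1 _ int1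
        real_cond_exp_eps_given_other(2)[OF P xyz(1,2) null_hypothesis g sY]]
    have int2: "integrable P (\<lambda>p. \<phi> (zc p) * sY (zc p) * (?ex p)\<^sup>2)"
      using step1(1) by (simp add: eps_def mult_ac)
    have condX: "AE p in P. real_cond_exp P (vimage_algebra (space P) zc borel) (\<lambda>p. (?ex p)\<^sup>2) p = sX (zc p)"
      using sX unfolding cond_exp_version_def by simp
    note step2 = P.integral_real_cond_exp_vimage(2)[OF xyz(3) 2 _ int2 condX]
    have "(\<integral>p. \<phi> (zc p) * ((?ex p)\<^sup>2 * (?ey p)\<^sup>2) \<partial>P) = (\<integral>p. \<phi> (zc p) * sY (zc p) * (?ex p)\<^sup>2 \<partial>P)"
      using step1(2) by (simp add: eps_def mult_ac)
    also have "\<dots> = (\<integral>p. \<phi> (zc p) * sY (zc p) * sX (zc p) \<partial>P)" using step2 by simp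
    also have "\<dots> = (\<integral>z. \<phi> z * sX z * sY z \<partial>F)"
      unfolding F_def by (subst integral_distr) (auto simp: mult_ac)
    finally show "(\<integral>z. \<phi> z * sX z * sY z \<partial>F) = (\<integral>p. \<phi> (zc p) * ((?ex p)\<^sup>2 * (?ey p)\<^sup>2) \<partial>P)" by simp
  qed

  \<comment> \<open>Identification of the covariance operator\<close>
  define \<kappa> where "\<kappa> p = (?ex p * ?ey p) *\<^sub>R feature (zc p)" for p
  have inner_\<kappa>: "v \<bullet> \<kappa> p = (?ex p * ?ey p) * fval v (zc p)" for v p
    unfolding \<kappa>_def inner_scaleR_right by (rule arg_cong[OF fval_eq_inner[symmetric]])
  have \<kappa>_meas [measurable]: "\<kappa> \<in> borel_measurable P" unfolding \<kappa>_def by measurable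
  have \<kappa>_sq: "integrable P (\<lambda>p. (norm (\<kappa> p))\<^sup>2)"
    using moment(1)[of "\<lambda>z. (norm (feature z))\<^sup>2" C] feature_le
    unfolding \<kappa>_def by (simp add: power_mult_distrib mult_ac)
  have sigma: "sigma_form F sX sY (fval v) (fval w) = (\<integral>p. (v \<bullet> \<kappa> p) * (w \<bullet> \<kappa> p) \<partial>P)" for v w
  proof -
    have "\<bar>fval u z\<bar> \<le> norm u * sqrt C" for u z
    proof -
      have "\<bar>fval u z\<bar> = \<bar>u \<bullet> feature z\<bar>" by (rule arg_cong[OF fval_eq_inner])
      also have "\<dots> \<le> norm u * norm (feature z)" by (rule Cauchy_Schwarz_ineq2)
      also have "\<dots> \<le> norm u * sqrt C" by (intro mult_left_mono norm_feature_le norm_ge_zero)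
      finally show ?thesis .
    qed
    then have "\<bar>fval v z * fval w z\<bar> \<le> (norm v * sqrt C) * (norm w * sqrt C)" for z
      unfolding abs_mult using K_bounded(1) by (intro mult_mono) auto
    from moment(2)[of "\<lambda>z. fval v z * fval w z", OF _ this]
    show ?thesis unfolding sigma_form_def inner_\<kappa>
      by (simp add: power2_eq_square mult_ac)
  qed
  \<comment> \<open>The definition of \<open>T_sigma\<close> inverts \<open>fval\<close>, which is
    meaningful only on its range. An operator t with the prescribed function values is therefore
    produced first; injectivity of \<open>fval\<close> then identifies it with T.\<close>
  obtain t where t: "\<And>v w. (\<integral>p. (v \<bullet> \<kappa> p) * (w \<bullet> \<kappa> p) \<partial>P) = t v \<bullet> w"
    using covariance_operator_exists[OF \<kappa>_meas \<kappa>_sq] by metis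
  have fval_t: "fval (t w) z = sigma_form F sX sY (fval w) (K z)" for w z
  proof -
    have "fval (t w) z = t w \<bullet> feature z" by (rule fval_eq_inner)
    also have "\<dots> = sigma_form F sX sY (fval w) (fval (feature z))" by (simp only: t sigma)
    finally show ?thesis by (simp only: fval_feature)
  qed
  have T_t: "T w = t w" for w
  proof -
    have "fval (t w) = (\<lambda>z. sigma_form F sX sY (fval w) (K z))" using fval_t by auto
    then show ?thesis unfolding T_def T_sigma_def by (metis inv_f_f inj_fval)
  qed
  \<comment> \<open>The factor multiplying the noise of Y is a function of (Z, X), against which
    that noise is centred under the null hypothesis.\<close>
  have mean: "(\<integral>p. v \<bullet> \<kappa> p \<partial>P) = 0" for v
  proof -
    have 1: "(\<lambda>(z, x). (x - f z) * fval v z) \<in> borel_measurable borel"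
      unfolding borel_prod[symmetric] by measurable
    have "integrable P (\<lambda>p. (v \<bullet> \<kappa> p)\<^sup>2)"
      using integrable_inner_mult[OF \<kappa>_meas \<kappa>_sq, of v v] by (simp only: power2_eq_square)
    then have "integrable P (\<lambda>p. v \<bullet> \<kappa> p)"
      by (rule P.square_integrable_imp_integrable[rotated]) measurable
    then have int: "integrable P (\<lambda>p. (case (zc p, xc p) of (z, x) \<Rightarrow> (x - f z) * fval v z) * ?ey p)"
      unfolding inner_\<kappa> by (simp add: eps_def mult_ac)
    have "(\<integral>p. v \<bullet> \<kappa> p \<partial>P) = (\<integral>p. (case (zc p, xc p) of (z, x) \<Rightarrow> (x - f z) * fval v z) * ?ey p \<partial>P)"
      unfolding inner_\<kappa> by (simp add: eps_def mult_ac)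
    also have "\<dots> = 0"
      using P.integral_real_cond_exp_vimage(2)[OF U 1 _ int
        real_cond_exp_eps_given_other(1)[OF P xyz(1,2) null_hypothesis g]] by simp
    finally show ?thesis .
  qed
  interpret centered_sample M P W \<kappa> T
    by unfold_locales (simp_all add: \<kappa>_sq T_t t mean)

  \<comment> \<open>Errors of the fitted values\<close>
  have snd_meas [measurable]: "snd \<in> borel_measurable (borel :: (real \<times> (real ^ 'd)) measure)"
    by (intro borel_measurable_continuous_onI continuous_intros)
  have coord: "(\<lambda>D :: nat \<Rightarrow> real \<times> (real ^ 'd). snd (D i)) \<in> borel_measurable (PiM {..<n} (\<lambda>_. borel))" if "i < n" for i n
    by (rule measurable_compose[OF _ snd_meas]) (use that in simp)
  \<comment> \<open>The errors are written as functions of the data set alone, the form that weights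
    must have in the lemma on weighted noise.\<close>
  define a where "a n i D = f (snd (D i)) - fhat n D (snd (D i))" for n i and D :: "nat \<Rightarrow> real \<times> (real ^ 'd)"
  define b where "b n i D = g (snd (D i)) - ghat n D (snd (D i))" for n i and D :: "nat \<Rightarrow> real \<times> (real ^ 'd)"
  have a_meas: "a n i \<in> borel_measurable (PiM {..<n} (\<lambda>_. borel))" if "i < n" for n i
  proof -
    have "(\<lambda>D. fhat n D (snd (D i))) \<in> borel_measurable (PiM {..<n} (\<lambda>_. borel))"
      using fhat that unfolding regression_estimator_def by blast
    moreover have "(\<lambda>D :: nat \<Rightarrow> real \<times> (real ^ 'd). f (snd (D i))) \<in> borel_measurable (PiM {..<n} (\<lambda>_. borel))"
      by (rule measurable_compose[OF coord[OF that]]) simp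
    ultimately show ?thesis unfolding a_def by simp
  qed
  have b_meas: "b n i \<in> borel_measurable (PiM {..<n} (\<lambda>_. borel))" if "i < n" for n i
  proof -
    have "(\<lambda>D. ghat n D (snd (D i))) \<in> borel_measurable (PiM {..<n} (\<lambda>_. borel))"
      using ghat that unfolding regression_estimator_def by blast
    moreover have "(\<lambda>D :: nat \<Rightarrow> real \<times> (real ^ 'd). g (snd (D i))) \<in> borel_measurable (PiM {..<n} (\<lambda>_. borel))"
      by (rule measurable_compose[OF coord[OF that]]) simp
    ultimately show ?thesis unfolding b_def by simp
  qed
  define \<alpha> where "\<alpha> n i x = a n i (n1.data n x)" for n i x
  define \<beta> where "\<beta> n i x = b n i (n2.data n x)" for n i x
  have \<alpha>_meas [measurable]: "\<alpha> n i \<in> borel_measurable M" if "i < n" for n i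
    unfolding \<alpha>_def by (rule measurable_compose[OF n1.data_measurable a_meas[OF that]])
  have \<beta>_meas [measurable]: "\<beta> n i \<in> borel_measurable M" if "i < n" for n i
    unfolding \<beta>_def by (rule measurable_compose[OF n2.data_measurable b_meas[OF that]])
  have res: "residual xc fhat W n i x = ?ex (W i x) + \<alpha> n i x"
    "residual yc ghat W n i x = ?ey (W i x) + \<beta> n i x" if "i < n" for n i x
    using that unfolding residual_def fitted_def eps_def \<alpha>_def \<beta>_def a_def b_def n1.data_def n2.data_def by simp_all
  have mse: "mean_sq_error xc fhat f W n x = (1 / real n) * (\<Sum>i<n. (\<alpha> n i x)\<^sup>2)"
    "mean_sq_error yc ghat g W n x = (1 / real n) * (\<Sum>i<n. (\<beta> n i x)\<^sup>2)" for n x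
    unfolding mean_sq_error_def fitted_def \<alpha>_def \<beta>_def a_def b_def n1.data_def n2.data_def by simp_all
  have mse_meas [measurable]: "mean_sq_error xc fhat f W n \<in> borel_measurable M"
    "mean_sq_error yc ghat g W n \<in> borel_measurable M" for n
    unfolding mse[abs_def] by measurable
  \<comment> \<open>The assumed rate is used twice: it is at most 1, which serves the two terms
    linear in the errors, and it cancels the factor sqrt n in front of the product term.\<close>
  have rate: "1 * real n powr (- 1/2) \<le> 1" "sqrt C / 2 * sqrt (real n) * real n powr (- 1/2) \<le> sqrt C" if "n > 0" for n
  proof -
    have "real n powr (- 1/2) = 1 / sqrt (real n)"
      using that by (simp add: powr_minus powr_half_sqrt divide_simps)
    then show "1 * real n powr (- 1/2) \<le> 1" "sqrt C / 2 * sqrt (real n) * real n powr (- 1/2) \<le> sqrt C"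
      using that K_bounded(1) by simp_all
  qed
  have small1: "small_o_p M (mean_sq_error xc fhat f W) (\<lambda>_. 1)" "small_o_p M (mean_sq_error yc ghat g W) (\<lambda>_. 1)"
    using M.small_o_p_rescale[OF Af, of 1 "\<lambda>_. 1"] M.small_o_p_rescale[OF Ag, of 1 "\<lambda>_. 1"] rate(1) by simp_all

  \<comment> \<open>The three terms other than \<kappa> in the product (noise of X + \<alpha>)
    (noise of Y + \<beta>) of the residuals.\<close>
  define R1 where "R1 n x = (1 / sqrt (real n)) *\<^sub>R (\<Sum>i<n. (\<alpha> n i x * ?ey (W i x)) *\<^sub>R feature (zc (W i x)))" for n x
  define R2 where "R2 n x = (1 / sqrt (real n)) *\<^sub>R (\<Sum>i<n. (\<beta> n i x * ?ex (W i x)) *\<^sub>R feature (zc (W i x)))" for n x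
  define R3 where "R3 n x = (1 / sqrt (real n)) *\<^sub>R (\<Sum>i<n. (\<alpha> n i x * \<beta> n i x) *\<^sub>R feature (zc (W i x)))" for n x
  \<comment> \<open>Here sqrt C bounds the norm of the features, 1/2 comes from |\<alpha> \<beta>|
    \<le> (\<alpha>^2 + \<beta>^2) / 2, and sqrt n is the normalisation n^(-1/2) times the n that
    turns means into sums.\<close>
  define c where "c n = sqrt C / 2 * sqrt (real n)" for n
  define \<Delta> where "\<Delta> n x = norm (R1 n x) + norm (R2 n x) +
    (c n * mean_sq_error xc fhat f W n x + c n * mean_sq_error yc ghat g W n x)" for n x
  have R_meas [measurable]: "R1 n \<in> borel_measurable M" "R2 n \<in> borel_measurable M" "R3 n \<in> borel_measurable M" for n
    unfolding R1_def R2_def R3_def by measurable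
  have k_meas: "(\<lambda>u :: real \<times> (real ^ 'd). feature (snd u)) \<in> borel_measurable borel" by measurable
  have small_R1: "small_o_p M (\<lambda>n x. norm (R1 n x)) (\<lambda>_. 1)"
    using n1.weighted_noise_tendsto_0[OF k_meas feature_le a_meas] small1(1)
    unfolding R1_def \<alpha>_def mse[abs_def] by simp
  have small_R2: "small_o_p M (\<lambda>n x. norm (R2 n x)) (\<lambda>_. 1)"
    using n2.weighted_noise_tendsto_0[OF k_meas feature_le b_meas] small1(2)
    unfolding R2_def \<beta>_def mse[abs_def] by simp
  have small_mse: "small_o_p M (\<lambda>n x. c n * mean_sq_error xc fhat f W n x) (\<lambda>_. 1)"
    "small_o_p M (\<lambda>n x. c n * mean_sq_error yc ghat g W n x) (\<lambda>_. 1)"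
    using rate(2) K_bounded(1) unfolding c_def
    by (intro M.small_o_p_rescale[OF Af, where c = "sqrt C"] M.small_o_p_rescale[OF Ag, where c = "sqrt C"]; simp)+
  have small_\<Delta>: "small_o_p M \<Delta> (\<lambda>_. 1)"
    unfolding \<Delta>_def[abs_def]
    by (intro M.small_o_p_add small_R1 small_R2 small_mse) measurable
  have \<Delta>_meas [measurable]: "\<Delta> n \<in> borel_measurable M" for n unfolding \<Delta>_def by measurable

  define Vh where "Vh n x = (1 / sqrt (real n)) *\<^sub>R
    (\<Sum>i<n. (residual xc fhat W n i x * residual yc ghat W n i x) *\<^sub>R feature (zc (W i x)))" for n x
  have Vh_eq: "Vh n x = V n x + R1 n x + R2 n x + R3 n x" for n x
  proof -
    have "(\<Sum>i<n. (residual xc fhat W n i x * residual yc ghat W n i x) *\<^sub>R feature (zc (W i x))) =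
      (\<Sum>i<n. \<kappa> (W i x) + (\<alpha> n i x * ?ey (W i x)) *\<^sub>R feature (zc (W i x)) +
        (\<beta> n i x * ?ex (W i x)) *\<^sub>R feature (zc (W i x)) + (\<alpha> n i x * \<beta> n i x) *\<^sub>R feature (zc (W i x)))"
      by (intro sum.cong refl) (simp add: res \<kappa>_def algebra_simps flip: scaleR_add_left)
    then show ?thesis unfolding Vh_def V_def R1_def R2_def R3_def
      by (simp add: sum.distrib scaleR_add_right)
  qed
  have Vh_meas [measurable]: "Vh n \<in> borel_measurable M" for n
    unfolding Vh_eq[abs_def] by measurable
  have R3_le: "norm (R3 n x) \<le> c n * mean_sq_error xc fhat f W n x + c n * mean_sq_error yc ghat g W n x" for n x
  proof (cases "n = 0")
    case True
    then show ?thesis by (simp add: R3_def c_def)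
  next
    case False
    have "0 \<le> 1 / sqrt (real n)" by simp
    have "norm (\<Sum>i<n. (\<alpha> n i x * \<beta> n i x) *\<^sub>R feature (zc (W i x))) \<le>
        (\<Sum>i<n. ((\<alpha> n i x)\<^sup>2 + (\<beta> n i x)\<^sup>2) / 2 * sqrt C)"
    proof (rule sum_norm_le)
      fix i
      have "\<bar>\<alpha> n i x * \<beta> n i x\<bar> \<le> ((\<alpha> n i x)\<^sup>2 + (\<beta> n i x)\<^sup>2) / 2"
        using sum_squares_bound[of "\<bar>\<alpha> n i x\<bar>" "\<bar>\<beta> n i x\<bar>"] by (simp add: abs_mult)
      then show "norm ((\<alpha> n i x * \<beta> n i x) *\<^sub>R feature (zc (W i x))) \<le> ((\<alpha> n i x)\<^sup>2 + (\<beta> n i x)\<^sup>2) / 2 * sqrt C"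
        unfolding norm_scaleR by (intro mult_mono norm_feature_le) auto
    qed
    also have "\<dots> = sqrt C / 2 * ((\<Sum>i<n. (\<alpha> n i x)\<^sup>2) + (\<Sum>i<n. (\<beta> n i x)\<^sup>2))"
      by (simp add: sum.distrib sum_divide_distrib sum_distrib_left add_divide_distrib algebra_simps)
    finally have "norm (R3 n x) \<le> (1 / sqrt (real n)) * (sqrt C / 2 * ((\<Sum>i<n. (\<alpha> n i x)\<^sup>2) + (\<Sum>i<n. (\<beta> n i x)\<^sup>2)))"
      unfolding R3_def norm_scaleR abs_of_nonneg[OF \<open>0 \<le> 1 / sqrt (real n)\<close>]
      by (rule mult_left_mono) simp
    also have "\<dots> = c n * mean_sq_error xc fhat f W n x + c n * mean_sq_error yc ghat g W n x"
    proof -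
      have "1 / sqrt (real n) = sqrt (real n) * (1 / real n)"
        using False by (simp add: real_div_sqrt field_simps)
      then show ?thesis unfolding c_def mse by (simp add: algebra_simps)
    qed
    finally show ?thesis .
  qed
  have close: "\<bar>norm (Vh n x) - norm (V n x)\<bar> \<le> \<Delta> n x" for n x
  proof -
    have "\<bar>norm (Vh n x) - norm (V n x)\<bar> \<le> norm (Vh n x - V n x)" by (rule norm_triangle_ineq3)
    also have "Vh n x - V n x = R1 n x + R2 n x + R3 n x" unfolding Vh_eq by simp
    also have "norm (R1 n x + R2 n x + R3 n x) \<le> norm (R1 n x) + norm (R2 n x) + norm (R3 n x)"
      by (intro order_trans[OF norm_triangle_ineq] add_mono norm_triangle_ineq order_refl)
    also have "\<dots> \<le> \<Delta> n x" unfolding \<Delta>_def using R3_le[of n x] by simp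
    finally show ?thesis .
  qed
  have Psi: "Psi_stat fval fhat ghat W n x = (norm (Vh n x))\<^sup>2" for n x
  proof -
    have "S_stat fval fhat ghat W n x w = w \<bullet> Vh n x" for w
      unfolding S_stat_def Vh_def by (simp add: inner_sum_right fval_eq_inner[symmetric] mult_ac)
    then show ?thesis unfolding Psi_stat_def by (simp add: Sup_unit_sphere_inner_square)
  qed

  \<comment> \<open>The limit distribution\<close>
  have normal: "std_normal_sequence N Q"
    using N Q by (simp add: std_normal_sequence_def std_normal_sequence_axioms_def)
  interpret NQ: std_normal_sequence N Q by (rule normal)
  have limit: "(AE q in N. summable (\<lambda>i. lam i * (Q i q)\<^sup>2)) \<and>
      converges_in_distribution M (Psi_stat fval fhat ghat W) N (\<lambda>q. \<Sum>i. lam i * (Q i q)\<^sup>2)"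
    if lam: "eigenvalue_sequence T lam" for lam
    unfolding converges_in_distribution_def Psi[abs_def]
  proof (intro conjI allI)
    show "AE q in N. summable (\<lambda>i. lam i * (Q i q)\<^sup>2)"
      by (rule laplace_transform_norm_square(1)[OF normal lam order_refl])
    show "weak_conv_m (\<lambda>n. distr M borel (\<lambda>x. (norm (Vh n x))\<^sup>2)) (distr N borel (\<lambda>q. \<Sum>i. lam i * (Q i q)\<^sup>2))"
    proof (rule laplace_transform_imp_weak_conv[OF M N])
      show "AE q in N. 0 \<le> (\<Sum>i. lam i * (Q i q)\<^sup>2)"
        by (rule laplace_transform_norm_square(2)[OF normal lam order_refl])
      show "(\<lambda>n. \<integral>x. exp (- (s * (norm (Vh n x))\<^sup>2)) \<partial>M) \<longlonglongrightarrow> (\<integral>q. exp (- (s * (\<Sum>i. lam i * (Q i q)\<^sup>2))) \<partial>N)"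
        if "0 \<le> s" for s
        by (rule M.laplace_transform_perturbation[OF _ _ _ _ _ close small_\<Delta> that
              laplace_transform_norm_square(3)[OF normal lam that]]) simp_all
    qed measurable
  qed measurable
  have "fval (T w) z = sigma_form F sX sY (fval w) (K z)" for w z
    unfolding T_t by (rule fval_t)
  then show ?thesis
    unfolding Let_def F_def[symmetric] T_def[symmetric]
    using eigenvalue_sequence_exists limit by blast
qed

end
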